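(* Let $G$ be a given bounded measurable function on $\mathcal{T}=\mathbb{R}/2\pi\mathbb{Z}$ (also regarded as a $2\pi$-periodic function on $\mathbb{R}$). The Cauchy problem for the nonlinear wave equation $$\left(\frac{\partial}{\partial t}-\frac{\partial}{\partial x}\right)g(x,t)=-\delta(x)u(t),\qquad u(t)=\operatorname{sign} g(0,t),\qquad g(x,0)=G(x),$$ on $x\in\mathcal{T}$, has a unique bounded solution for $t\ge 0$. Moreover, with $\phi(t)=g(0,t)$, the function $\phi$ (together with $v=u$) forms the only solution of the equation $$\phi(t)+\frac12 v(t)+\sum_{k\in\mathbb{Z},\ k\ne 0,\ 2k\pi\in[-t,0]}v(t+2k\pi)=G(t),\qquad v=\operatorname{sign}\phi,\qquad t\ge 0,$$ where $G$ is given and the functions $v$ and $\phi$ are unknown. In these equations the function $\operatorname{sign}$ is interpreted as multivalued, with $\operatorname{sign}(0)=[-1,1]$.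
   Context: $\delta$ is the Dirac delta at $x=0$ on the torus $\mathcal{T}$. The equation $v=\operatorname{sign}\phi$ means $v(t)\in\operatorname{sign}(\phi(t))$ for a.e. $t$, where $\operatorname{sign}(y)=\{1\}$ for $y>0$, $\{-1\}$ for $y<0$, $\operatorname{sign}(0)=[-1,1]$; similarly $u(t)=\operatorname{sign}g(0,t)$ means $u(t)\in\operatorname{sign}(g(0,t))$ for a.e. $t$. All functions are measurable and identified when equal almost everywhere. A bounded solution is a bounded measurable function $g$ on $\mathcal{T}\times[0,\infty)$, together with a measurable $u$, satisfying the differential equation in the sense of distributions, with $t\mapsto g(\cdot,t)$ continuous with values in distributions on $\mathcal{T}$ and $g(\cdot,0)=G$. Equivalently, for each $t\ge0$, as an equality of distributions in $z\in\mathcal{T}$ and not pointwise, $g(z,t)=G(z+t)-\sum_{k}u(z+t+2k\pi)$, the sum being over $k\in\mathbb{Z}$ with $z+2k\pi\in[-t,0]$. The value $g(0,t)$ is the half-sum $\frac12(g(0+,t)+g(0-,t))$ of the one-sided traces of $g$ at $x=0$, which exist as bounded measurable functions of $t$ because on $(0,2\pi)\times(0,\infty)$ the function $g$ depends only on $x+t$. *)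

theory Defs
  imports "HOL-Analysis.Analysis"
begin

text \<open>Functions on the torus \<open>\<real>/2\<pi>\<int>\<close> are represented by \<open>2\<pi>\<close>-periodic functions on \<open>\<real>\<close>,
  functions of \<open>(x, t)\<close> by functions on \<open>real \<times> real\<close> of which only the values with \<open>t \<ge> 0\<close> matter.
  Measurable means Lebesgue measurable.\<close>

definition periodic :: "(real \<Rightarrow> real) \<Rightarrow> bool" where
  "periodic f \<longleftrightarrow> (\<forall>x. f (x + 2 * pi) = f x)"

definition msign :: "real \<Rightarrow> real set" where
  "msign y = (if y > 0 then {1} else if y < 0 then {-1} else {-1..1})"

primrec k_times_cont_diff :: "nat \<Rightarrow> ('a::euclidean_space \<Rightarrow> real) \<Rightarrow> bool" where
  "k_times_cont_diff 0 f \<longleftrightarrow> continuous_on UNIV f"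
| "k_times_cont_diff (Suc k) f \<longleftrightarrow>
     (\<exists>f'. (\<forall>x. (f has_derivative f' x) (at x)) \<and> (\<forall>v. k_times_cont_diff k (\<lambda>x. f' x v)))"

definition smooth :: "('a::euclidean_space \<Rightarrow> real) \<Rightarrow> bool" where
  "smooth f \<longleftrightarrow> (\<forall>k. k_times_cont_diff k f)"

text \<open>Test functions on (torus) \<open>\<times> (0, \<infinity>)\<close>; as the torus is compact, only the
  support in \<open>t\<close> has to be restricted.\<close>

definition test_function :: "(real \<times> real \<Rightarrow> real) \<Rightarrow> bool" where
  "test_function \<psi> \<longleftrightarrow> smooth \<psi> \<and> (\<forall>t. periodic (\<lambda>x. \<psi> (x, t))) \<and>
     (\<exists>a>0. \<exists>b. \<forall>x t. t \<notin> {a..b} \<longrightarrow> \<psi> (x, t) = 0)"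

text \<open>\<open>(\<partial>\<^sub>t - \<partial>\<^sub>x) g = - \<delta>(x) u(t)\<close> in the sense of distributions: both derivatives are moved to the
  test function, with a change of sign, and \<open>\<langle>\<delta>(x) u(t), \<psi>\<rangle> = \<integral> u(t) \<psi>(0, t) dt\<close>.\<close>

definition wave_equation :: "(real \<times> real \<Rightarrow> real) \<Rightarrow> (real \<Rightarrow> real) \<Rightarrow> bool" where
  "wave_equation g u \<longleftrightarrow> (\<forall>\<psi>. test_function \<psi> \<longrightarrow>
     (LINT p|lebesgue_on ({0..2 * pi} \<times> {0<..}).
        g p * (- frechet_derivative \<psi> (at p) (0, 1) + frechet_derivative \<psi> (at p) (1, 0)))
     = - (LINT t|lebesgue_on {0<..}. u t * \<psi> (0, t)))"

definition continuous_into_distributions :: "(real \<times> real \<Rightarrow> real) \<Rightarrow> bool" where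
  "continuous_into_distributions g \<longleftrightarrow> (\<forall>\<theta>. smooth \<theta> \<and> periodic \<theta> \<longrightarrow>
     continuous_on {0..} (\<lambda>t. LINT x|lebesgue_on {0..2 * pi}. g (x, t) * \<theta> x))"

text \<open>The one-sided traces \<open>g(0+, \<cdot>)\<close> and \<open>g(0-, \<cdot>)\<close>, as limits of \<open>g(x, \<cdot>)\<close> for \<open>x\<close> tending to \<open>0\<close>
  from one side. Convergence is in local \<open>L\<^sup>1\<close> and averaged over \<open>x\<close>, so that it does not depend on
  the values of \<open>g\<close> on null sets.\<close>

definition trace_right :: "(real \<times> real \<Rightarrow> real) \<Rightarrow> (real \<Rightarrow> real) \<Rightarrow> bool" where
  "trace_right g \<gamma> \<longleftrightarrow> \<gamma> \<in> borel_measurable (lebesgue_on {0..}) \<and> bounded (\<gamma> ` {0..}) \<and>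
     (\<forall>T>0. ((\<lambda>h. (1 / h) * (LINT p|lebesgue_on ({0..h} \<times> {0..T}). \<bar>g p - \<gamma> (snd p)\<bar>))
        \<longlongrightarrow> 0) (at_right 0))"

definition trace_left :: "(real \<times> real \<Rightarrow> real) \<Rightarrow> (real \<Rightarrow> real) \<Rightarrow> bool" where
  "trace_left g \<gamma> \<longleftrightarrow> \<gamma> \<in> borel_measurable (lebesgue_on {0..}) \<and> bounded (\<gamma> ` {0..}) \<and>
     (\<forall>T>0. ((\<lambda>h. (1 / h) * (LINT p|lebesgue_on ({-h..0} \<times> {0..T}). \<bar>g p - \<gamma> (snd p)\<bar>))
        \<longlongrightarrow> 0) (at_right 0))"

text \<open>\<open>\<phi>(t) = g(0, t)\<close> for almost every \<open>t\<close>.\<close>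

definition value_at_0 :: "(real \<times> real \<Rightarrow> real) \<Rightarrow> (real \<Rightarrow> real) \<Rightarrow> bool" where
  "value_at_0 g \<phi> \<longleftrightarrow> (\<exists>\<alpha> \<beta>. trace_right g \<alpha> \<and> trace_left g \<beta> \<and>
     (AE t in lebesgue_on {0..}. \<phi> t = (\<alpha> t + \<beta> t) / 2))"

text \<open>Measurability of every section is required because \<open>g(\<cdot>, t)\<close> has to be a distribution for
  every \<open>t\<close>; Lebesgue measurability of \<open>g\<close> yields it only for almost every \<open>t\<close>.\<close>

definition bounded_solution ::
    "(real \<Rightarrow> real) \<Rightarrow> (real \<times> real \<Rightarrow> real) \<Rightarrow> (real \<Rightarrow> real) \<Rightarrow> bool" where
  "bounded_solution G g u \<longleftrightarrow>
     (\<forall>t\<ge>0. periodic (\<lambda>x. g (x, t))) \<and>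
     g \<in> borel_measurable (lebesgue_on (UNIV \<times> {0..})) \<and>
     (\<forall>t\<ge>0. (\<lambda>x. g (x, t)) \<in> borel_measurable lebesgue) \<and>
     bounded (g ` (UNIV \<times> {0..})) \<and>
     u \<in> borel_measurable (lebesgue_on {0..}) \<and>
     wave_equation g u \<and>
     (\<exists>\<phi>. value_at_0 g \<phi> \<and> (AE t in lebesgue_on {0..}. u t \<in> msign (\<phi> t))) \<and>
     continuous_into_distributions g \<and>
     (AE x in lebesgue. g (x, 0) = G x)"

definition delay_solution ::
    "(real \<Rightarrow> real) \<Rightarrow> (real \<Rightarrow> real) \<Rightarrow> (real \<Rightarrow> real) \<Rightarrow> bool" where
  "delay_solution G \<phi> v \<longleftrightarrow>
     \<phi> \<in> borel_measurable (lebesgue_on {0..}) \<and>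
     v \<in> borel_measurable (lebesgue_on {0..}) \<and>
     (AE t in lebesgue_on {0..}.
        \<phi> t + 1 / 2 * v t
          + (\<Sum>k | k \<noteq> (0::int) \<and> 2 * of_int k * pi \<in> {-t..0}. v (t + 2 * of_int k * pi)) = G t) \<and>
     (AE t in lebesgue_on {0..}. v t \<in> msign (\<phi> t))"

end

theory Submission
  imports Defs
begin

text \<open>On \<open>(0, 2\<pi>)\<close> a solution depends on \<open>x + t\<close> only, \<open>g (x, t) = r (x + t)\<close>, and the source at \<open>x = 0\<close> means
  \<open>r (s + 2\<pi>) = r s - u s\<close>; hence \<open>g (0, t) = r t - u t / 2\<close>, where
  \<open>r t = G t - (u (t - 2\<pi>) + u (t - 4\<pi>) + \<dots>)\<close>. So the delay equation is \<open>\<phi> + u/2 = r\<close> with \<open>u \<in> sign \<phi>\<close>,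
  and \<open>\<phi> \<mapsto> \<phi> + sign \<phi> / 2\<close> has a single-valued inverse: the values of \<open>u\<close> at \<open>t - 2\<pi>\<close>, \<open>t - 4\<pi>\<close>, \<dots> determine
  those of \<open>\<phi>\<close> and \<open>u\<close> at \<open>t\<close>. That every weak solution has this form is uniqueness for the
  homogeneous equation: the integrals of \<open>d (x, t) * \<theta> (x + t)\<close> over a period are constant in time
  for all smooth periodic \<open>\<theta>\<close>, and smooth approximations of indicators of arcs show that they determine \<open>d\<close>.
  The traces are computed from the continuity of translations in \<open>L\<^sup>1\<close>.\<close>

text \<open>All data are known only up to null sets, while the sum over the past evaluates
  \<open>u\<close> at translates. Hence \<open>G\<close> and \<open>u\<close> are replaced by Borel
  functions defined and bounded everywhere, so that \<open>r (s + 2 * pi) = r s - u s\<close> is an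
  identity for every \<open>s \<ge> 0\<close> and integrals can be treated by Fubini and
  substitution. Two profiles occur. For a given solution, \<open>r\<close> is \<open>G\<close> minus
  the past of \<open>u\<close>; its a priori bound grows with time, so the lemmas on profiles ask
  only for boundedness on \<open>s \<le> T\<close>. Existence requires a bound for all times, and
  there \<open>r\<close> is built by iteration instead. Test functions vanish near
  \<open>t = 0\<close>, so the weak equation alone does not see the initial value: it enters through
  continuity in time, which also gives the conclusion at every \<open>t\<close> rather than almost
  every \<open>t\<close>. The sign condition speaks of a value at 0 that is only asserted to exist;
  it becomes usable because one-sided traces are unique almost everywhere.\<close>

subsection \<open>Smooth functions\<close>

lemma k_times_cont_diff_has_derivative:
  assumes "k_times_cont_diff (Suc k) f"
  obtains f' where "\<And>x. (f has_derivative f' x) (at x)" "\<And>v. k_times_cont_diff k (\<lambda>x. f' x v)"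
  using assms unfolding k_times_cont_diff.simps by blast

lemma k_times_cont_diff_SucI:
  assumes "\<And>x. (f has_derivative f' x) (at x)" "\<And>v. k_times_cont_diff k (\<lambda>x. f' x v)"
  shows "k_times_cont_diff (Suc k) f"
  using assms unfolding k_times_cont_diff.simps by blast

lemma k_times_cont_diff_continuous: "k_times_cont_diff k f \<Longrightarrow> continuous_on UNIV f"
proof (cases k)
  case (Suc j)
  assume "k_times_cont_diff k f"
  with Suc obtain f' where "\<And>x. (f has_derivative f' x) (at x)" by auto
  then show ?thesis by (rule has_derivative_continuous_on)
qed simp

lemma k_times_cont_diff_Suc_D: "k_times_cont_diff (Suc k) f \<Longrightarrow> k_times_cont_diff k f"
proof (induction k arbitrary: f)
  case 0
  then show ?case using k_times_cont_diff_continuous[OF 0] by simp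
next
  case (Suc k)
  obtain f' where "\<And>x. (f has_derivative f' x) (at x)" "\<And>v. k_times_cont_diff (Suc k) (\<lambda>x. f' x v)"
    using k_times_cont_diff_has_derivative[OF Suc.prems] by blast
  then show ?case using Suc.IH k_times_cont_diff_SucI by blast
qed

lemma k_times_cont_diff_const: "k_times_cont_diff k (\<lambda>x. c)"
proof (induction k arbitrary: c)
  case (Suc k)
  have "((\<lambda>x::'a. c) has_derivative (\<lambda>v. 0)) (at x)" for x by simp
  then show ?case by (rule k_times_cont_diff_SucI) (rule Suc)
qed simp

lemma k_times_cont_diff_linear:
  assumes "bounded_linear f"
  shows "k_times_cont_diff k f"
proof (cases k)
  case 0
  then show ?thesis using assms by (simp add: linear_continuous_on)
next
  case (Suc j)
  then show ?thesis
    using k_times_cont_diff_SucI[OF bounded_linear_imp_has_derivative[OF assms] k_times_cont_diff_const]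
    by simp
qed

lemma k_times_cont_diff_add:
  "k_times_cont_diff k f \<Longrightarrow> k_times_cont_diff k g \<Longrightarrow> k_times_cont_diff k (\<lambda>x. f x + g x)"
proof (induction k arbitrary: f g)
  case 0
  then show ?case by (auto intro!: continuous_on_add continuous_on_mult continuous_on_cos continuous_on_sin continuous_on_id continuous_on_const)
next
  case (Suc k)
  obtain f' where f: "\<And>x. (f has_derivative f' x) (at x)" "\<And>v. k_times_cont_diff k (\<lambda>x. f' x v)"
    using k_times_cont_diff_has_derivative[OF Suc.prems(1)] by blast
  obtain g' where g: "\<And>x. (g has_derivative g' x) (at x)" "\<And>v. k_times_cont_diff k (\<lambda>x. g' x v)"
    using k_times_cont_diff_has_derivative[OF Suc.prems(2)] by blast
  show ?case
    by (rule k_times_cont_diff_SucI[OF has_derivative_add[OF f(1) g(1)] Suc.IH[OF f(2) g(2)]])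
qed

lemma k_times_cont_diff_mult:
  "k_times_cont_diff k f \<Longrightarrow> k_times_cont_diff k g \<Longrightarrow> k_times_cont_diff k (\<lambda>x. f x * g x)"
proof (induction k arbitrary: f g)
  case 0
  then show ?case by (auto intro!: continuous_on_add continuous_on_mult continuous_on_cos continuous_on_sin continuous_on_id continuous_on_const)
next
  case (Suc k)
  obtain f' where f: "\<And>x. (f has_derivative f' x) (at x)" "\<And>v. k_times_cont_diff k (\<lambda>x. f' x v)"
    using k_times_cont_diff_has_derivative[OF Suc.prems(1)] by blast
  obtain g' where g: "\<And>x. (g has_derivative g' x) (at x)" "\<And>v. k_times_cont_diff k (\<lambda>x. g' x v)"
    using k_times_cont_diff_has_derivative[OF Suc.prems(2)] by blast
  have "((\<lambda>x. f x * g x) has_derivative (\<lambda>v. f x * g' x v + f' x v * g x)) (at x)" for x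
    using f(1) g(1) by (rule has_derivative_mult)
  moreover have "k_times_cont_diff k (\<lambda>x. f x * g' x v + f' x v * g x)" for v
    by (intro k_times_cont_diff_add Suc.IH k_times_cont_diff_Suc_D[OF Suc.prems(1)]
        k_times_cont_diff_Suc_D[OF Suc.prems(2)] f g)
  ultimately show ?case by (rule k_times_cont_diff_SucI)
qed

text \<open>The outer function has one real variable, so the derivative of the composite is the
  product \<open>g' x v * h' (g x) 1\<close>; the induction hypothesis handles the factor
  \<open>h' (g x) 1\<close> and the product rule the rest.\<close>

lemma k_times_cont_diff_compose:
  fixes h :: "real \<Rightarrow> real"
  shows "k_times_cont_diff k h \<Longrightarrow> k_times_cont_diff k g \<Longrightarrow> k_times_cont_diff k (\<lambda>x. h (g x))"
proof (induction k arbitrary: h g)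
  case 0
  then show ?case using continuous_on_compose2[of UNIV h UNIV g] by simp
next
  case (Suc k)
  obtain h' where h: "\<And>x. (h has_derivative h' x) (at x)" "\<And>v. k_times_cont_diff k (\<lambda>x. h' x v)"
    using k_times_cont_diff_has_derivative[OF Suc.prems(1)] by blast
  obtain g' where g: "\<And>x. (g has_derivative g' x) (at x)" "\<And>v. k_times_cont_diff k (\<lambda>x. g' x v)"
    using k_times_cont_diff_has_derivative[OF Suc.prems(2)] by blast
  have lin: "h' y v = v * h' y 1" for y v
    using linear_cmul[OF has_derivative_linear[OF h(1)[of y]], of v 1] by simp
  have "((\<lambda>x. h (g x)) has_derivative (\<lambda>v. g' x v * h' (g x) 1)) (at x)" for x
    by (rule has_derivative_eq_rhs[OF has_derivative_compose[OF g(1) h(1)]]) (rule ext, rule lin)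
  moreover have "k_times_cont_diff k (\<lambda>x. g' x v * h' (g x) 1)" for v
    by (rule k_times_cont_diff_mult[OF g(2) Suc.IH[OF h(2) k_times_cont_diff_Suc_D[OF Suc.prems(2)]]])
  ultimately show ?case by (rule k_times_cont_diff_SucI)
qed

lemma k_times_cont_diff_Suc_real:
  fixes f :: "real \<Rightarrow> real"
  assumes "\<And>x. (f has_real_derivative f' x) (at x)" "k_times_cont_diff k f'"
  shows "k_times_cont_diff (Suc k) f"
  using k_times_cont_diff_SucI[of f "\<lambda>x v. f' x * v", OF _ k_times_cont_diff_mult[OF assms(2) k_times_cont_diff_const]]
    assms(1) unfolding has_field_derivative_def by blast

text \<open>The derivative is a product of \<open>f'\<close> with the reciprocal itself, which by
  the induction hypothesis has one order of smoothness less, as needed.\<close>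

lemma k_times_cont_diff_inverse:
  fixes f :: "'a::euclidean_space \<Rightarrow> real"
  assumes "\<And>x. f x \<noteq> 0"
  shows "k_times_cont_diff k f \<Longrightarrow> k_times_cont_diff k (\<lambda>x. inverse (f x))"
proof (induction k)
  case 0
  then show ?case using assms by (auto intro!: continuous_on_inverse)
next
  case (Suc k)
  obtain f' where f: "\<And>x. (f has_derivative f' x) (at x)" "\<And>v. k_times_cont_diff k (\<lambda>x. f' x v)"
    using k_times_cont_diff_has_derivative[OF Suc.prems(1)] by blast
  have IH: "k_times_cont_diff k (\<lambda>x. inverse (f x))"
    by (rule Suc.IH[OF k_times_cont_diff_Suc_D[OF Suc.prems(1)]])
  let ?D = "\<lambda>x v. -1 * (inverse (f x) * f' x v * inverse (f x))"
  have "((\<lambda>x. inverse (f x)) has_derivative ?D x) (at x)" for x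
    using Deriv.has_derivative_inverse[OF assms f(1)] by simp
  moreover have "k_times_cont_diff k (\<lambda>x. ?D x v)" for v
    using k_times_cont_diff_mult[OF k_times_cont_diff_mult[OF IH f(2)] IH]
    by (intro k_times_cont_diff_mult[OF k_times_cont_diff_const])
  ultimately show ?case by (rule k_times_cont_diff_SucI)
qed

lemma smooth_const: "smooth (\<lambda>x. c)"
  unfolding smooth_def by (simp add: k_times_cont_diff_const)

lemma smooth_linear: "bounded_linear L \<Longrightarrow> smooth L"
  unfolding smooth_def by (simp add: k_times_cont_diff_linear)

lemma smooth_add: "smooth f \<Longrightarrow> smooth g \<Longrightarrow> smooth (\<lambda>x. f x + g x)"
  unfolding smooth_def by (simp add: k_times_cont_diff_add)

lemma smooth_mult: "smooth f \<Longrightarrow> smooth g \<Longrightarrow> smooth (\<lambda>x. f x * g x)"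
  unfolding smooth_def by (simp add: k_times_cont_diff_mult)

lemma smooth_compose: "smooth h \<Longrightarrow> smooth f \<Longrightarrow> smooth (\<lambda>x. h (f x))"
  for h :: "real \<Rightarrow> real"
  unfolding smooth_def by (simp add: k_times_cont_diff_compose)

lemma smooth_inverse: "smooth f \<Longrightarrow> (\<And>x. f x \<noteq> 0) \<Longrightarrow> smooth (\<lambda>x. inverse (f x))"
  unfolding smooth_def by (simp add: k_times_cont_diff_inverse)

lemma smooth_affine: "smooth (\<lambda>x::real. a * x + b)"
  by (intro smooth_add smooth_const smooth_linear bounded_linear_mult_right)

lemma smooth_imp_continuous: "smooth f \<Longrightarrow> continuous_on A f"
  using k_times_cont_diff_continuous continuous_on_subset unfolding smooth_def by blast

lemma smooth_has_derivative:
  assumes "smooth f"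
  shows "(f has_derivative frechet_derivative f (at x)) (at x)"
    and "continuous_on UNIV (\<lambda>x. frechet_derivative f (at x) v)"
proof -
  have "k_times_cont_diff (Suc 0) f"
    using assms unfolding smooth_def by blast
  from k_times_cont_diff_has_derivative[OF this] obtain f' where
    f: "\<And>x. (f has_derivative f' x) (at x)" "\<And>v. continuous_on UNIV (\<lambda>x. f' x v)"
    by auto
  have "frechet_derivative f (at x) = f' x" for x
    using f(1) frechet_derivative_at by metis
  then show "(f has_derivative frechet_derivative f (at x)) (at x)"
    "continuous_on UNIV (\<lambda>x. frechet_derivative f (at x) v)"
    using f by auto
qed

lemma smooth_has_real_derivative:
  fixes f :: "real \<Rightarrow> real"
  assumes "smooth f"
  shows "(f has_real_derivative deriv f x) (at x)" and "continuous_on UNIV (deriv f)"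
proof -
  have D: "(f has_real_derivative frechet_derivative f (at x) 1) (at x)" for x
  proof -
    note D = smooth_has_derivative(1)[OF assms, of x]
    have "frechet_derivative f (at x) = (*) (frechet_derivative f (at x) 1)"
    proof
      fix v
      show "frechet_derivative f (at x) v = frechet_derivative f (at x) 1 * v"
        using linear_cmul[OF has_derivative_linear[OF D], of v 1] by (simp del: mult_cancel_right)
    qed
    then show ?thesis unfolding has_field_derivative_def by (rule has_derivative_eq_rhs[OF D])
  qed
  then have "deriv f = (\<lambda>x. frechet_derivative f (at x) 1)"
    by (intro ext DERIV_imp_deriv)
  with D show "(f has_real_derivative deriv f x) (at x)" "continuous_on UNIV (deriv f)"
    using smooth_has_derivative(2)[OF assms, of 1] by auto
qed

section \<open>Cosine, a smooth step function and smooth arcs\<close>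

lemma smooth_cos: "smooth (cos :: real \<Rightarrow> real)"
proof -
  \<comment> \<open>Cosine alone is not closed under differentiation; the combinations with
    arbitrary \<open>a\<close> and \<open>b\<close> are.\<close>
  have "k_times_cont_diff k (\<lambda>x. a * cos x + b * sin x)" for k and a b :: real
  proof (induction k arbitrary: a b)
    case (Suc k)
    show ?case
      by (rule k_times_cont_diff_Suc_real[OF _ Suc[of b "-a"]]) (auto intro!: derivative_eq_intros)
  next
    case 0
    have "continuous_on UNIV (\<lambda>x. a * cos x + b * sin x)"
      by (intro continuous_intros)
    then show ?case by simp
  qed
  from this[of _ 1 0] show ?thesis by (simp add: smooth_def)
qed

text \<open>The prototype is \<open>exp (- (1 / x))\<close>, the case \<open>p = 1\<close>. The
  polynomial in \<open>1 / x\<close> makes the family closed under differentiation, so that one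
  induction gives all derivatives.\<close>

definition flat :: "real poly \<Rightarrow> real \<Rightarrow> real" where
  "flat p x = (if x > 0 then poly p (1 / x) * exp (- (1 / x)) else 0)"

lemma poly_exp_decay: "((\<lambda>y. poly p y * exp (- y)) \<longlongrightarrow> (0::real)) at_top"
proof -
  have "((\<lambda>y. \<Sum>i\<le>degree p. coeff p i * (y ^ i / exp y)) \<longlongrightarrow> (\<Sum>i\<le>degree p. coeff p i * 0)) at_top"
    by (intro tendsto_intros tendsto_power_div_exp_0)
  then show ?thesis
    by (simp add: poly_altdef exp_minus sum_distrib_right divide_inverse mult.assoc)
qed

text \<open>With \<open>y = 1 / x\<close>, differentiation in \<open>x\<close> is
  \<open>- y^2\<close> times differentiation in \<open>y\<close>, and the
  \<open>y\<close>-derivative of \<open>p y * exp (- y)\<close> is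
  \<open>(p' - p) * exp (- y)\<close>; hence the new polynomial
  \<open>y^2 * (p - p')\<close>.\<close>

lemma flat_has_derivative:
  "(flat p has_real_derivative flat ([:0,0,1:] * (p - pderiv p)) x) (at x)"
proof -
  consider "x > 0" | "x < 0" | "x = 0" by linarith
  then show ?thesis
  proof cases
    case 1
    have "((\<lambda>x. poly p (1 / x) * exp (- (1 / x))) has_real_derivative
        flat ([:0,0,1:] * (p - pderiv p)) x) (at x)"
      using 1 by (auto intro!: derivative_eq_intros DERIV_chain2[OF poly_DERIV]
          simp: flat_def field_simps power2_eq_square)
    moreover have "\<forall>\<^sub>F y in nhds x. poly p (1 / y) * exp (- (1 / y)) = flat p y"
      using eventually_nhds_in_open[of "{0<..}" x] 1 by (auto simp: flat_def elim!: eventually_mono)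
    ultimately show ?thesis
      using DERIV_cong_ev[OF refl _ refl] by metis
  next
    case 2
    have "\<forall>\<^sub>F y in nhds x. 0 = flat p y"
      using eventually_nhds_in_open[of "{..<0}" x] 2 by (auto simp: flat_def elim!: eventually_mono)
    then show ?thesis
      using 2 DERIV_cong_ev[of x x "\<lambda>_. 0" "flat p" 0 0] by (simp add: flat_def)
  next
    case 3
    have "((\<lambda>h. flat p h / h) \<longlongrightarrow> 0) (at 0)"
      unfolding filterlim_at_split
    proof
      have "((\<lambda>h. 0) \<longlongrightarrow> (0::real)) (at_left 0)" by simp
      then show "((\<lambda>h. flat p h / h) \<longlongrightarrow> 0) (at_left 0)"
        by (rule Lim_transform_eventually) (auto simp: eventually_at_filter flat_def)
      \<comment> \<open>Dividing by \<open>h\<close> multiplies the polynomial by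
        \<open>y = 1 / h\<close>, which is \<open>pCons 0 p\<close>; the exponential still wins as
        \<open>y\<close> tends to infinity.\<close>
      have "((\<lambda>h. poly (pCons 0 p) (inverse h) * exp (- (inverse h))) \<longlongrightarrow> (0::real)) (at_right 0)"
        by (rule filterlim_compose[OF poly_exp_decay filterlim_inverse_at_top_right])
      then show "((\<lambda>h. flat p h / h) \<longlongrightarrow> 0) (at_right 0)"
        by (rule Lim_transform_eventually) (auto simp: eventually_at_filter flat_def field_simps)
    qed
    then show ?thesis
      using 3 by (simp add: has_field_derivative_iff flat_def)
  qed
qed

lemma smooth_flat: "smooth (flat p)"
proof -
  have "k_times_cont_diff k (flat p)" for k
  proof (induction k arbitrary: p)
    case 0
    then show ?case
      using DERIV_isCont[OF flat_has_derivative] by (simp add: continuous_at_imp_continuous_on)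
  next
    case (Suc k)
    show ?case by (rule k_times_cont_diff_Suc_real[OF flat_has_derivative Suc])
  qed
  then show ?thesis by (simp add: smooth_def)
qed

text \<open>The transition lies in \<open>[1, 2]\<close> and not around 0, so the dilates
  \<open>smooth_step (n * y)\<close> vanish for \<open>y \<le> 1 / n\<close>: they tend to the
  indicator of \<open>{0<..}\<close> even at 0, and in time they stay away from \<open>t = 0\<close>
  as test functions must.\<close>

definition smooth_step :: "real \<Rightarrow> real" where
  "smooth_step x = flat 1 (x - 1) * inverse (flat 1 (x - 1) + flat 1 (2 - x))"

lemma smooth_step:
  shows smooth_smooth_step: "smooth smooth_step"
    and smooth_step_0: "x \<le> 1 \<Longrightarrow> smooth_step x = 0"
    and smooth_step_1: "x \<ge> 2 \<Longrightarrow> smooth_step x = 1"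
    and smooth_step_nonneg: "smooth_step x \<ge> 0"
    and smooth_step_le_1: "smooth_step x \<le> 1"
proof -
  \<comment> \<open>The half-lines \<open>x > 1\<close> and \<open>x < 2\<close> cover the real
    line, so the denominator never vanishes.\<close>
  have pos: "flat 1 (x - 1) + flat 1 (2 - x) > 0" for x
    by (cases "x > 1"; cases "x < 2") (auto simp: flat_def add_pos_pos)
  have aff: "smooth (\<lambda>x. flat 1 (x - 1))" "smooth (\<lambda>x. flat 1 (2 - x))"
    using smooth_compose[OF smooth_flat smooth_affine[of 1 "-1"]]
      smooth_compose[OF smooth_flat smooth_affine[of "-1" 2]] by auto
  show "smooth smooth_step"
    unfolding smooth_step_def[abs_def]
    using pos by (intro smooth_mult smooth_inverse smooth_add aff) (auto simp: less_imp_neq[symmetric])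
  show "x \<le> 1 \<Longrightarrow> smooth_step x = 0" by (simp add: smooth_step_def flat_def)
  show "x \<ge> 2 \<Longrightarrow> smooth_step x = 1" by (simp add: smooth_step_def flat_def)
  have nn: "flat 1 y \<ge> 0" for y by (simp add: flat_def)
  show "smooth_step x \<ge> 0"
    using nn by (simp add: smooth_step_def add_nonneg_nonneg)
  show "smooth_step x \<le> 1"
    using nn[of "x-1"] nn[of "2-x"] pos[of x] by (simp add: smooth_step_def field_simps)
qed

lemma smooth_step_limit: "(\<lambda>n. smooth_step (real n * y)) \<longlonglongrightarrow> indicator {0<..} y"
proof (cases "y > 0")
  case True
  obtain N where N: "real N * y \<ge> 2"
    using reals_Archimedean3[OF True] by (meson less_eq_real_def)
  have "smooth_step (real n * y) = 1" if "n \<ge> N" for n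
  proof -
    have "real N * y \<le> real n * y" using that True by (intro mult_right_mono) auto
    then show ?thesis using N by (intro smooth_step_1) linarith
  qed
  then have "\<forall>\<^sub>F n in sequentially. smooth_step (real n * y) = 1"
    unfolding eventually_sequentially by blast
  then show ?thesis using True by (simp add: tendsto_eventually)
next
  case False
  then have "real n * y \<le> 1" for n by (smt (verit) mult_nonneg_nonpos of_nat_0_le_iff)
  then show ?thesis using False by (simp add: smooth_step_0)
qed

text \<open>As \<open>a \<rightarrow> \<infinity>\<close> these functions tend to the indicator of the arc \<open>cos (x - c) > b\<close> of the torus.\<close>

lemma smooth_arc: "smooth (\<lambda>x. smooth_step (a * (cos (x - c) - b)))"
proof -
  have "smooth (\<lambda>x. cos (1 * x + (- c)))"
    by (rule smooth_compose[OF smooth_cos smooth_affine])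
  from smooth_compose[OF smooth_smooth_step smooth_compose[OF smooth_affine[of a "- (a * b)"] this]]
  show ?thesis by (simp add: algebra_simps)
qed

lemma periodic_arc: "periodic (\<lambda>x. smooth_step (a * (cos (x - c) - b)))"
proof -
  have "cos (x + 2 * pi - c) = cos (x - c)" for x
    using cos_periodic[of "x - c"] by (simp add: algebra_simps)
  then show ?thesis by (simp add: periodic_def)
qed

subsection \<open>Lebesgue measure\<close>

lemma AE_lebesgue_iff_lborel: "(AE x in lebesgue. P x) \<longleftrightarrow> (AE x in lborel. P x)"
  by (rule AE_completion_iff)

lemma AE_lebesgue_on_iff:
  "S \<in> sets lebesgue \<Longrightarrow> (AE x in lebesgue_on S. P x) \<longleftrightarrow> (AE x in lborel. x \<in> S \<longrightarrow> P x)"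
  by (subst AE_restrict_space_iff) (auto simp: AE_lebesgue_iff_lborel)

lemma borel_measurable_fst_snd [measurable]:
  "fst \<in> borel_measurable (borel :: (real \<times> real) measure)"
  "snd \<in> borel_measurable (borel :: (real \<times> real) measure)"
  by (auto intro!: borel_measurable_continuous_onI continuous_intros)

lemma AE_lborel_translate:
  fixes c :: real
  assumes "AE x in lborel. P x"
  shows "AE x in lborel. P (x + c)"
proof -
  obtain N where N: "negligible N" "{x. \<not> P x} \<subseteq> N"
    using assms unfolding AE_lebesgue_iff_lborel[symmetric] eventually_ae_filter_negligible by blast
  have "negligible ((+) (- c) ` N)" using N(1) by (rule negligible_translation)
  moreover have "{x. \<not> P (x + c)} \<subseteq> (+) (- c) ` N"
  proof
    fix x assume "x \<in> {x. \<not> P (x + c)}"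
    then have "x + c \<in> N" using N(2) by blast
    then show "x \<in> (+) (- c) ` N" by (intro image_eqI[of _ _ "x + c"]) auto
  qed
  ultimately show ?thesis
    unfolding AE_lebesgue_iff_lborel[symmetric] eventually_ae_filter_negligible by blast
qed

text \<open>Bridge from Lebesgue measurable functions on \<open>S\<close> to Borel functions on the
  whole space. Clamping to \<open>[-B, B]\<close> makes the bound hold everywhere and respects the
  equality on \<open>S\<close>, where \<open>f\<close> obeys the bound almost everywhere.\<close>

lemma borel_representative:
  fixes f :: "'a::euclidean_space \<Rightarrow> real"
  assumes S: "S \<in> sets lebesgue" and f: "f \<in> borel_measurable (lebesgue_on S)"
    and B: "AE x in lborel. x \<in> S \<longrightarrow> \<bar>f x\<bar> \<le> B" and "0 \<le> B"
  obtains f' where "f' \<in> borel_measurable borel" "\<And>x. \<bar>f' x\<bar> \<le> B"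
    "AE x in lborel. x \<in> S \<longrightarrow> f x = f' x"
proof -
  have "(\<lambda>x. if x \<in> S then f x else 0) \<in> borel_measurable lebesgue"
    using f S by (subst borel_measurable_if) auto
  from completion_ex_borel_measurable_real[OF this] obtain f0
    where f0: "f0 \<in> borel_measurable borel" "AE x in lborel. (if x \<in> S then f x else 0) = f0 x"
    by auto
  show ?thesis
  proof (rule that[of "\<lambda>x. max (- B) (min B (f0 x))"])
    show "AE x in lborel. x \<in> S \<longrightarrow> f x = max (- B) (min B (f0 x))"
      using f0(2) B by eventually_elim auto
  qed (use f0 \<open>0 \<le> B\<close> in auto)
qed

text \<open>Density argument: \<open>f\<close> is an L1 limit of continuous functions
  \<open>h n\<close> supported in one fixed interval. For each \<open>h n\<close> dominated
  convergence gives the claim, and translation invariance makes the two approximation errors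
  equal.\<close>

lemma L1_continuous_translation:
  fixes f :: "real \<Rightarrow> real"
  assumes [measurable]: "f \<in> borel_measurable borel"
    and B: "\<And>x. \<bar>f x\<bar> \<le> B" and T: "\<And>x. \<bar>x\<bar> > T \<Longrightarrow> f x = 0"
  shows "((\<lambda>h. LINT x|lborel. \<bar>f (x + h) - f x\<bar>) \<longlongrightarrow> 0) (at 0)"
proof -
  have "f measurable_on UNIV"
    by (rule lebesgue_measurable_imp_measurable_on_real) (auto intro!: measurable_completion)
  then obtain N g where N: "negligible N" and g: "\<And>n. continuous_on UNIV (g n)"
    and lim: "\<And>x. x \<notin> N \<Longrightarrow> (\<lambda>n. g n x) \<longlonglongrightarrow> f x"
    unfolding measurable_on_def by auto
  \<comment> \<open>The clamp and the cutoff provide a common bound and a common support; neither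
    alters the limit, since \<open>\<bar>f x\<bar> \<le> B\<close> and the cutoff is 1 for
    \<open>\<bar>x\<bar> \<le> T\<close>.\<close>
  define h where "h n x = max (- B) (min B (g n x)) * max 0 (min 1 (T + 1 - \<bar>x\<bar>))" for n x
  have B0: "0 \<le> B" using B[of 0] by linarith
  have h_cont: "continuous_on UNIV (h n)" for n
    unfolding h_def by (intro continuous_intros g)
  have [measurable]: "h n \<in> borel_measurable borel" for n
    using h_cont by (rule borel_measurable_continuous_onI)
  have h_supp: "h n x = 0" if "\<bar>x\<bar> > T + 1" for n x
    using that by (simp add: h_def)
  have h_bound: "\<bar>h n x\<bar> \<le> B" for n x
  proof -
    have "\<bar>h n x\<bar> \<le> B * 1"
      unfolding h_def abs_mult using B0 by (intro mult_mono) auto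
    then show ?thesis by simp
  qed
  have h_int: "integrable lborel (h n)" for n
    by (rule integrableI_bounded_set[where A = "{- (T + 1)..T + 1}" and B = B])
      (use h_supp h_bound in \<open>auto simp: abs_le_iff not_le emeasure_lborel_Icc_eq\<close>)
  have f_int: "integrable lborel f"
    by (rule integrableI_bounded_set[where A = "{- T..T}" and B = B])
      (use B T in \<open>auto simp: abs_le_iff not_le emeasure_lborel_Icc_eq\<close>)
  have h_lim: "(\<lambda>n. h n x) \<longlonglongrightarrow> f x" if "x \<notin> N" for x
  proof -
    have "(\<lambda>n. h n x) \<longlonglongrightarrow> max (- B) (min B (f x)) * max 0 (min 1 (T + 1 - \<bar>x\<bar>))"
      unfolding h_def by (intro tendsto_intros lim that)
    also have "max (- B) (min B (f x)) * max 0 (min 1 (T + 1 - \<bar>x\<bar>)) = f x"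
      using B[of x] T[of x] B0 by (cases "\<bar>x\<bar> > T") (auto simp: abs_le_iff)
    finally show ?thesis .
  qed
  have int_ind: "integrable lborel (\<lambda>x. c * indicator {a..b} x)" for a b c :: real
    by (intro integrable_mult_right integrable_real_indicator) (auto simp: emeasure_lborel_Icc_eq)
  have "(\<lambda>n. LINT x|lborel. \<bar>f x - h n x\<bar>) \<longlonglongrightarrow> (LINT x|lborel. \<bar>f x - f x\<bar>)"
  proof (rule integral_dominated_convergence[where w = "\<lambda>x. 2 * B * indicator {- (T + 1)..T + 1} x"])
    have "AE x in lborel. x \<notin> N"
      using N unfolding AE_lebesgue_iff_lborel[symmetric] eventually_ae_filter_negligible by blast
    then show "AE x in lborel. (\<lambda>n. \<bar>f x - h n x\<bar>) \<longlonglongrightarrow> \<bar>f x - f x\<bar>"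
      by eventually_elim (intro tendsto_intros h_lim)
    show "AE x in lborel. norm \<bar>f x - h n x\<bar> \<le> 2 * B * indicator {- (T + 1)..T + 1} x" for n
    proof (rule AE_I2)
      fix x show "norm \<bar>f x - h n x\<bar> \<le> 2 * B * indicator {- (T + 1)..T + 1} x"
        using B[of x] h_bound[of n x] T[of x] h_supp[of x n]
        by (cases "\<bar>x\<bar> > T + 1") (auto simp: indicator_def)
    qed
    show "integrable lborel (\<lambda>x. 2 * B * indicator {- (T + 1)..T + 1} x)"
      by (rule int_ind)
  qed auto
  then have approx: "(\<lambda>n. LINT x|lborel. \<bar>f x - h n x\<bar>) \<longlonglongrightarrow> 0" by simp
  have transl: "((\<lambda>s. LINT x|lborel. \<bar>h n (x + s) - h n x\<bar>) \<longlongrightarrow> 0) (at 0)" for n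
    unfolding tendsto_at_iff_sequentially comp_def
  proof (intro allI impI)
    fix X :: "nat \<Rightarrow> real" assume X: "X \<longlonglongrightarrow> 0"
    \<comment> \<open>A bound for the convergent sequence confines all translates to one interval,
      which supplies an integrable majorant.\<close>
    then obtain K where K: "\<And>i. \<bar>X i\<bar> \<le> K"
      by (metis Bseq_def convergentI convergent_imp_Bseq real_norm_def)
    have "(\<lambda>i. LINT x|lborel. \<bar>h n (x + X i) - h n x\<bar>) \<longlonglongrightarrow> (LINT x|lborel. \<bar>h n (x + 0) - h n x\<bar>)"
    proof (rule integral_dominated_convergence[where w = "\<lambda>x. 2 * B * indicator {- (T + 1 + K)..T + 1 + K} x"])
      have "isCont (h n) (x + 0)" for x
        using h_cont by (simp add: continuous_on_eq_continuous_at)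
      then show "AE x in lborel. (\<lambda>i. \<bar>h n (x + X i) - h n x\<bar>) \<longlonglongrightarrow> \<bar>h n (x + 0) - h n x\<bar>"
        by (intro AE_I2 tendsto_intros isCont_tendsto_compose[of _ "h n"] X)
      show "AE x in lborel. norm \<bar>h n (x + X i) - h n x\<bar> \<le> 2 * B * indicator {- (T + 1 + K)..T + 1 + K} x" for i
      proof (rule AE_I2)
        fix x
        show "norm \<bar>h n (x + X i) - h n x\<bar> \<le> 2 * B * indicator {- (T + 1 + K)..T + 1 + K} x"
          using h_bound[of n x] h_bound[of n "x + X i"] h_supp[of x n] h_supp[of "x + X i" n] K[of i]
          by (cases "\<bar>x\<bar> > T + 1 + K") (auto simp: indicator_def)
      qed
      show "integrable lborel (\<lambda>x. 2 * B * indicator {- (T + 1 + K)..T + 1 + K} x)"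
        by (rule int_ind)
    qed auto
    then show "(\<lambda>i. LINT x|lborel. \<bar>h n (x + X i) - h n x\<bar>) \<longlonglongrightarrow> 0" by simp
  qed
  show ?thesis
  proof (rule tendstoI)
    fix e :: real assume "e > 0"
    then obtain n where n: "(LINT x|lborel. \<bar>f x - h n x\<bar>) < e / 3"
      using order_tendstoD(2)[OF approx, of "e / 3"] by (auto simp: eventually_sequentially)
    have "\<forall>\<^sub>F s in at 0. (LINT x|lborel. \<bar>h n (x + s) - h n x\<bar>) < e / 3"
      using order_tendstoD(2)[OF transl[of n], of "e / 3"] \<open>e > 0\<close> by simp
    then show "\<forall>\<^sub>F s in at 0. dist (LINT x|lborel. \<bar>f (x + s) - f x\<bar>) 0 < e"
    proof eventually_elim
      fix s assume s: "(LINT x|lborel. \<bar>h n (x + s) - h n x\<bar>) < e / 3"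
      have int_shift: "integrable lborel (\<lambda>x. k (x + s))" if "integrable lborel k" for k :: "real \<Rightarrow> real"
        using lborel_integrable_real_affine[OF that, of 1 s] by (simp add: add.commute)
      have "(LINT x|lborel. \<bar>f (x + s) - f x\<bar>)
          \<le> (LINT x|lborel. \<bar>f (x + s) - h n (x + s)\<bar> + \<bar>h n (x + s) - h n x\<bar> + \<bar>f x - h n x\<bar>)"
        by (intro integral_mono Bochner_Integration.integrable_add integrable_abs
            Bochner_Integration.integrable_diff int_shift f_int h_int) auto
      also have "\<dots> = (LINT x|lborel. \<bar>f (x + s) - h n (x + s)\<bar>)
          + (LINT x|lborel. \<bar>h n (x + s) - h n x\<bar>) + (LINT x|lborel. \<bar>f x - h n x\<bar>)"
        by (subst Bochner_Integration.integral_add, (intro Bochner_Integration.integrable_add integrable_abs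
            Bochner_Integration.integrable_diff int_shift f_int h_int)+)+ simp
      also have "(LINT x|lborel. \<bar>f (x + s) - h n (x + s)\<bar>) = (LINT x|lborel. \<bar>f x - h n x\<bar>)"
        using lborel_integral_real_affine[of 1 "\<lambda>x. \<bar>f x - h n x\<bar>" s] by (simp add: add.commute)
      finally have "(LINT x|lborel. \<bar>f (x + s) - f x\<bar>) < e"
        using s n by linarith
      then show "dist (LINT x|lborel. \<bar>f (x + s) - f x\<bar>) 0 < e"
        by (simp add: integral_nonneg_AE)
    qed
  qed
qed

text \<open>The positive and the negative part of \<open>f\<close>, taken as densities, give
  measures that are finite and equal on all half-lines \<open>{a<..}\<close>. Such measures
  coincide, and then so do their densities almost everywhere.\<close>

lemma AE_eq_0_if_integrals_eq_0:
  fixes f :: "real \<Rightarrow> real"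
  assumes f: "integrable lborel f" and 0: "\<And>a. (LINT x|lborel. indicator {a<..} x * f x) = 0"
  shows "AE x in lborel. f x = 0"
proof -
  have [measurable]: "f \<in> borel_measurable borel" using f by auto
  let ?p = "\<lambda>x. ennreal (f x)" and ?n = "\<lambda>x. ennreal (- f x)"
  have "density lborel ?p = density lborel ?n"
  proof (rule measure_eqI_lessThan)
    fix a :: real
    have int: "integrable lborel (\<lambda>x. indicator {a<..} x * f x)"
      using integrable_mult_indicator[OF _ f, of "{a<..}"] by simp
    have int_p: "integrable lborel (\<lambda>x. max 0 (indicator {a<..} x * f x))"
      and int_n: "integrable lborel (\<lambda>x. max 0 (- (indicator {a<..} x * f x)))"
      by (intro Bochner_Integration.integrable_max Bochner_Integration.integrable_minus int integrable_zero)+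
    have p: "emeasure (density lborel ?p) {a<..} = ennreal (LINT x|lborel. max 0 (indicator {a<..} x * f x))"
      by (subst emeasure_density, simp, simp, subst nn_integral_eq_integral[symmetric])
        (rule int_p, auto intro!: nn_integral_cong simp: indicator_def max_def ennreal_neg)
    have n: "emeasure (density lborel ?n) {a<..} = ennreal (LINT x|lborel. max 0 (- (indicator {a<..} x * f x)))"
      by (subst emeasure_density, simp, simp, subst nn_integral_eq_integral[symmetric])
        (rule int_n, auto intro!: nn_integral_cong simp: indicator_def max_def ennreal_neg)
    have "(LINT x|lborel. max 0 (indicator {a<..} x * f x)) - (LINT x|lborel. max 0 (- (indicator {a<..} x * f x)))
        = (LINT x|lborel. max 0 (indicator {a<..} x * f x) - max 0 (- (indicator {a<..} x * f x)))"
      using int_p int_n by (rule Bochner_Integration.integral_diff[symmetric])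
    also have "\<dots> = (LINT x|lborel. indicator {a<..} x * f x)"
      by (intro Bochner_Integration.integral_cong) auto
    finally show "emeasure (density lborel ?p) {a<..} = emeasure (density lborel ?n) {a<..}"
      using p n 0[of a] by simp
    show "emeasure (density lborel ?p) {a<..} < \<infinity>" using p by simp
  qed auto
  then have "AE x in lborel. ?p x = ?n x"
    by (rule sigma_finite_measure.density_unique[OF lborel.sigma_finite_measure_axioms, rotated 2]) auto
  \<comment> \<open>\<open>ennreal\<close> sends negative numbers to 0, so \<open>f x\<close> and
    \<open>- f x\<close> have the same image only if \<open>f x = 0\<close>.\<close>
  then show ?thesis
    by eventually_elim (metis ennreal_eq_0_iff ennreal_neg linorder_linear neg_0_le_iff_le order_antisym neg_le_0_iff_le)
qed

text \<open>For \<open>\<bar>y\<bar> > pi\<close> the reflection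
  \<open>2 * pi - \<bar>y\<bar>\<close> lies in \<open>[d, pi]\<close>, where cosine is at most
  \<open>cos d\<close>. Just beyond the window the next periodic copy of the arc begins.\<close>

lemma cos_gt_cos_iff:
  assumes "0 \<le> d" "d \<le> pi" "\<bar>y\<bar> \<le> 2 * pi - d"
  shows "cos y > cos d \<longleftrightarrow> \<bar>y\<bar> < d"
proof (cases "\<bar>y\<bar> \<le> pi")
  case True
  then show ?thesis
    using assms cos_mono_less_eq[of d "\<bar>y\<bar>"] by simp
next
  case False
  have "cos y = cos (2 * pi - \<bar>y\<bar>)" by (simp add: cos_diff)
  also have "\<dots> \<le> cos d"
    using assms False by (intro cos_monotone_0_pi_le) auto
  finally show ?thesis using False assms by auto
qed

text \<open>The arcs \<open>(a, 2 * pi)\<close> suffice: once \<open>f\<close> is cut down to one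
  period, they give its integrals over all half-lines. The indicator of each is a pointwise limit of
  smooth periodic functions with values in \<open>[0, 1]\<close>.\<close>

lemma AE_eq_0_if_smooth_periodic_integrals_eq_0:
  fixes f :: "real \<Rightarrow> real"
  assumes [measurable]: "f \<in> borel_measurable borel" and B: "\<And>x. \<bar>f x\<bar> \<le> B"
    and 0: "\<And>\<theta>. smooth \<theta> \<Longrightarrow> periodic \<theta> \<Longrightarrow> (LINT x|lborel. indicator {0..2 * pi} x * (f x * \<theta> x)) = 0"
  shows "AE x in lborel. x \<in> {0..2 * pi} \<longrightarrow> f x = 0"
proof -
  let ?f = "\<lambda>x. indicator {0..2 * pi} x * f x"
  have int: "integrable lborel ?f"
    using integrableI_bounded_set_indicator[of "{0..2 * pi}" lborel f B] B by simp
  have arc: "(LINT x|lborel. indicator {a<..<2 * pi} x * ?f x) = 0" if a: "0 \<le> a" "a < 2 * pi" for a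
  proof -
    \<comment> \<open>Midpoint and half-length of the arc. For \<open>x\<close> in
      \<open>[0, 2 * pi]\<close> the distance to \<open>c\<close> is at most
      \<open>c = 2 * pi - d\<close>, exactly what \<open>cos_gt_cos_iff\<close> allows.\<close>
    define c where "c = (a + 2 * pi) / 2"
    define d where "d = (2 * pi - a) / 2"
    define \<theta> where "\<theta> n x = smooth_step (real n * (cos (x - c) - cos d))" for n x
    have "(\<lambda>n. LINT x|lborel. \<theta> n x * ?f x) \<longlonglongrightarrow> (LINT x|lborel. indicator {a<..<2 * pi} x * ?f x)"
    proof (rule integral_dominated_convergence[where w = "\<lambda>x. \<bar>?f x\<bar>"])
      have [measurable]: "\<theta> n \<in> borel_measurable borel" for n
        unfolding \<theta>_def by (intro borel_measurable_continuous_onI smooth_imp_continuous smooth_arc)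
      show "(\<lambda>x. \<theta> n x * ?f x) \<in> borel_measurable lborel" for n by measurable
      show "AE x in lborel. (\<lambda>n. \<theta> n x * ?f x) \<longlonglongrightarrow> indicator {a<..<2 * pi} x * ?f x"
      proof (rule AE_I2)
        fix x
        show "(\<lambda>n. \<theta> n x * ?f x) \<longlonglongrightarrow> indicator {a<..<2 * pi} x * ?f x"
        proof (cases "x \<in> {0..2 * pi}")
          case True
          have "cos (x - c) > cos d \<longleftrightarrow> \<bar>x - c\<bar> < d"
            using True a by (intro cos_gt_cos_iff) (auto simp: c_def d_def field_simps abs_if)
          moreover have "\<bar>x - c\<bar> < d \<longleftrightarrow> x \<in> {a<..<2 * pi}"
            by (auto simp: c_def d_def abs_if field_simps)
          ultimately have "indicator {0<..} (cos (x - c) - cos d) = (indicator {a<..<2 * pi} x :: real)"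
            by (auto simp: indicator_def)
          then show ?thesis
            unfolding \<theta>_def using smooth_step_limit[of "cos (x - c) - cos d"]
            by (intro tendsto_mult) auto
        qed auto
      qed
      show "AE x in lborel. norm (\<theta> n x * ?f x) \<le> \<bar>?f x\<bar>" for n
        using smooth_step_nonneg smooth_step_le_1
        by (auto simp: \<theta>_def abs_mult intro!: mult_left_le_one_le)
    qed (use int in auto)
    moreover have "(LINT x|lborel. \<theta> n x * ?f x) = 0" for n
      using 0[OF smooth_arc periodic_arc, of "real n" c "cos d"] by (simp add: \<theta>_def mult_ac)
    ultimately show ?thesis
      by (simp add: LIMSEQ_const_iff)
  qed
  have "AE x in lborel. ?f x = 0"
  proof (rule AE_eq_0_if_integrals_eq_0[OF int])
    fix a :: real
    show "(LINT x|lborel. indicator {a<..} x * ?f x) = 0"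
    proof (cases "a < 2 * pi")
      case True
      have "AE x in lborel. x \<noteq> 0 \<and> x \<noteq> 2 * pi"
        using AE_lborel_singleton[of "0::real"] AE_lborel_singleton[of "2 * pi"] by eventually_elim auto
      then have "AE x in lborel. indicator {a<..} x * ?f x = indicator {max 0 a<..<2 * pi} x * ?f x"
        by eventually_elim (auto simp: indicator_def)
      then have "(LINT x|lborel. indicator {a<..} x * ?f x) = (LINT x|lborel. indicator {max 0 a<..<2 * pi} x * ?f x)"
        by (intro integral_cong_AE) auto
      then show ?thesis using arc[of "max 0 a"] True by simp
    next
      case False
      then have "(\<lambda>x. indicator {a<..} x * ?f x) = (\<lambda>x. 0)" by (auto simp: indicator_def)
      then show ?thesis by simp
    qed
  qed
  then show ?thesis by eventually_elim auto
qed

subsection \<open>Solutions with a given profile\<close>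

lemma integral_lebesgue_on_borel:
  fixes f :: "'a::euclidean_space \<Rightarrow> real"
  assumes "S \<in> sets borel" "f \<in> borel_measurable borel"
  shows "(LINT x|lebesgue_on S. f x) = (LINT x|lborel. indicator S x * f x)"
  using assms by (subst integral_restrict_space) (auto simp: integral_completion)

lemma integral_lborel_pair:
  fixes f :: "'a::euclidean_space \<times> 'b::euclidean_space \<Rightarrow> real"
  assumes "integrable lborel f"
  shows "integral\<^sup>L lborel f = (LINT x|lborel. LINT y|lborel. f (x, y))"
    and "integral\<^sup>L lborel f = (LINT y|lborel. LINT x|lborel. f (x, y))"
proof -
  have int: "integrable (lborel \<Otimes>\<^sub>M lborel) f" using assms by (simp add: lborel_prod)
  show 1: "integral\<^sup>L lborel f = (LINT x|lborel. LINT y|lborel. f (x, y))"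
    using lborel_pair.integral_fst'[OF int] by (simp add: lborel_prod)
  show "integral\<^sup>L lborel f = (LINT y|lborel. LINT x|lborel. f (x, y))"
    unfolding 1 using lborel_pair.Fubini_integral[of "\<lambda>x y. f (x, y)"] int by simp
qed

lemma integrable_bounded_on_box:
  fixes f :: "real \<times> real \<Rightarrow> real"
  assumes "f \<in> borel_measurable borel"
    and "\<And>x y. x \<in> {a..b} \<Longrightarrow> y \<in> {c..d} \<Longrightarrow> \<bar>f (x, y)\<bar> \<le> B"
    and "\<And>x y. \<not> (x \<in> {a..b} \<and> y \<in> {c..d}) \<Longrightarrow> f (x, y) = 0"
  shows "integrable lborel f"
proof (rule integrableI_bounded_set[where A = "cbox (a, c) (b, d)" and B = B])
  show "emeasure lborel (cbox (a, c) (b, d)) < \<infinity>" by (rule emeasure_lborel_cbox_finite)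
  have "norm (f p) \<le> B" if "p \<in> cbox (a, c) (b, d)" for p
    using assms(2)[of "fst p" "snd p"] that by (cases p) auto
  then show "AE p in lborel. p \<in> cbox (a, c) (b, d) \<longrightarrow> norm (f p) \<le> B" by simp
  have "f p = 0" if "p \<notin> cbox (a, c) (b, d)" for p
    using assms(3)[of "fst p" "snd p"] that by (cases p) auto
  then show "AE p in lborel. p \<notin> cbox (a, c) (b, d) \<longrightarrow> f p = 0" by simp
qed (use assms in auto)

lemma integrable_bounded_on_interval:
  fixes f :: "real \<Rightarrow> real"
  assumes "f \<in> borel_measurable borel" "\<And>x. x \<in> {a..b} \<Longrightarrow> \<bar>f x\<bar> \<le> B"
    "\<And>x. x \<notin> {a..b} \<Longrightarrow> f x = 0"
  shows "integrable lborel f"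
  by (rule integrableI_bounded_set[where A = "{a..b}" and B = B])
    (use assms in \<open>auto simp: emeasure_lborel_Icc_eq\<close>)

text \<open>The solution with profile \<open>r\<close>: \<open>g (x, t) = r (x + t)\<close> for \<open>0 \<le> x < 2\<pi>\<close>, periodic in \<open>x\<close>. Its trace at
  \<open>0+\<close> is \<open>r t\<close>, its trace at \<open>0-\<close> is \<open>r (t + 2\<pi>)\<close>.\<close>

definition rolled :: "(real \<Rightarrow> real) \<Rightarrow> real \<times> real \<Rightarrow> real" where
  "rolled r p = r (fst p - 2 * pi * of_int \<lfloor>fst p / (2 * pi)\<rfloor> + snd p)"

lemma periodic_rolled: "periodic (\<lambda>x. rolled r (x, t))"
proof -
  have "\<lfloor>(x + 2 * pi) / (2 * pi)\<rfloor> = \<lfloor>x / (2 * pi)\<rfloor> + 1" for x :: real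
    by (simp add: add_divide_distrib)
  then show ?thesis
    by (simp add: periodic_def rolled_def algebra_simps)
qed

lemma rolled_nonneg: "0 \<le> x \<Longrightarrow> x < 2 * pi \<Longrightarrow> rolled r (x, t) = r (x + t)"
  by (simp add: rolled_def floor_eq_iff[of _ 0, THEN iffD2])

lemma rolled_neg: "- 2 * pi \<le> x \<Longrightarrow> x < 0 \<Longrightarrow> rolled r (x, t) = r (x + t + 2 * pi)"
proof -
  assume "- 2 * pi \<le> x" "x < 0"
  then have "\<lfloor>x / (2 * pi)\<rfloor> = - 1" by (intro floor_eq_iff[THEN iffD2]) (auto simp: field_simps)
  then show ?thesis by (simp add: rolled_def algebra_simps)
qed

lemma continuous_bounded_on_cbox:
  fixes f :: "'a::euclidean_space \<Rightarrow> real"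
  assumes "continuous_on (cbox a b) f"
  shows "\<exists>C. \<forall>x\<in>cbox a b. \<bar>f x\<bar> \<le> C"
  using compact_imp_bounded[OF compact_continuous_image[OF assms compact_cbox]]
  unfolding bounded_iff by auto

text \<open>The adjoint expression is the derivative of \<open>\<psi>\<close> in the direction
  \<open>(1, -1)\<close>, that is, along the characteristics \<open>x + t = s\<close>. The other
  properties are the supports and bounds from which integrability follows.\<close>

lemma test_function_derivative:
  assumes "test_function \<psi>"
  obtains K a b C where "\<And>p. K p = - frechet_derivative \<psi> (at p) (0, 1) + frechet_derivative \<psi> (at p) (1, 0)"
    "K \<in> borel_measurable borel" "0 < a" "\<And>x t. t \<notin> {a..b} \<Longrightarrow> K (x, t) = 0"
    "\<And>x t. t \<notin> {a..b} \<Longrightarrow> \<psi> (x, t) = 0"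
    "\<And>x t. x \<in> {0..2 * pi} \<Longrightarrow> \<bar>K (x, t)\<bar> \<le> C" "\<And>t. \<bar>\<psi> (0, t)\<bar> \<le> C"
    "\<And>x s. ((\<lambda>x. \<psi> (x, s - x)) has_real_derivative K (x, s - x)) (at x)"
    "continuous_on UNIV K"
proof -
  have sm: "smooth \<psi>" using assms by (simp add: test_function_def)
  define K where "K p = - frechet_derivative \<psi> (at p) (0, 1) + frechet_derivative \<psi> (at p) (1, 0)" for p
  obtain a b where ab: "a > 0" "\<And>x t. t \<notin> {a..b} \<Longrightarrow> \<psi> (x, t) = 0"
    using assms unfolding test_function_def by blast
  have cont: "continuous_on UNIV K"
    unfolding K_def using smooth_has_derivative(2)[OF sm] by (intro continuous_intros)
  have K0: "K (x, t) = 0" if t: "t \<notin> {a..b}" for x t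
  proof -
    \<comment> \<open>Off the closed interval \<open>\<psi>\<close> vanishes on a whole
      neighbourhood, hence so does its derivative.\<close>
    have "open (UNIV \<times> - {a..b} :: (real \<times> real) set)"
      by (intro open_Times) auto
    then have "(\<psi> has_derivative (\<lambda>_. 0)) (at (x, t))"
    proof (rule has_derivative_transform_within_open[OF has_derivative_const[of 0]])
      fix p :: "real \<times> real" assume "p \<in> UNIV \<times> - {a..b}"
      then show "0 = \<psi> p" using ab(2)[of "snd p" "fst p"] by (cases p) auto
    qed (use t in simp)
    then have "frechet_derivative \<psi> (at (x, t)) = (\<lambda>_. 0)"
      by (rule frechet_derivative_at[symmetric])
    then show ?thesis by (simp add: K_def)
  qed
  obtain C1 where C1: "\<And>p. p \<in> cbox (0, a) (2 * pi, b) \<Longrightarrow> \<bar>K p\<bar> \<le> C1"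
    using continuous_bounded_on_cbox[OF continuous_on_subset[OF cont subset_UNIV]] by blast
  obtain C2 where C2: "\<And>p. p \<in> cbox (0, a) (2 * pi, b) \<Longrightarrow> \<bar>\<psi> p\<bar> \<le> C2"
    using continuous_bounded_on_cbox[OF smooth_imp_continuous[OF sm]] by blast
  show thesis
  proof (rule that[of K a b "max 0 (max C1 C2)", OF K_def])
    show "K \<in> borel_measurable borel" by (rule borel_measurable_continuous_onI[OF cont])
    show "\<bar>K (x, t)\<bar> \<le> max 0 (max C1 C2)" if "x \<in> {0..2 * pi}" for x t
      using K0[of t x] C1[of "(x, t)"] that by (cases "t \<in> {a..b}") (auto simp: cbox_Pair_eq)
    show "\<bar>\<psi> (0, t)\<bar> \<le> max 0 (max C1 C2)" for t
      using ab(2)[of t 0] C2[of "(0, t)"] by (cases "t \<in> {a..b}") (auto simp: cbox_Pair_eq)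
    show "((\<lambda>x. \<psi> (x, s - x)) has_real_derivative K (x, s - x)) (at x)" for x s
    proof -
      let ?D = "frechet_derivative \<psi> (at (x, s - x))"
      have D: "(\<psi> has_derivative ?D) (at (x, s - x))"
        by (rule smooth_has_derivative(1)[OF sm])
      have lin: "?D (v, - v) = K (x, s - x) * v" for v
      proof -
        have "(v, - v) = v *\<^sub>R ((1, 0) - (0, 1))" by simp
        then show ?thesis
          using has_derivative_linear[OF D]
          by (simp only: linear_cmul linear_diff) (simp add: K_def algebra_simps)
      qed
      have "((\<lambda>x. (x, s - x)) has_derivative (\<lambda>v. (v, - v))) (at x)"
        by (auto intro!: derivative_eq_intros)
      from has_derivative_compose[OF this D] show ?thesis
        by (simp add: has_field_derivative_def lin)
    qed
  qed (use ab K0 cont in auto)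
qed

text \<open>Boundedness is asked on half-lines \<open>s \<le> T\<close> only, because the bound for
  \<open>G - past u\<close> grows with the number of terms in the sum.\<close>

locale profile =
  fixes r :: "real \<Rightarrow> real"
  assumes measurable_profile [measurable]: "r \<in> borel_measurable borel"
    and locally_bounded: "\<exists>B. \<forall>s\<le>T. \<bar>r s\<bar> \<le> B"
begin

lemma measurable_rolled [measurable]: "rolled r \<in> borel_measurable borel"
proof -
  show ?thesis unfolding rolled_def[abs_def] by measurable
qed

text \<open>After the substitution \<open>t = s - x\<close> the inner integrand is a derivative
  along the characteristic, and integrating in \<open>x\<close> leaves
  \<open>\<psi> (2 * pi, s - 2 * pi) - \<psi> (0, s)\<close>. Periodicity of \<open>\<psi>\<close>
  and a shift of \<open>s\<close> move the first term onto \<open>r (s + 2 * pi)\<close>: the source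
  is the jump of \<open>rolled r\<close> at \<open>x = 0\<close>.\<close>

lemma wave_equation_rolled: "wave_equation (rolled r) (\<lambda>s. r s - r (s + 2 * pi))"
  unfolding wave_equation_def
proof (intro allI impI)
  fix \<psi> assume \<psi>: "test_function \<psi>"
  obtain K a b C where K: "\<And>p. K p = - frechet_derivative \<psi> (at p) (0, 1) + frechet_derivative \<psi> (at p) (1, 0)"
    and [measurable]: "K \<in> borel_measurable borel" and "0 < a"
    and K0: "\<And>x t. t \<notin> {a..b} \<Longrightarrow> K (x, t) = 0"
    and \<psi>0: "\<And>x t. t \<notin> {a..b} \<Longrightarrow> \<psi> (x, t) = 0"
    and C: "\<And>x t. x \<in> {0..2 * pi} \<Longrightarrow> \<bar>K (x, t)\<bar> \<le> C" "\<And>t. \<bar>\<psi> (0, t)\<bar> \<le> C"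
    and D: "\<And>x s. ((\<lambda>x. \<psi> (x, s - x)) has_real_derivative K (x, s - x)) (at x)"
    and contK: "continuous_on UNIV K"
    by (rule test_function_derivative[OF \<psi>]) (rule that; assumption)
  obtain B where B: "\<And>s. s \<le> b + 2 * pi \<Longrightarrow> \<bar>r s\<bar> \<le> B" using locally_bounded by blast
  have per: "\<psi> (2 * pi, t) = \<psi> (0, t)" for t
    using \<psi> unfolding test_function_def periodic_def by (metis add_0)
  have B0: "0 \<le> B" using B[of "b + 2 * pi"] by linarith
  have C0: "0 \<le> C" using C(2)[of 0] by linarith
  have [measurable]: "(\<lambda>t. \<psi> (0, t)) \<in> borel_measurable borel"
    using \<psi> unfolding test_function_def
    by (intro borel_measurable_continuous_onI continuous_on_compose2[OF smooth_imp_continuous[of \<psi> UNIV]]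
        continuous_intros) auto
  let ?I = "\<lambda>x. indicator {0..<2 * pi} x :: real"
  \<comment> \<open>The interval is half-open because \<open>rolled\<close> starts anew at
    \<open>x = 2 * pi\<close>; the restriction to \<open>t > 0\<close> is absorbed by
    \<open>K\<close>, which vanishes for \<open>t < a\<close>.\<close>
  define F where "F p = ?I (fst p) * (r (fst p + snd p) * K p)" for p
  have [measurable]: "F \<in> borel_measurable borel" unfolding F_def by measurable
  have F: "\<bar>F (x, t)\<bar> \<le> B * C" "\<not> (x \<in> {0..2 * pi} \<and> t \<in> {a..b}) \<Longrightarrow> F (x, t) = 0" for x t
  proof -
    show "\<not> (x \<in> {0..2 * pi} \<and> t \<in> {a..b}) \<Longrightarrow> F (x, t) = 0"
      using K0[of t x] by (auto simp: F_def)
    show "\<bar>F (x, t)\<bar> \<le> B * C"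
    proof (cases "x \<in> {0..<2 * pi} \<and> t \<in> {a..b}")
      case True
      then have "\<bar>F (x, t)\<bar> = \<bar>r (x + t)\<bar> * \<bar>K (x, t)\<bar>" by (simp add: F_def abs_mult)
      also have "\<dots> \<le> B * C" using True C(1)[of x t] B[of "x + t"] C0 B0 by (intro mult_mono) auto
      finally show ?thesis .
    next
      case False
      then have "F (x, t) = 0" using K0[of t x] by (auto simp: F_def)
      then show ?thesis using B0 C0 by simp
    qed
  qed
  have intF: "integrable lborel F"
    by (rule integrable_bounded_on_box[where a = 0 and b = "2 * pi" and c = a and d = b and B = "B * C"])
      (use F in auto)
  \<comment> \<open>In the variables \<open>(x, s)\<close> with \<open>s = x + t\<close> the support
    spreads to \<open>s\<close> in \<open>[a, b + 2 * pi]\<close>.\<close>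
  have F_shift: "(\<lambda>p. F (fst p, snd p - fst p)) \<in> borel_measurable borel" by measurable
  have intF': "integrable lborel (\<lambda>p. F (fst p, snd p - fst p))"
  proof (rule integrable_bounded_on_box[OF F_shift, where a = 0 and b = "2 * pi" and c = a and d = "b + 2 * pi" and B = "B * C"])
    show "F (fst (x, y), snd (x, y) - fst (x, y)) = 0" if "\<not> (x \<in> {0..2 * pi} \<and> y \<in> {a..b + 2 * pi})" for x y
      using that F(2)[of x "y - x"] by auto
  qed (use F in auto)
  have intr: "integrable lborel (\<lambda>s. r s * \<psi> (0, s))"
  proof (rule integrable_bounded_on_interval[of _ a b "B * C"])
    show "\<bar>r s * \<psi> (0, s)\<bar> \<le> B * C" if "s \<in> {a..b}" for s
      unfolding abs_mult using that pi_ge_zero by (intro mult_mono B C B0) (auto intro: order_trans[of s b])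
  qed (use \<psi>0 in auto)
  have intr2: "integrable lborel (\<lambda>s. r (s + 2 * pi) * \<psi> (0, s))"
  proof (rule integrable_bounded_on_interval[of _ a b "B * C"])
    show "\<bar>r (s + 2 * pi) * \<psi> (0, s)\<bar> \<le> B * C" if "s \<in> {a..b}" for s
      unfolding abs_mult using that by (intro mult_mono B C B0) auto
  qed (use \<psi>0 in auto)
  have set: "{0..2 * pi} \<times> {0<..} \<in> sets (borel :: (real \<times> real) measure)"
    by (intro borel_Times) auto
  have "AE p in lborel. fst (p :: real \<times> real) \<noteq> 2 * pi"
  proof -
    have "negligible {p :: real \<times> real. p \<bullet> (1, 0) = 2 * pi}"
      by (rule negligible_standard_hyperplane) (simp add: Basis_prod_def)
    then show ?thesis
      unfolding AE_lebesgue_iff_lborel[symmetric] eventually_ae_filter_negligible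
      by (intro exI[of _ "{p. p \<bullet> (1, 0) = 2 * pi}"]) (auto simp: inner_prod_def)
  qed
  then have AE: "AE p in lborel. indicator ({0..2 * pi} \<times> {0<..}) p * (rolled r p * K p) = F p"
  proof eventually_elim
    fix p :: "real \<times> real" assume "fst p \<noteq> 2 * pi"
    then show "indicator ({0..2 * pi} \<times> {0<..}) p * (rolled r p * K p) = F p"
      using \<open>0 < a\<close> K0[of "snd p" "fst p"] rolled_nonneg[of "fst p" r "snd p"]
      by (cases p) (auto simp: F_def indicator_def)
  qed
  have "(LINT p|lebesgue_on ({0..2 * pi} \<times> {0<..}). rolled r p * K p)
      = (LINT p|lborel. indicator ({0..2 * pi} \<times> {0<..}) p * (rolled r p * K p))"
    by (rule integral_lebesgue_on_borel[OF set]) measurable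
  also have "\<dots> = integral\<^sup>L lborel F"
  proof (rule integral_cong_AE[OF _ _ AE])
    show "(\<lambda>p. indicator ({0..2 * pi} \<times> {0<..}) p * (rolled r p * K p)) \<in> borel_measurable lborel"
      by (intro borel_measurable_times borel_measurable_indicator) (use set in auto)
  qed simp
  also have "\<dots> = (LINT x|lborel. LINT t|lborel. F (x, t))"
    by (rule integral_lborel_pair(1)[OF intF])
  also have "\<dots> = (LINT x|lborel. LINT s|lborel. F (x, s - x))"
  proof -
    have "(LINT t|lborel. F (x, t)) = (LINT s|lborel. F (x, s - x))" for x
      using lborel_integral_real_affine[of 1 "\<lambda>t. F (x, t)" "- x"] by simp
    then show ?thesis by simp
  qed
  also have "\<dots> = (LINT s|lborel. LINT x|lborel. F (x, s - x))"
    using integral_lborel_pair[OF intF'] by simp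
  also have "\<dots> = (LINT s|lborel. r s * \<psi> (0, s - 2 * pi) - r s * \<psi> (0, s))"
  proof (rule Bochner_Integration.integral_cong[OF refl])
    fix s :: real
    have "continuous_on UNIV (\<lambda>x. K (x, s - x))"
      by (rule continuous_on_compose2[OF contK]) (auto intro!: continuous_intros)
    then have contK': "isCont (\<lambda>x. K (x, s - x)) x" for x
      by (simp add: continuous_on_eq_continuous_at)
    have "(LINT x|lborel. F (x, s - x)) = (LINT x|lborel. r s * (indicator {0..2 * pi} x * K (x, s - x)))"
    proof (rule integral_cong_AE)
      show "AE x in lborel. F (x, s - x) = r s * (indicator {0..2 * pi} x * K (x, s - x))"
        using AE_lborel_singleton[of "2 * pi"]
        by eventually_elim (auto simp: F_def indicator_def)
    qed measurable
    also have "\<dots> = r s * (LINT x|lborel. indicator {0..2 * pi} x * K (x, s - x))"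
      by simp
    also have "(LINT x|lborel. indicator {0..2 * pi} x * K (x, s - x)) = \<psi> (2 * pi, s - 2 * pi) - \<psi> (0, s - 0)"
      using integral_FTC_Icc_real[of 0 "2 * pi" "\<lambda>x. \<psi> (x, s - x)" "\<lambda>x. K (x, s - x)"] D contK'
      by (simp add: mult.commute)
    finally show "(LINT x|lborel. F (x, s - x)) = r s * \<psi> (0, s - 2 * pi) - r s * \<psi> (0, s)"
      by (simp only: per right_diff_distrib diff_zero)
  qed
  also have "\<dots> = (LINT s|lborel. r s * \<psi> (0, s - 2 * pi)) - (LINT s|lborel. r s * \<psi> (0, s))"
    using lborel_integrable_real_affine[OF intr2, of 1 "- 2 * pi"] intr
    by (intro Bochner_Integration.integral_diff) auto
  also have "(LINT s|lborel. r s * \<psi> (0, s - 2 * pi)) = (LINT s|lborel. r (s + 2 * pi) * \<psi> (0, s))"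
    using lborel_integral_real_affine[of 1 "\<lambda>s. r s * \<psi> (0, s - 2 * pi)" "2 * pi"] by (simp add: add.commute)
  also have "\<dots> - (LINT s|lborel. r s * \<psi> (0, s)) = (LINT s|lborel. r (s + 2 * pi) * \<psi> (0, s) - r s * \<psi> (0, s))"
    by (rule Bochner_Integration.integral_diff[symmetric, OF intr2 intr])
  also have "\<dots> = (LINT s|lborel. - (indicator {0<..} s * ((r s - r (s + 2 * pi)) * \<psi> (0, s))))"
    using \<psi>0 \<open>0 < a\<close> by (intro Bochner_Integration.integral_cong) (auto simp: indicator_def algebra_simps)
  also have "\<dots> = - (LINT s|lebesgue_on {0<..}. (r s - r (s + 2 * pi)) * \<psi> (0, s))"
    by (subst integral_lebesgue_on_borel) auto
  finally show "(LINT p|lebesgue_on ({0..2 * pi} \<times> {0<..}).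
        rolled r p * (- frechet_derivative \<psi> (at p) (0, 1) + frechet_derivative \<psi> (at p) (1, 0)))
     = - (LINT t|lebesgue_on {0<..}. (r t - r (t + 2 * pi)) * \<psi> (0, t))"
    by (simp only: K)
qed

section \<open>Local L1 continuity of translations of the profile, and its consequences\<close>

lemma integrable_translation_difference:
  assumes "S \<in> sets borel" "S \<subseteq> {a..b}"
  shows "integrable lborel (\<lambda>x. indicator S x * \<bar>r (x + h) - r x\<bar>)"
proof -
  obtain B where B: "\<And>s. s \<le> b + \<bar>h\<bar> \<Longrightarrow> \<bar>r s\<bar> \<le> B" using locally_bounded by blast
  show ?thesis
  proof (rule integrable_bounded_on_interval[of _ a b "2 * B"])
    fix x assume "x \<in> {a..b}"
    then have "x \<le> b + \<bar>h\<bar>" "x + h \<le> b + \<bar>h\<bar>" by auto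
    then have "\<bar>r (x + h) - r x\<bar> \<le> 2 * B" using B[of x] B[of "x + h"] by linarith
    moreover have "0 \<le> B" using B[of b] by auto
    ultimately show "\<bar>indicator S x * \<bar>r (x + h) - r x\<bar>\<bar> \<le> 2 * B" by (auto simp: indicator_def)
  qed (use assms in \<open>auto simp: indicator_def\<close>)
qed

lemma locally_L1_continuous_translation:
  "((\<lambda>h. LINT x|lborel. indicator {- T..T} x * \<bar>r (x + h) - r x\<bar>) \<longlongrightarrow> 0) (at 0)"
proof -
  \<comment> \<open>The margin 1 keeps both \<open>x\<close> and \<open>x + h\<close> inside the
    cutoff when \<open>\<bar>x\<bar> \<le> T\<close> and \<open>\<bar>h\<bar> < 1\<close>.\<close>
  define f where "f x = indicator {- (\<bar>T\<bar> + 1)..\<bar>T\<bar> + 1} x * r x" for x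
  have [measurable]: "f \<in> borel_measurable borel" unfolding f_def by measurable
  obtain B where B: "\<And>s. s \<le> \<bar>T\<bar> + 1 \<Longrightarrow> \<bar>r s\<bar> \<le> B" using locally_bounded by blast
  have f_bound: "\<bar>f x\<bar> \<le> B" for x
    using B[of x] B[of 0] by (auto simp: f_def indicator_def)
  have f_supp: "f x = 0" if "\<bar>x\<bar> > \<bar>T\<bar> + 1" for x
    using that by (auto simp: f_def indicator_def)
  have f_int: "integrable lborel f"
    by (rule integrable_bounded_on_interval[OF _ f_bound, where a = "- (\<bar>T\<bar> + 1)" and b = "\<bar>T\<bar> + 1"])
      (auto simp: f_def)
  have "((\<lambda>h. LINT x|lborel. \<bar>f (x + h) - f x\<bar>) \<longlongrightarrow> 0) (at 0)"
    using f_bound f_supp by (intro L1_continuous_translation[of f B "\<bar>T\<bar> + 1"]) auto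
  moreover have "\<forall>\<^sub>F h in at 0. norm (LINT x|lborel. indicator {- T..T} x * \<bar>r (x + h) - r x\<bar>)
      \<le> (LINT x|lborel. \<bar>f (x + h) - f x\<bar>)"
  proof -
    have "\<forall>\<^sub>F h::real in at 0. \<bar>h\<bar> < 1"
      using eventually_at_ball[of 1 "0::real" UNIV] by (auto simp: dist_real_def elim: eventually_mono)
    then show ?thesis
    proof eventually_elim
      fix h :: real assume h: "\<bar>h\<bar> < 1"
      have "(LINT x|lborel. indicator {- T..T} x * \<bar>r (x + h) - r x\<bar>)
          \<le> (LINT x|lborel. \<bar>f (x + h) - f x\<bar>)"
      proof (rule integral_mono[OF integrable_translation_difference[of _ "- T" T]])
        show "integrable lborel (\<lambda>x. \<bar>f (x + h) - f x\<bar>)"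
          using lborel_integrable_real_affine[OF f_int, of 1 h] f_int
          by (intro integrable_abs Bochner_Integration.integrable_diff) (auto simp: add.commute)
        show "indicator {- T..T} x * \<bar>r (x + h) - r x\<bar> \<le> \<bar>f (x + h) - f x\<bar>" for x
          using h by (auto simp: f_def indicator_def)
      qed auto
      then show "norm (LINT x|lborel. indicator {- T..T} x * \<bar>r (x + h) - r x\<bar>)
          \<le> (LINT x|lborel. \<bar>f (x + h) - f x\<bar>)"
        by (simp add: integral_nonneg_AE)
    qed
  qed
  ultimately show ?thesis by (rule Lim_null_comparison[rotated])
qed

text \<open>A limit at 0 says nothing about \<open>h = 0\<close> itself. There the integral is 0,
  which fills the gap and gives an estimate on a full interval of shifts.\<close>

lemma translation_close:
  assumes "e > 0"
  obtains d where "d > 0"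
    "\<And>h. \<bar>h\<bar> < d \<Longrightarrow> (LINT x|lborel. indicator {- T..T} x * \<bar>r (x + h) - r x\<bar>) < e"
proof -
  obtain d where "d > 0" and d: "\<And>h. h \<noteq> 0 \<Longrightarrow> \<bar>h\<bar> < d \<Longrightarrow>
      (LINT x|lborel. indicator {- T..T} x * \<bar>r (x + h) - r x\<bar>) < e"
    using order_tendstoD(2)[OF locally_L1_continuous_translation assms, of T]
    unfolding eventually_at by (auto simp: dist_real_def)
  show thesis
  proof (rule that[OF \<open>d > 0\<close>])
    fix h :: real assume "\<bar>h\<bar> < d"
    then show "(LINT x|lborel. indicator {- T..T} x * \<bar>r (x + h) - r x\<bar>) < e"
      using d[of h] assms by (cases "h = 0") auto
  qed
qed

lemma integral_rolled_period:
  assumes "continuous_on UNIV \<theta>"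
  shows "(LINT x|lebesgue_on {0..2 * pi}. rolled r (x, t) * \<theta> x)
    = (LINT x|lborel. indicator {0..2 * pi} x * (r (x + t) * \<theta> x))"
proof -
  have [measurable]: "\<theta> \<in> borel_measurable borel" using assms by (rule borel_measurable_continuous_onI)
  have [measurable]: "(\<lambda>x. rolled r (x, t)) \<in> borel_measurable borel"
    unfolding rolled_def fst_conv snd_conv by measurable
  have "(LINT x|lebesgue_on {0..2 * pi}. rolled r (x, t) * \<theta> x)
      = (LINT x|lborel. indicator {0..2 * pi} x * (rolled r (x, t) * \<theta> x))"
    by (rule integral_lebesgue_on_borel) auto
  also have "\<dots> = (LINT x|lborel. indicator {0..2 * pi} x * (r (x + t) * \<theta> x))"
  proof (rule integral_cong_AE)
    show "AE x in lborel. indicator {0..2 * pi} x * (rolled r (x, t) * \<theta> x)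
        = indicator {0..2 * pi} x * (r (x + t) * \<theta> x)"
      using AE_lborel_singleton[of "2 * pi"]
      by eventually_elim (auto simp: indicator_def rolled_nonneg)
  qed auto
  finally show ?thesis .
qed

lemma integrable_period:
  assumes "continuous_on UNIV \<theta>"
  shows "integrable lborel (\<lambda>x. indicator {0..2 * pi} x * (r (x + t) * \<theta> x))"
proof -
  have [measurable]: "\<theta> \<in> borel_measurable borel" using assms by (rule borel_measurable_continuous_onI)
  obtain B where B: "\<And>s. s \<le> 2 * pi + t \<Longrightarrow> \<bar>r s\<bar> \<le> B" using locally_bounded by blast
  obtain C where C: "\<And>x. x \<in> {0..2 * pi} \<Longrightarrow> \<bar>\<theta> x\<bar> \<le> C"
    using continuous_bounded_on_cbox[OF continuous_on_subset[OF assms subset_UNIV], of 0 "2 * pi"]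
    unfolding cbox_interval by blast
  show ?thesis
  proof (rule integrable_bounded_on_interval[of _ 0 "2 * pi" "B * C"])
    fix x assume x: "x \<in> {0..2 * pi}"
    have "\<bar>r (x + t)\<bar> * \<bar>\<theta> x\<bar> \<le> B * C"
      using x by (intro mult_mono B C) (auto intro: order_trans[OF abs_ge_zero B])
    then show "\<bar>indicator {0..2 * pi} x * (r (x + t) * \<theta> x)\<bar> \<le> B * C"
      using x by (simp add: abs_mult)
  qed auto
qed

text \<open>Paired with \<open>\<theta>\<close>, two times differ by at most a bound for
  \<open>\<bar>\<theta>\<bar>\<close> times the L1 distance of two translates of \<open>r\<close>
  over a period.\<close>

lemma continuous_into_distributions_rolled: "continuous_into_distributions (rolled r)"
  unfolding continuous_into_distributions_def continuous_on_iff
proof (intro allI impI ballI)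
  fix \<theta> and t e :: real
  assume \<theta>: "smooth \<theta> \<and> periodic \<theta>" and t: "t \<in> {0..}" and e: "0 < e"
  have cont: "continuous_on UNIV \<theta>" using \<theta> smooth_imp_continuous by blast
  obtain C where "\<And>x. x \<in> {0..2 * pi} \<Longrightarrow> \<bar>\<theta> x\<bar> \<le> C"
    using continuous_bounded_on_cbox[OF continuous_on_subset[OF cont subset_UNIV], of 0 "2 * pi"]
    unfolding cbox_interval by blast
  \<comment> \<open>The maximum with 1 makes the bound positive, so that \<open>e\<close> can be
    divided by it.\<close>
  then have C: "\<And>x. x \<in> {0..2 * pi} \<Longrightarrow> \<bar>\<theta> x\<bar> \<le> max 1 C"
    using max.coboundedI2 by metis
  have e': "0 < e / max 1 C" using e by simp
  obtain d where "d > 0" and d: "\<And>h. \<bar>h\<bar> < d \<Longrightarrow>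
      (LINT x|lborel. indicator {- (t + 2 * pi)..t + 2 * pi} x * \<bar>r (x + h) - r x\<bar>) < e / max 1 C"
    by (rule translation_close[OF e', of "t + 2 * pi"]) (rule that; assumption)
  have "dist (LINT x|lebesgue_on {0..2 * pi}. rolled r (x, t') * \<theta> x)
      (LINT x|lebesgue_on {0..2 * pi}. rolled r (x, t) * \<theta> x) < e" if "dist t' t < d" for t'
  proof -
    define h where "h = t' - t"
    have "(LINT x|lborel. indicator {0..2 * pi} x * \<bar>r (x + t') - r (x + t)\<bar>)
        = (LINT x|lborel. indicator {t..t + 2 * pi} x * \<bar>r (x + h) - r x\<bar>)"
    proof -
      have "(indicator {0..2 * pi} (x - t) :: real) = indicator {t..t + 2 * pi} x" for x
        by (auto simp: indicator_def)
      then show ?thesis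
        using lborel_integral_real_affine[of 1 "\<lambda>x. indicator {0..2 * pi} x * \<bar>r (x + t') - r (x + t)\<bar>" "- t"]
        by (simp add: h_def algebra_simps)
    qed
    also have "\<dots> \<le> (LINT x|lborel. indicator {- (t + 2 * pi)..t + 2 * pi} x * \<bar>r (x + h) - r x\<bar>)"
    proof (rule integral_mono)
      show "integrable lborel (\<lambda>x. indicator {t..t + 2 * pi} x * \<bar>r (x + h) - r x\<bar>)"
        by (rule integrable_translation_difference[where a = t and b = "t + 2 * pi"]) auto
      show "integrable lborel (\<lambda>x. indicator {- (t + 2 * pi)..t + 2 * pi} x * \<bar>r (x + h) - r x\<bar>)"
        by (rule integrable_translation_difference[where a = "- (t + 2 * pi)" and b = "t + 2 * pi"]) auto
    qed (use t pi_gt_zero in \<open>auto simp: indicator_def\<close>)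
    also have "\<dots> < e / max 1 C"
      by (rule d) (use that in \<open>simp add: h_def dist_real_def\<close>)
    finally have small: "(LINT x|lborel. indicator {0..2 * pi} x * \<bar>r (x + t') - r (x + t)\<bar>) < e / max 1 C" .
    have "dist (LINT x|lebesgue_on {0..2 * pi}. rolled r (x, t') * \<theta> x)
        (LINT x|lebesgue_on {0..2 * pi}. rolled r (x, t) * \<theta> x)
      = \<bar>LINT x|lborel. indicator {0..2 * pi} x * (r (x + t') * \<theta> x) - indicator {0..2 * pi} x * (r (x + t) * \<theta> x)\<bar>"
      by (simp add: integral_rolled_period[OF cont] dist_real_def Bochner_Integration.integral_diff integrable_period[OF cont])
    also have "\<dots> \<le> (LINT x|lborel. max 1 C * (indicator {0..2 * pi} x * \<bar>r (x + t') - r (x + t)\<bar>))"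
    proof (rule integral_abs_bound_integral)
      show "integrable lborel (\<lambda>x. indicator {0..2 * pi} x * (r (x + t') * \<theta> x) - indicator {0..2 * pi} x * (r (x + t) * \<theta> x))"
        by (intro Bochner_Integration.integrable_diff integrable_period cont)
      have "integrable lborel (\<lambda>x. indicator {0..2 * pi} x * (r (x + t') * 1) - indicator {0..2 * pi} x * (r (x + t) * 1))"
        by (intro Bochner_Integration.integrable_diff integrable_period) auto
      then have "integrable lborel (\<lambda>x. \<bar>indicator {0..2 * pi} x * (r (x + t') * 1) - indicator {0..2 * pi} x * (r (x + t) * 1)\<bar>)"
        by (rule integrable_abs)
      moreover have "\<bar>indicator {0..2 * pi} x * (r (x + t') * 1) - indicator {0..2 * pi} x * (r (x + t) * 1)\<bar>
          = indicator {0..2 * pi} x * \<bar>r (x + t') - r (x + t)\<bar>" for x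
        by (auto simp: indicator_def)
      ultimately show "integrable lborel (\<lambda>x. max 1 C * (indicator {0..2 * pi} x * \<bar>r (x + t') - r (x + t)\<bar>))"
        by simp
      show "\<bar>indicator {0..2 * pi} x * (r (x + t') * \<theta> x) - indicator {0..2 * pi} x * (r (x + t) * \<theta> x)\<bar>
          \<le> max 1 C * (indicator {0..2 * pi} x * \<bar>r (x + t') - r (x + t)\<bar>)" for x
      proof (cases "x \<in> {0..2 * pi}")
        case True
        have "\<bar>(r (x + t') - r (x + t)) * \<theta> x\<bar> \<le> \<bar>r (x + t') - r (x + t)\<bar> * max 1 C"
          unfolding abs_mult by (intro mult_left_mono C True) auto
        then show ?thesis using True by (simp add: algebra_simps)
      qed auto
    qed
    also have "\<dots> = max 1 C * (LINT x|lborel. indicator {0..2 * pi} x * \<bar>r (x + t') - r (x + t)\<bar>)"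
      by simp
    also have "\<dots> < max 1 C * (e / max 1 C)"
      by (intro mult_strict_left_mono small) auto
    finally show ?thesis by simp
  qed
  then show "\<exists>d>0. \<forall>t'\<in>{0..}. dist t' t < d \<longrightarrow>
      dist (LINT x|lebesgue_on {0..2 * pi}. rolled r (x, t') * \<theta> x)
        (LINT x|lebesgue_on {0..2 * pi}. rolled r (x, t) * \<theta> x) < e"
    using \<open>d > 0\<close> by blast
qed

text \<open>The lower end \<open>c h\<close> encodes the side: \<open>c h = 0\<close> gives the
  strip to the right of 0, \<open>c h = - h\<close> the one to the left. Either way the shift
  satisfies \<open>\<bar>x\<bar> \<le> h\<close>, so each inner integral over time is below
  \<open>e / 2\<close> and their mean is at most \<open>e / 2\<close>.\<close>

lemma mean_translation_difference:
  assumes c: "\<And>h. h > 0 \<Longrightarrow> - h \<le> c h \<and> c h \<le> 0" and "T > 0"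
  shows "((\<lambda>h. (1 / h) * (LINT p|lebesgue_on ({c h..c h + h} \<times> {0..T}).
      \<bar>r (fst p + snd p) - r (snd p)\<bar>)) \<longlongrightarrow> 0) (at_right 0)"
proof (rule tendstoI)
  fix e :: real assume e: "e > 0"
  obtain d where "d > 0" and d: "\<And>h. \<bar>h\<bar> < d \<Longrightarrow>
      (LINT x|lborel. indicator {- T..T} x * \<bar>r (x + h) - r x\<bar>) < e / 2"
    by (rule translation_close[OF half_gt_zero[OF e], of T]) (rule that; assumption)
  have "\<forall>\<^sub>F h in at_right 0. 0 < h \<and> h < d"
    using \<open>d > 0\<close> by (auto simp: eventually_at_right_field)
  then show "\<forall>\<^sub>F h in at_right 0. dist ((1 / h) * (LINT p|lebesgue_on ({c h..c h + h} \<times> {0..T}).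
      \<bar>r (fst p + snd p) - r (snd p)\<bar>)) 0 < e"
  proof eventually_elim
    fix h assume h: "0 < h \<and> h < d"
    let ?S = "{c h..c h + h} \<times> {0..T}"
    let ?f = "\<lambda>p. indicator ?S p * \<bar>r (fst p + snd p) - r (snd p)\<bar>"
    have S: "?S \<in> sets borel" by (intro borel_Times) auto
    obtain B where B: "\<And>s. s \<le> T + h \<Longrightarrow> \<bar>r s\<bar> \<le> B" using locally_bounded by blast
    have meas: "?f \<in> borel_measurable borel"
      by (intro borel_measurable_times borel_measurable_indicator S) measurable
    have int: "integrable lborel ?f"
    proof (rule integrable_bounded_on_box[OF meas, of "c h" "c h + h" 0 T "2 * B"])
      fix x y assume xy: "x \<in> {c h..c h + h}" "y \<in> {0..T}"
      have "\<bar>r (x + y)\<bar> \<le> B" "\<bar>r y\<bar> \<le> B"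
        using xy c[of h] h by (auto intro!: B)
      then show "\<bar>?f (x, y)\<bar> \<le> 2 * B" using xy by simp
    qed auto
    have "(LINT p|lebesgue_on ?S. \<bar>r (fst p + snd p) - r (snd p)\<bar>) = integral\<^sup>L lborel ?f"
      by (rule integral_lebesgue_on_borel[OF S]) measurable
    also have "\<dots> = (LINT x|lborel. LINT y|lborel. ?f (x, y))"
      by (rule integral_lborel_pair[OF int])
    also have "\<dots> \<le> (LINT x|lborel. indicator {c h..c h + h} x * (e / 2))"
    proof (rule integral_mono)
      show "integrable lborel (\<lambda>x. LINT y|lborel. ?f (x, y))"
        using lborel_pair.integrable_fst'[of ?f] int by (simp add: lborel_prod)
      show "integrable lborel (\<lambda>x. indicator {c h..c h + h} x * (e / 2))"
        by (rule integrable_bounded_on_interval[of _ "c h" "c h + h" "e / 2"]) (use e in auto)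
      show "(LINT y|lborel. ?f (x, y)) \<le> indicator {c h..c h + h} x * (e / 2)" for x
      proof (cases "x \<in> {c h..c h + h}")
        case True
        have "(LINT y|lborel. ?f (x, y)) = (LINT y|lborel. indicator {0..T} y * \<bar>r (y + x) - r y\<bar>)"
          using True by (intro Bochner_Integration.integral_cong) (auto simp: indicator_def add.commute)
        also have "\<dots> \<le> (LINT y|lborel. indicator {- T..T} y * \<bar>r (y + x) - r y\<bar>)"
        proof (rule integral_mono)
          show "integrable lborel (\<lambda>y. indicator {0..T} y * \<bar>r (y + x) - r y\<bar>)"
            by (rule integrable_translation_difference[where a = 0 and b = T]) auto
          show "integrable lborel (\<lambda>y. indicator {- T..T} y * \<bar>r (y + x) - r y\<bar>)"
            by (rule integrable_translation_difference[where a = "- T" and b = T]) auto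
        qed (use \<open>T > 0\<close> in \<open>auto simp: indicator_def\<close>)
        also have "\<dots> < e / 2"
          using True c[of h] h by (intro d) auto
        finally show ?thesis using True by simp
      qed auto
    qed
    also have "\<dots> = h * (e / 2)" using h by simp
    finally have "(1 / h) * (LINT p|lebesgue_on ?S. \<bar>r (fst p + snd p) - r (snd p)\<bar>) \<le> e / 2"
      using h by (simp add: field_simps)
    moreover have "0 \<le> (LINT p|lebesgue_on ?S. \<bar>r (fst p + snd p) - r (snd p)\<bar>)"
      by (intro integral_nonneg_AE) auto
    then have "dist ((1 / h) * (LINT p|lebesgue_on ?S. \<bar>r (fst p + snd p) - r (snd p)\<bar>)) 0
        = (1 / h) * (LINT p|lebesgue_on ?S. \<bar>r (fst p + snd p) - r (snd p)\<bar>)"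
      using h by simp
    ultimately show "dist ((1 / h) * (LINT p|lebesgue_on ?S. \<bar>r (fst p + snd p) - r (snd p)\<bar>)) 0 < e"
      using e by linarith
  qed
qed

end

subsection \<open>The homogeneous wave equation\<close>

lemma borel_measurable_lebesgue_on_cong_AE:
  fixes f :: "'a::euclidean_space \<Rightarrow> real"
  assumes S: "S \<in> sets lebesgue" and f': "f' \<in> borel_measurable (lebesgue_on S)"
    and AE: "AE x in lborel. x \<in> S \<longrightarrow> f x = f' x"
  shows "f \<in> borel_measurable (lebesgue_on S)"
proof -
  have "(\<lambda>x. if x \<in> S then f' x else 0) \<in> borel_measurable lebesgue"
    using f' S by (subst borel_measurable_if) auto
  then have "(\<lambda>x. if x \<in> S then f x else 0) \<in> borel_measurable lebesgue"
  proof (rule borel_measurable_AE)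
    show "AE x in lebesgue. (if x \<in> S then f' x else 0) = (if x \<in> S then f x else 0)"
      unfolding AE_lebesgue_iff_lborel using AE by eventually_elim auto
  qed
  then show ?thesis using S by (subst (asm) borel_measurable_if) auto
qed

text \<open>Measurability of \<open>f\<close> comes from the almost everywhere equality, Lebesgue
  measure being complete. This is how integrals of the given functions pass to their Borel
  representatives.\<close>

lemma integral_lebesgue_on_cong_borel:
  fixes f :: "'a::euclidean_space \<Rightarrow> real"
  assumes S: "S \<in> sets borel" and f': "f' \<in> borel_measurable borel"
    and AE: "AE x in lborel. x \<in> S \<longrightarrow> f x = f' x"
  shows "(LINT x|lebesgue_on S. f x) = (LINT x|lborel. indicator S x * f' x)"
proof -
  have f'_meas: "f' \<in> borel_measurable (lebesgue_on S)"
    using f' by (intro measurable_restrict_space1 measurable_completion) simp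
  have "(LINT x|lebesgue_on S. f x) = (LINT x|lebesgue_on S. f' x)"
  proof (rule integral_cong_AE[OF _ f'_meas])
    show "f \<in> borel_measurable (lebesgue_on S)"
      using S by (intro borel_measurable_lebesgue_on_cong_AE[OF _ f'_meas AE]) auto
    show "AE x in lebesgue_on S. f x = f' x"
      using S AE by (subst AE_lebesgue_on_iff) auto
  qed
  then show ?thesis by (simp only: integral_lebesgue_on_borel[OF S f'])
qed

lemma AE_lborel_sections:
  fixes Q :: "'a::euclidean_space \<times> 'b::euclidean_space \<Rightarrow> bool"
  assumes "AE p in lborel. Q p"
  shows "AE y in lborel. AE x in lborel. Q (x, y)"
proof -
  from assms[folded lborel_prod] obtain N where N: "N \<in> null_sets (lborel \<Otimes>\<^sub>M lborel)"
    and Q: "{p \<in> space (lborel \<Otimes>\<^sub>M lborel). \<not> Q p} \<subseteq> N"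
    by (auto elim!: AE_E simp: null_setsI)
  have "AE x in lborel. AE y in lborel. (x, y) \<notin> N"
    using lborel_pair.AE_pair[OF AE_not_in[OF N]] .
  moreover have "{p \<in> space (lborel \<Otimes>\<^sub>M lborel). (fst p, snd p) \<notin> N} \<in> sets (lborel \<Otimes>\<^sub>M lborel)"
  proof -
    have "{p \<in> space (lborel \<Otimes>\<^sub>M lborel). (fst p, snd p) \<notin> N} = space (lborel \<Otimes>\<^sub>M lborel) - N"
      by auto
    then show ?thesis using sets.compl_sets[OF null_setsD2[OF N]] by (simp only:)
  qed
  ultimately have "AE y in lborel. AE x in lborel. (x, y) \<notin> N"
    using lborel_pair.AE_commute[of "\<lambda>x y. (x, y) \<notin> N"] by simp
  then show ?thesis
  proof eventually_elim
    fix y assume "AE x in lborel. (x, y) \<notin> N"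
    then show "AE x in lborel. Q (x, y)"
      by eventually_elim (use Q in \<open>auto simp: space_pair_measure\<close>)
  qed
qed

text \<open>The factor \<open>\<theta> (x + t)\<close> is constant along characteristics: its
  derivatives cancel in the adjoint expression, and only \<open>\<eta>\<close> gets
  differentiated.\<close>

lemma test_function_product:
  assumes "smooth \<eta>" "\<And>t. t \<notin> {a..b} \<Longrightarrow> \<eta> t = 0" "0 < a" "smooth \<theta>" "periodic \<theta>"
  defines "\<psi> \<equiv> \<lambda>p. \<eta> (snd p) * \<theta> (fst p + snd p)"
  shows "test_function \<psi>"
    and "- frechet_derivative \<psi> (at p) (0, 1) + frechet_derivative \<psi> (at p) (1, 0)
      = - deriv \<eta> (snd p) * \<theta> (fst p + snd p)"
proof -
  have "smooth (\<lambda>p::real \<times> real. \<eta> (snd p))" "smooth (\<lambda>p::real \<times> real. \<theta> (fst p + snd p))"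
    using smooth_compose[OF assms(1) smooth_linear[OF bounded_linear_snd]]
      smooth_compose[OF assms(4) smooth_linear[OF bounded_linear_add[OF bounded_linear_fst bounded_linear_snd]]]
    by blast+
  then have "smooth \<psi>" unfolding \<psi>_def by (rule smooth_mult)
  moreover have "periodic (\<lambda>x. \<psi> (x, t))" for t
  proof -
    have "\<theta> (x + t + 2 * pi) = \<theta> (x + t)" for x
      using assms(5) by (simp add: periodic_def)
    then show ?thesis by (simp add: periodic_def \<psi>_def algebra_simps)
  qed
  ultimately show "test_function \<psi>"
    using assms(2,3) unfolding test_function_def by (fastforce simp: \<psi>_def)
  have \<eta>: "(\<eta> has_derivative (*) (deriv \<eta> x)) (at x)" for x
    using smooth_has_real_derivative(1)[OF assms(1)] by (simp add: has_field_derivative_def)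
  have \<theta>: "(\<theta> has_derivative (*) (deriv \<theta> x)) (at x)" for x
    using smooth_has_real_derivative(1)[OF assms(4)] by (simp add: has_field_derivative_def)
  have "((\<lambda>p. \<eta> (snd p)) has_derivative (\<lambda>v. deriv \<eta> (snd p) * snd v)) (at p)"
    by (rule has_derivative_compose[OF _ \<eta>]) (auto intro!: derivative_eq_intros)
  moreover have "((\<lambda>p. \<theta> (fst p + snd p)) has_derivative (\<lambda>v. deriv \<theta> (fst p + snd p) * (fst v + snd v))) (at p)"
    by (rule has_derivative_compose[OF _ \<theta>]) (auto intro!: derivative_eq_intros)
  ultimately have "(\<psi> has_derivative (\<lambda>v. \<eta> (snd p) * (deriv \<theta> (fst p + snd p) * (fst v + snd v))
      + deriv \<eta> (snd p) * snd v * \<theta> (fst p + snd p))) (at p)"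
    unfolding \<psi>_def by (rule has_derivative_mult)
  then have "frechet_derivative \<psi> (at p) = (\<lambda>v. \<eta> (snd p) * (deriv \<theta> (fst p + snd p) * (fst v + snd v))
      + deriv \<eta> (snd p) * snd v * \<theta> (fst p + snd p))"
    by (rule frechet_derivative_at[symmetric])
  then show "- frechet_derivative \<psi> (at p) (0, 1) + frechet_derivative \<psi> (at p) (1, 0)
      = - deriv \<eta> (snd p) * \<theta> (fst p + snd p)"
    by simp
qed

lemma deriv_eq_0_outside:
  fixes f :: "real \<Rightarrow> real"
  assumes "\<And>t. t \<notin> {a..b} \<Longrightarrow> f t = 0" "t \<notin> {a..b}"
  shows "deriv f t = 0"
proof -
  have "\<forall>\<^sub>F y in nhds t. y \<in> - {a..b}"
    using assms(2) by (intro eventually_nhds_in_open) auto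
  then have "\<forall>\<^sub>F y in nhds t. f y = 0" by eventually_elim (use assms(1) in auto)
  then have "(f has_real_derivative 0) (at t)"
    using DERIV_cong_ev[of t t f "\<lambda>_. 0" 0 0] by simp
  then show ?thesis by (rule DERIV_imp_deriv)
qed

text \<open>The derivative is a bump of mass 1 on \<open>[1, 2]\<close>; its dilates act as an
  approximate identity concentrated to the right of a given time.\<close>

lemma deriv_smooth_step:
  shows "x < 1 \<or> 2 < x \<Longrightarrow> deriv smooth_step x = 0"
    and "(LINT x|lborel. indicator {1..2} x * deriv smooth_step x) = 1"
proof -
  note D = smooth_has_real_derivative[OF smooth_smooth_step]
  show "deriv smooth_step x = 0" if "x < 1 \<or> 2 < x"
    using that
  proof
    assume "x < 1"
    then have "\<forall>\<^sub>F y in nhds x. smooth_step y = 0"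
      using eventually_nhds_in_open[of "{..<1}" x] by (auto elim!: eventually_mono intro: smooth_step_0)
    then have "(smooth_step has_real_derivative 0) (at x)"
      using DERIV_cong_ev[of x x smooth_step "\<lambda>_. 0" 0 0] by simp
    then show ?thesis by (rule DERIV_imp_deriv)
  next
    assume "2 < x"
    then have "\<forall>\<^sub>F y in nhds x. smooth_step y = 1"
      using eventually_nhds_in_open[of "{2<..}" x] by (auto elim!: eventually_mono intro: smooth_step_1)
    then have "(smooth_step has_real_derivative 0) (at x)"
      using DERIV_cong_ev[of x x smooth_step "\<lambda>_. 1" 0 0] by simp
    then show ?thesis by (rule DERIV_imp_deriv)
  qed
  have "isCont (deriv smooth_step) x" for x
    using D(2) by (simp add: continuous_on_eq_continuous_at)
  then show "(LINT x|lborel. indicator {1..2} x * deriv smooth_step x) = 1"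
    using integral_FTC_Icc_real[of 1 2 smooth_step "deriv smooth_step"] D(1)
    by (simp add: smooth_step_0 smooth_step_1 mult.commute)
qed

lemma integrable_bounded_times_continuous:
  fixes f \<theta> :: "real \<Rightarrow> real"
  assumes f: "f \<in> borel_measurable lebesgue" "\<And>x. \<bar>f x\<bar> \<le> B" and \<theta>: "continuous_on UNIV \<theta>"
  shows "integrable (lebesgue_on {a..b}) (\<lambda>x. f x * \<theta> x)"
proof -
  obtain C where C: "\<And>x. x \<in> {a..b} \<Longrightarrow> \<bar>\<theta> x\<bar> \<le> C"
    using continuous_bounded_on_cbox[OF continuous_on_subset[OF \<theta> subset_UNIV], of a b]
    unfolding cbox_interval by blast
  have "\<theta> \<in> borel_measurable lebesgue"
    using borel_measurable_continuous_onI[OF \<theta>] by (intro measurable_completion) simp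
  then have meas: "(\<lambda>x. f x * \<theta> x) \<in> borel_measurable (lebesgue_on {a..b})"
    using f(1) by (intro measurable_restrict_space1 borel_measurable_times)
  show ?thesis
  proof (rule integrableI_bounded_set[where A = "{a..b}" and B = "B * C"])
    show "AE x in lebesgue_on {a..b}. x \<in> {a..b} \<longrightarrow> norm (f x * \<theta> x) \<le> B * C"
    proof (intro AE_I2 impI)
      fix x assume "x \<in> {a..b}"
      then show "norm (f x * \<theta> x) \<le> B * C"
        unfolding real_norm_def abs_mult by (intro mult_mono f C) (auto intro: order_trans[OF abs_ge_zero f(2)])
    qed
  qed (use meas in \<open>auto simp: emeasure_restrict_space sets_restrict_space emeasure_lborel_Icc_eq\<close>)
qed

text \<open>Modelled on the difference between a bounded solution and a rolled profile with the same
  source and initial value; bounds are local in time because those of the profile are.\<close>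

locale homogeneous_wave =
  fixes d :: "real \<times> real \<Rightarrow> real"
  assumes measurable: "d \<in> borel_measurable (lebesgue_on (UNIV \<times> {0..}))"
    and measurable_section: "t \<ge> 0 \<Longrightarrow> (\<lambda>x. d (x, t)) \<in> borel_measurable lebesgue"
    and locally_bounded: "\<exists>B. \<forall>x. \<forall>t\<in>{0..T}. \<bar>d (x, t)\<bar> \<le> B"
    and homogeneous: "wave_equation d (\<lambda>_. 0)"
    and continuous: "continuous_into_distributions d"
    and initial: "AE x in lborel. x \<in> {0..2 * pi} \<longrightarrow> d (x, 0) = 0"
begin

text \<open>Moments along characteristics; a test function \<open>\<eta> t * \<theta> (x + t)\<close> in the equation shows that their
  derivative in \<open>t\<close> vanishes.\<close>

definition moment :: "(real \<Rightarrow> real) \<Rightarrow> real \<Rightarrow> real" where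
  "moment \<theta> t = (LINT x|lebesgue_on {0..2 * pi}. d (x, t) * \<theta> (x + t))"

lemma smooth_periodic_shift:
  assumes "smooth \<theta>" "periodic \<theta>"
  shows "smooth (\<lambda>x. \<theta> (x + c))" "periodic (\<lambda>x. \<theta> (x + c))"
proof -
  show "smooth (\<lambda>x. \<theta> (x + c))"
    using smooth_compose[OF assms(1) smooth_affine[of 1 c]] by simp
  have "\<theta> (x + c + 2 * pi) = \<theta> (x + c)" for x using assms(2) by (simp add: periodic_def)
  then show "periodic (\<lambda>x. \<theta> (x + c))" by (simp add: periodic_def algebra_simps)
qed

lemma integrable_section_mult:
  assumes "t \<ge> 0" "continuous_on UNIV \<theta>"
  shows "integrable (lebesgue_on {0..2 * pi}) (\<lambda>x. d (x, t) * \<theta> x)"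
proof -
  obtain B where "\<And>x s. s \<in> {0..t} \<Longrightarrow> \<bar>d (x, s)\<bar> \<le> B"
    using locally_bounded by blast
  then have "\<bar>d (x, t)\<bar> \<le> B" for x using assms(1) by simp
  then show ?thesis
    by (rule integrable_bounded_times_continuous[OF measurable_section[OF assms(1)] _ assms(2)])
qed

text \<open>Both the section and the test function move with time. With the test function frozen at
  \<open>\<theta> (x + t)\<close>, this is continuity into distributions; the error of freezing is
  small because \<open>d\<close> is locally bounded and \<open>\<theta>\<close> uniformly
  continuous.\<close>

lemma moment_tendsto:
  assumes \<theta>: "smooth \<theta>" "periodic \<theta>" and t: "t \<ge> 0"
  shows "(moment \<theta> \<longlongrightarrow> moment \<theta> t) (at t within {0..})"
proof -
  have cont: "continuous_on A (\<lambda>x. \<theta> (x + c))" for A c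
    using smooth_periodic_shift(1)[OF \<theta>] by (rule smooth_imp_continuous)
  obtain B where B: "\<And>x s. s \<in> {0..t + 1} \<Longrightarrow> \<bar>d (x, s)\<bar> \<le> B"
    using locally_bounded by blast
  have B0: "0 \<le> B" using B[of 0 0] t by (auto intro: order_trans[OF abs_ge_zero])
  let ?m = "\<lambda>s. LINT x|lebesgue_on {0..2 * pi}. d (x, s) * \<theta> (x + t)"
  have "(?m \<longlongrightarrow> ?m t) (at t within {0..})"
    using continuous smooth_periodic_shift[OF \<theta>] t
    unfolding continuous_into_distributions_def continuous_on_def by simp
  moreover have "((\<lambda>s. moment \<theta> s - ?m s) \<longlongrightarrow> 0) (at t within {0..})"
  proof (rule tendstoI)
    fix e :: real assume e: "e > 0"
    \<comment> \<open>Length of the period times a bound for \<open>d\<close>, with 1 added to keep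
      \<open>K\<close> positive; \<open>e' = e / (2 * K)\<close> then leaves a total error of
      \<open>e / 2\<close>.\<close>
    define K where "K = 2 * pi * (B + 1)"
    have "K > 0" using B0 by (simp add: K_def)
    define e' where "e' = e / (2 * K)"
    have "e' > 0" using e \<open>K > 0\<close> by (simp add: e'_def)
    have "uniformly_continuous_on {0..t + 1 + 2 * pi} \<theta>"
      using \<theta>(1) by (intro compact_uniformly_continuous smooth_imp_continuous) auto
    then obtain \<delta> where "\<delta> > 0" and \<delta>: "\<And>x y. x \<in> {0..t + 1 + 2 * pi} \<Longrightarrow> y \<in> {0..t + 1 + 2 * pi} \<Longrightarrow>
        dist y x < \<delta> \<Longrightarrow> dist (\<theta> y) (\<theta> x) < e'"
      using \<open>e' > 0\<close> unfolding uniformly_continuous_on_def by metis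
    have "\<forall>\<^sub>F s in at t within {0..}. s \<in> {0..} \<and> dist s t < min 1 \<delta>"
      using \<open>\<delta> > 0\<close> unfolding eventually_at by (intro exI[of _ "min 1 \<delta>"]) auto
    then show "\<forall>\<^sub>F s in at t within {0..}. dist (moment \<theta> s - ?m s) 0 < e"
    proof eventually_elim
      fix s assume s: "s \<in> {0..} \<and> dist s t < min 1 \<delta>"
      then have s': "s \<in> {0..t + 1}" by (auto simp: dist_real_def)
      have "moment \<theta> s - ?m s = (LINT x|lebesgue_on {0..2 * pi}. d (x, s) * \<theta> (x + s) - d (x, s) * \<theta> (x + t))"
        unfolding moment_def using s
        by (intro Bochner_Integration.integral_diff[symmetric] integrable_section_mult cont) auto
      also have "\<bar>\<dots>\<bar> \<le> (LINT x|lebesgue_on {0..2 * pi}. (B + 1) * e')"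
      proof (rule integral_abs_bound_integral)
        show "integrable (lebesgue_on {0..2 * pi}) (\<lambda>x. d (x, s) * \<theta> (x + s) - d (x, s) * \<theta> (x + t))"
          using s by (intro Bochner_Integration.integrable_diff integrable_section_mult cont) auto
        show "integrable (lebesgue_on {0..2 * pi}) (\<lambda>x. (B + 1) * e')"
          by (auto simp: integrable_restrict_space set_integrable_def emeasure_lborel_Icc_eq)
        fix x assume "x \<in> space (lebesgue_on {0..2 * pi})"
        then have x: "x \<in> {0..2 * pi}" by simp
        have "dist (\<theta> (x + s)) (\<theta> (x + t)) < e'"
          using x s s' t by (intro \<delta>) (auto simp: dist_real_def)
        then have "\<bar>d (x, s)\<bar> * \<bar>\<theta> (x + s) - \<theta> (x + t)\<bar> \<le> (B + 1) * e'"
          using B[OF s', of x] B0 by (intro mult_mono) (auto simp: dist_real_def)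
        then show "\<bar>d (x, s) * \<theta> (x + s) - d (x, s) * \<theta> (x + t)\<bar> \<le> (B + 1) * e'"
          by (simp add: right_diff_distrib[symmetric] abs_mult)
      qed
      also have "\<dots> = K * e'"
        by (subst integral_restrict_space) (auto simp: K_def)
      also have "\<dots> = e / 2"
        using \<open>K > 0\<close> by (simp add: e'_def)
      finally show "dist (moment \<theta> s - ?m s) 0 < e" using e by (simp add: moment_def)
    qed
  qed
  ultimately have "((\<lambda>s. (moment \<theta> s - ?m s) + ?m s) \<longlongrightarrow> 0 + ?m t) (at t within {0..})"
    by (intro tendsto_add)
  then show ?thesis by (simp add: moment_def[abs_def])
qed

text \<open>Clamping time at 0 extends the moment continuously to the whole line, so that integrals
  over \<open>lborel\<close> make sense; at negative times it will be multiplied by a derivative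
  \<open>deriv \<eta>\<close> that is 0 there.\<close>

lemma continuous_moment:
  assumes "smooth \<theta>" "periodic \<theta>"
  shows "continuous_on UNIV (\<lambda>t. moment \<theta> (max 0 t))"
proof -
  have "continuous_on {0..} (moment \<theta>)"
    using moment_tendsto[OF assms] by (simp add: continuous_on_def)
  then show ?thesis
    by (rule continuous_on_compose2) (auto intro!: continuous_intros)
qed

text \<open>The weak equation tested with \<open>\<eta> t * \<theta> (x + t)\<close> and integrated
  in \<open>x\<close> first.\<close>

lemma moment_deriv_weak:
  assumes \<theta>: "smooth \<theta>" "periodic \<theta>"
    and \<eta>: "smooth \<eta>" "\<And>t. t \<notin> {a..T} \<Longrightarrow> \<eta> t = 0" and a: "0 < a"
  shows "(LINT t|lborel. moment \<theta> (max 0 t) * deriv \<eta> t) = 0"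
proof -
  define k where "k p = - deriv \<eta> (snd p) * \<theta> (fst p + snd p)" for p
  have \<eta>0: "deriv \<eta> t = 0" if "t \<notin> {a..T}" for t
    using deriv_eq_0_outside[of a T \<eta>] \<eta>(2) that by blast
  have cont_\<theta>: "continuous_on UNIV \<theta>" using \<theta>(1) by (rule smooth_imp_continuous)
  have cont_\<eta>: "continuous_on UNIV (deriv \<eta>)" using smooth_has_real_derivative(2)[OF \<eta>(1)] .
  have [measurable]: "\<theta> \<in> borel_measurable borel" "deriv \<eta> \<in> borel_measurable borel"
    using cont_\<theta> cont_\<eta> by (auto intro: borel_measurable_continuous_onI)
  have cont_k: "continuous_on UNIV k"
    unfolding k_def
    by (intro continuous_intros continuous_on_compose2[OF cont_\<eta>] continuous_on_compose2[OF cont_\<theta>]) auto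
  have k_meas [measurable]: "k \<in> borel_measurable borel"
    by (rule borel_measurable_continuous_onI[OF cont_k])
  obtain C where C: "\<And>p. p \<in> cbox (0, a) (2 * pi, T) \<Longrightarrow> \<bar>k p\<bar> \<le> C"
    using continuous_bounded_on_cbox[OF continuous_on_subset[OF cont_k subset_UNIV]] by blast
  let ?S = "UNIV \<times> {0..T} :: (real \<times> real) set" and ?\<Omega> = "{0..2 * pi} \<times> {0<..} :: (real \<times> real) set"
  have \<Omega>: "?\<Omega> \<in> sets borel" by (intro borel_Times) auto
  have S: "?S \<in> sets lebesgue" "UNIV \<times> {0..} \<in> sets (lebesgue :: (real \<times> real) measure)"
    by (auto intro!: sets_completionI_sets borel_Times simp: space_borel[symmetric] simp del: space_borel)
  obtain B where "\<And>x s. s \<in> {0..T} \<Longrightarrow> \<bar>d (x, s)\<bar> \<le> B" using locally_bounded by blast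
  then have "\<bar>d p\<bar> \<le> max 0 B" if "p \<in> ?S" for p
    using that by (cases p) (auto intro: max.coboundedI2)
  then have AE_bound: "AE p in lborel. p \<in> ?S \<longrightarrow> \<bar>d p\<bar> \<le> max 0 B" by simp
  have "d \<in> borel_measurable (lebesgue_on ?S)"
    by (rule measurable_restrict_mono[OF measurable]) auto
  \<comment> \<open>The representative is taken on the strip up to time \<open>T\<close>, where
    \<open>d\<close> is bounded and outside of which \<open>\<eta>\<close> gives nothing for later
    times. Its sections agree with those of \<open>d\<close> for almost every \<open>t\<close>,
    enough for the outer integral.\<close>
  from borel_representative[OF S(1) this AE_bound] obtain d' where
    [measurable]: "d' \<in> borel_measurable borel" and d'_bound: "\<And>p. \<bar>d' p\<bar> \<le> max 0 B"
    and d': "AE p in lborel. p \<in> ?S \<longrightarrow> d p = d' p" by auto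
  define F where "F p = indicator ?\<Omega> p * (d' p * k p)" for p
  have F_meas: "F \<in> borel_measurable borel"
    unfolding F_def by (intro borel_measurable_times borel_measurable_indicator \<Omega>) auto
  have F0: "F (x, t) = 0" if "\<not> (x \<in> {0..2 * pi} \<and> t \<in> {a..T})" for x t
    using that \<eta>0[of t] by (auto simp: F_def k_def)
  have intF: "integrable lborel F"
  proof (rule integrable_bounded_on_box[OF F_meas, of 0 "2 * pi" a T "max 0 B * C"])
    fix x t assume xt: "x \<in> {0..2 * pi}" "t \<in> {a..T}"
    have "\<bar>d' (x, t)\<bar> * \<bar>k (x, t)\<bar> \<le> max 0 B * C"
      using xt by (intro mult_mono d'_bound C) auto
    then show "\<bar>F (x, t)\<bar> \<le> max 0 B * C" using xt a by (simp add: F_def abs_mult)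
  qed (rule F0)
  note product = test_function_product[of \<eta> a T \<theta>, OF \<eta>(1) _ a \<theta>, OF \<eta>(2)]
  have "0 = (LINT p|lebesgue_on ?\<Omega>. d p * k p)"
  proof -
    have "k p = - frechet_derivative (\<lambda>p. \<eta> (snd p) * \<theta> (fst p + snd p)) (at p) (0, 1)
        + frechet_derivative (\<lambda>p. \<eta> (snd p) * \<theta> (fst p + snd p)) (at p) (1, 0)" for p
      unfolding k_def by (rule product(2)[symmetric])
    then show ?thesis
      using homogeneous[unfolded wave_equation_def, rule_format, OF product(1)] by simp
  qed
  also have "\<dots> = integral\<^sup>L lborel F"
    unfolding F_def
  proof (rule integral_lebesgue_on_cong_borel[OF \<Omega>])
    show "AE p in lborel. p \<in> ?\<Omega> \<longrightarrow> d p * k p = d' p * k p"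
      using d'
    proof eventually_elim
      fix p assume *: "p \<in> ?S \<longrightarrow> d p = d' p"
      show "p \<in> ?\<Omega> \<longrightarrow> d p * k p = d' p * k p"
        using * \<eta>0[of "snd p"] by (cases "snd p \<le> T") (auto simp: k_def)
    qed
  qed auto
  also have "\<dots> = (LINT t|lborel. LINT x|lborel. F (x, t))"
    by (rule integral_lborel_pair(2)[OF intF])
  also have "\<dots> = (LINT t|lborel. - (moment \<theta> (max 0 t) * deriv \<eta> t))"
  proof (rule integral_cong_AE)
    have "integrable (lborel \<Otimes>\<^sub>M lborel) (\<lambda>(x, t). F (x, t))"
      using intF by (simp add: lborel_prod)
    then show "(\<lambda>t. LINT x|lborel. F (x, t)) \<in> borel_measurable lborel"
      using lborel_pair.integrable_snd by blast
    show "(\<lambda>t. - (moment \<theta> (max 0 t) * deriv \<eta> t)) \<in> borel_measurable lborel"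
      using borel_measurable_continuous_onI[OF continuous_moment[OF \<theta>]] by simp
    show "AE t in lborel. (LINT x|lborel. F (x, t)) = - (moment \<theta> (max 0 t) * deriv \<eta> t)"
      using AE_lborel_sections[OF d']
    proof eventually_elim
      fix t assume AE: "AE x in lborel. (x, t) \<in> ?S \<longrightarrow> d (x, t) = d' (x, t)"
      show "(LINT x|lborel. F (x, t)) = - (moment \<theta> (max 0 t) * deriv \<eta> t)"
      proof (cases "t \<in> {a..T}")
        case True
        have [measurable]: "(\<lambda>x. d' (x, t)) \<in> borel_measurable borel"
          by (rule measurable_compose[of "\<lambda>x. (x, t)" borel borel])
            (auto intro!: borel_measurable_continuous_onI continuous_intros)
        have "moment \<theta> t = (LINT x|lborel. indicator {0..2 * pi} x * (d' (x, t) * \<theta> (x + t)))"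
          unfolding moment_def
        proof (rule integral_lebesgue_on_cong_borel)
          show "AE x in lborel. x \<in> {0..2 * pi} \<longrightarrow> d (x, t) * \<theta> (x + t) = d' (x, t) * \<theta> (x + t)"
            using AE by eventually_elim (use True a in auto)
        qed auto
        moreover have "(LINT x|lborel. F (x, t))
            = (LINT x|lborel. - deriv \<eta> t * (indicator {0..2 * pi} x * (d' (x, t) * \<theta> (x + t))))"
          using True a by (intro Bochner_Integration.integral_cong) (auto simp: F_def k_def indicator_def)
        ultimately show ?thesis using True a by simp
      next
        case False
        then have "F (x, t) = 0" for x using F0 by blast
        then show ?thesis using False \<eta>0 by simp
      qed
    qed
  qed
  finally show ?thesis by simp
qed

text \<open>The test function \<open>\<eta>\<close> is a plateau rising just after 0 and falling
  just after \<open>b\<close>. Its derivative is a difference of two bumps of mass 1, so weighted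
  averages of the moment just after 0 and just after \<open>b\<close> agree. As the bumps shrink,
  continuity yields the two values, including the one at 0, where no test function lives.\<close>

lemma moment_constant:
  assumes \<theta>: "smooth \<theta>" "periodic \<theta>" and b: "b > 0"
  shows "moment \<theta> b = moment \<theta> 0"
proof -
  let ?M = "\<lambda>t. moment \<theta> (max 0 t)" and ?s = "deriv smooth_step"
  note cont = continuous_moment[OF \<theta>]
  have [measurable]: "?M \<in> borel_measurable borel" "?s \<in> borel_measurable borel"
    using cont smooth_has_real_derivative(2)[OF smooth_smooth_step]
    by (auto intro: borel_measurable_continuous_onI)
  have s0: "?s x = 0" if "x \<notin> {1..2}" for x
    using that deriv_smooth_step(1)[of x] by auto
  obtain K where K: "\<And>t. t \<in> {0..b + 2} \<Longrightarrow> \<bar>?M t\<bar> \<le> K"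
    using continuous_bounded_on_cbox[OF continuous_on_subset[OF cont subset_UNIV], of 0 "b + 2"]
    unfolding cbox_interval by blast
  obtain L where L: "\<And>x. x \<in> {1..2} \<Longrightarrow> \<bar>?s x\<bar> \<le> L"
    using continuous_bounded_on_cbox[OF continuous_on_subset[OF smooth_has_real_derivative(2)[OF smooth_smooth_step] subset_UNIV], of 1 2]
    unfolding cbox_interval by blast
  have arg: "c + x / real (Suc n) \<in> {0..b + 2}" if "c \<in> {0..b}" "x \<in> {1..2}" for c x n
  proof -
    have "x / real (Suc n) \<le> x" "0 \<le> x / real (Suc n)"
      using that by (auto simp: divide_le_eq mult_le_cancel_left1)
    then show ?thesis using that by auto
  qed
  have bound: "\<bar>?M (c + x / real (Suc n)) * ?s x\<bar> \<le> K * L" if "c \<in> {0..b}" "x \<in> {1..2}" for c x n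
    unfolding abs_mult using K[OF arg[OF that]] L[OF that(2)]
    by (intro mult_mono) (auto intro: order_trans[OF abs_ge_zero])
  have int: "integrable lborel (\<lambda>x. ?M (c + x / real (Suc n)) * ?s x)" if "c \<in> {0..b}" for c n
    by (rule integrable_bounded_on_interval[of _ 1 2 "K * L"]) (use bound[OF that] s0 in auto)
  have eq: "(LINT x|lborel. ?M (0 + x / real (Suc n)) * ?s x) = (LINT x|lborel. ?M (b + x / real (Suc n)) * ?s x)" for n
  proof -
    define m where "m = real (Suc n)"
    have m: "m > 0" by (simp add: m_def)
    \<comment> \<open>The support starts at \<open>1 / m > 0\<close> because
      \<open>smooth_step\<close> rises only beyond 1. The terms \<open>+ 0\<close> and
      \<open>-1 *\<close> fit the smoothness rules for affine maps and sums.\<close>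
    define \<eta> where "\<eta> t = smooth_step (m * t + 0) + -1 * smooth_step (m * t + - (m * b))" for t
    have smooth: "smooth \<eta>"
      unfolding \<eta>_def
      by (intro smooth_add smooth_mult smooth_const smooth_compose[OF smooth_smooth_step smooth_affine])
    have supp: "\<eta> t = 0" if "t \<notin> {1 / m..b + 2 / m}" for t
    proof (cases "t < 1 / m")
      case True
      then have "m * t \<le> 1" using m by (simp add: field_simps)
      moreover have "m * t + - (m * b) \<le> 1" using \<open>m * t \<le> 1\<close> m b by (smt (verit) mult_pos_pos)
      ultimately show ?thesis by (simp add: \<eta>_def smooth_step_0)
    next
      case False
      then have "t > b + 2 / m" using that by auto
      then have "m * t + - (m * b) \<ge> 2" using m by (simp add: field_simps)
      moreover have "m * t \<ge> 2" using \<open>m * t + - (m * b) \<ge> 2\<close> m b by (smt (verit) mult_pos_pos)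
      ultimately show ?thesis by (simp add: \<eta>_def smooth_step_1)
    qed
    have 0: "(LINT t|lborel. ?M t * deriv \<eta> t) = 0"
    proof (rule moment_deriv_weak[OF \<theta> smooth, of "1 / m" "b + 2 / m"])
      show "0 < 1 / m" using m by simp
    qed (rule supp)
    have "(\<eta> has_real_derivative m * ?s (m * t) - m * ?s (m * t - m * b)) (at t)" for t
      unfolding \<eta>_def
      by (auto intro!: derivative_eq_intros DERIV_chain2[OF smooth_has_real_derivative(1)[OF smooth_smooth_step]])
    then have deriv: "deriv \<eta> t = m * ?s (m * t) - m * ?s (m * t - m * b)" for t
      by (rule DERIV_imp_deriv)
    \<comment> \<open>Substitution \<open>t = c + x / m\<close>, for \<open>c = 0\<close> and
      \<open>c = b\<close>: the factor \<open>m\<close> cancels, and the bump no longer depends on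
      \<open>m\<close>.\<close>
    have shift: "(LINT t|lborel. ?M t * (m * ?s (m * t - m * c))) = (LINT x|lborel. ?M (c + x / m) * ?s x)"
      and int': "integrable lborel (\<lambda>t. ?M t * (m * ?s (m * t - m * c)))" if "c \<in> {0..b}" for c
    proof -
      have "(LINT t|lborel. ?M t * (m * ?s (m * t - m * c)))
          = (1 / m) * (LINT x|lborel. ?M (c + 1 / m * x) * (m * ?s (m * (c + 1 / m * x) - m * c)))"
        using lborel_integral_real_affine[of "1 / m" "\<lambda>t. ?M t * (m * ?s (m * t - m * c))" c] m by simp
      also have "\<dots> = (1 / m) * (LINT x|lborel. m * (?M (c + x / m) * ?s x))"
        using m by (simp add: field_simps)
      finally show "(LINT t|lborel. ?M t * (m * ?s (m * t - m * c))) = (LINT x|lborel. ?M (c + x / m) * ?s x)"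
        using m by simp
      have "integrable lborel (\<lambda>t. ?M (c + (- m * c + m * t) / m) * ?s (- m * c + m * t))"
        using lborel_integrable_real_affine[OF int[OF that, of n], of m "- m * c"] m by (simp add: m_def)
      then have "integrable lborel (\<lambda>t. m * (?M (c + (- m * c + m * t) / m) * ?s (- m * c + m * t)))"
        by simp
      moreover have "c + (- m * c + m * t) / m = t" for t using m by (simp add: field_simps)
      ultimately show "integrable lborel (\<lambda>t. ?M t * (m * ?s (m * t - m * c)))"
        by (simp add: algebra_simps)
    qed
    have "0 = (LINT t|lborel. ?M t * (m * ?s (m * t - m * 0)) - ?M t * (m * ?s (m * t - m * b)))"
      using 0 by (simp add: deriv right_diff_distrib)
    also have "\<dots> = (LINT t|lborel. ?M t * (m * ?s (m * t - m * 0))) - (LINT t|lborel. ?M t * (m * ?s (m * t - m * b)))"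
      using b by (intro Bochner_Integration.integral_diff int') auto
    also have "\<dots> = (LINT x|lborel. ?M (0 + x / m) * ?s x) - (LINT x|lborel. ?M (b + x / m) * ?s x)"
      using b by (subst (1 2) shift) auto
    finally show ?thesis by (simp add: m_def)
  qed
  have lim: "(\<lambda>n. LINT x|lborel. ?M (c + x / real (Suc n)) * ?s x) \<longlonglongrightarrow> ?M c" if c: "c \<in> {0..b}" for c
  proof -
    have "(\<lambda>n. LINT x|lborel. ?M (c + x / real (Suc n)) * ?s x) \<longlonglongrightarrow> (LINT x|lborel. ?M c * (indicator {1..2} x * ?s x))"
    proof (rule integral_dominated_convergence[where w = "\<lambda>x::real. indicator {1..2} x * (K * L)"])
      show "integrable lborel (\<lambda>x::real. indicator {1..2} x * (K * L))"
        by (rule integrable_bounded_on_interval[of _ 1 2 "\<bar>K * L\<bar>"]) auto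
      show "AE x in lborel. norm (?M (c + x / real (Suc n)) * ?s x) \<le> indicator {1..2} x * (K * L)" for n
      proof (rule AE_I2)
        fix x show "norm (?M (c + x / real (Suc n)) * ?s x) \<le> indicator {1..2} x * (K * L)"
          using bound[OF c, of x n] s0[of x] by (cases "x \<in> {1..2}") auto
      qed
      show "AE x in lborel. (\<lambda>n. ?M (c + x / real (Suc n)) * ?s x) \<longlonglongrightarrow> ?M c * (indicator {1..2} x * ?s x)"
      proof (rule AE_I2)
        fix x
        have "(\<lambda>n. x / real (Suc n)) \<longlonglongrightarrow> 0" by real_asymp
        then have "(\<lambda>n. c + x / real (Suc n)) \<longlonglongrightarrow> c + 0" by (intro tendsto_intros)
        moreover have "isCont ?M (c + 0)" using cont by (simp add: continuous_on_eq_continuous_at)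
        ultimately have "(\<lambda>n. ?M (c + x / real (Suc n))) \<longlonglongrightarrow> ?M (c + 0)"
          by (rule isCont_tendsto_compose[rotated])
        then have "(\<lambda>n. ?M (c + x / real (Suc n)) * ?s x) \<longlonglongrightarrow> ?M c * ?s x" by (intro tendsto_intros) simp
        also have "?M c * ?s x = ?M c * (indicator {1..2} x * ?s x)"
          using s0[of x] by (cases "x \<in> {1..2}") auto
        finally show "(\<lambda>n. ?M (c + x / real (Suc n)) * ?s x) \<longlonglongrightarrow> ?M c * (indicator {1..2} x * ?s x)" .
      qed
    qed auto
    then show ?thesis using deriv_smooth_step(2) by simp
  qed
  have "0 \<in> {0..b}" "b \<in> {0..b}" using b by auto
  then have "?M 0 = ?M b"
    using LIMSEQ_unique[OF lim[of 0, unfolded eq] lim[of b]] by blast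
  then show ?thesis using b by simp
qed

lemma moment_0:
  assumes "smooth \<theta>"
  shows "moment \<theta> 0 = 0"
proof -
  have "moment \<theta> 0 = (LINT x|lborel. indicator {0..2 * pi} x * 0)"
    unfolding moment_def
  proof (rule integral_lebesgue_on_cong_borel)
    show "AE x in lborel. x \<in> {0..2 * pi} \<longrightarrow> d (x, 0) * \<theta> (x + 0) = 0"
      using initial by eventually_elim simp
  qed auto
  then show ?thesis by simp
qed

text \<open>With \<open>\<theta>\<close> shifted by \<open>- t\<close>, the moment at time
  \<open>t\<close> is the pairing of the section with \<open>\<theta>\<close> itself. Constancy in
  time and the vanishing at time 0 annihilate all these pairings.\<close>

lemma section_eq_0:
  assumes "t \<ge> 0"
  shows "AE x in lborel. x \<in> {0..2 * pi} \<longrightarrow> d (x, t) = 0"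
proof -
  obtain B where "\<And>x s. s \<in> {0..t} \<Longrightarrow> \<bar>d (x, s)\<bar> \<le> B" using locally_bounded by blast
  then have B: "\<bar>d (x, t)\<bar> \<le> B" for x using assms by simp
  have "0 \<le> B" using B by (rule order_trans[OF abs_ge_zero])
  have meas: "(\<lambda>x. d (x, t)) \<in> borel_measurable (lebesgue_on UNIV)"
    using measurable_section[OF assms] by (simp add: lebesgue_on_UNIV_eq)
  obtain f where f: "f \<in> borel_measurable borel" "\<And>x. \<bar>f x\<bar> \<le> B" "AE x in lborel. d (x, t) = f x"
    using borel_representative[OF _ meas _ \<open>0 \<le> B\<close>] B by auto
  have "AE x in lborel. x \<in> {0..2 * pi} \<longrightarrow> f x = 0"
  proof (rule AE_eq_0_if_smooth_periodic_integrals_eq_0[OF f(1,2)])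
    fix \<theta> assume \<theta>: "smooth \<theta>" "periodic \<theta>"
    note shift = smooth_periodic_shift[OF \<theta>, of "- t"]
    have cont: "continuous_on UNIV \<theta>" using \<theta>(1) by (rule smooth_imp_continuous)
    have "(LINT x|lborel. indicator {0..2 * pi} x * (f x * \<theta> x)) = (LINT x|lebesgue_on {0..2 * pi}. d (x, t) * \<theta> x)"
    proof (rule integral_lebesgue_on_cong_borel[symmetric])
      show "(\<lambda>x. f x * \<theta> x) \<in> borel_measurable borel"
        by (intro borel_measurable_times f borel_measurable_continuous_onI cont)
      show "AE x in lborel. x \<in> {0..2 * pi} \<longrightarrow> d (x, t) * \<theta> x = f x * \<theta> x"
        using f(3) by eventually_elim simp
    qed auto
    also have "\<dots> = moment (\<lambda>x. \<theta> (x + - t)) t" by (simp add: moment_def)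
    also have "\<dots> = 0"
      using moment_constant[OF shift, of t] moment_0[OF shift(1)] assms by (cases "t = 0") auto
    finally show "(LINT x|lborel. indicator {0..2 * pi} x * (f x * \<theta> x)) = 0" .
  qed
  with f(3) show ?thesis by eventually_elim simp
qed

end

subsection \<open>The delay equation\<close>

definition past :: "(real \<Rightarrow> real) \<Rightarrow> real \<Rightarrow> real" where
  "past v t = (\<Sum>k | k \<noteq> (0::int) \<and> 2 * of_int k * pi \<in> {-t..0}. v (t + 2 * of_int k * pi))"

text \<open>An integer interval opens the sum to reindexing, counting and measurability; it is empty
  for \<open>t < 2 * pi\<close>.\<close>

lemma past_eq: "past v t = (\<Sum>k\<in>{- \<lfloor>t / (2 * pi)\<rfloor>..-1}. v (t + 2 * of_int k * pi))"
proof -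
  have "k \<noteq> 0 \<and> 2 * of_int k * pi \<in> {-t..0} \<longleftrightarrow> k \<in> {- \<lfloor>t / (2 * pi)\<rfloor>..-1}" for k :: int
  proof -
    have "2 * of_int k * pi \<le> 0 \<longleftrightarrow> k \<le> 0"
      by (auto simp: mult_le_0_iff) (use pi_gt_zero in linarith)
    moreover have "- t \<le> 2 * of_int k * pi \<longleftrightarrow> of_int (- k) \<le> t / (2 * pi)"
      by (simp add: field_simps) (auto simp: algebra_simps)
    moreover have "of_int (- k) \<le> t / (2 * pi) \<longleftrightarrow> - \<lfloor>t / (2 * pi)\<rfloor> \<le> k"
      unfolding le_floor_iff[symmetric] by linarith
    ultimately show ?thesis by auto
  qed
  then show ?thesis unfolding past_def by (simp only: Collect_mem_eq)
qed

lemma past_eq_0: "t < 2 * pi \<Longrightarrow> past v t = 0"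
proof -
  assume "t < 2 * pi"
  then have "\<lfloor>t / (2 * pi)\<rfloor> < 1" by (simp add: floor_less_iff)
  then show ?thesis by (simp add: past_eq)
qed

text \<open>Source of the recursion \<open>r (s + 2 * pi) = r s - u s\<close> for
  \<open>r = G - past u\<close>: moving the index by one leaves \<open>v t\<close> as the only new
  term.\<close>

lemma past_add_2pi:
  assumes "0 \<le> t"
  shows "past v (t + 2 * pi) = v t + past v t"
proof -
  define n where "n = \<lfloor>t / (2 * pi)\<rfloor>"
  have n: "0 \<le> n" "\<lfloor>(t + 2 * pi) / (2 * pi)\<rfloor> = n + 1"
    using assms by (simp_all add: n_def add_divide_distrib)
  have "past v (t + 2 * pi) = (\<Sum>k\<in>(\<lambda>k. k - 1) ` {- n..0}. v (t + 2 * pi + 2 * of_int k * pi))"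
    unfolding past_eq n(2) by (rule sum.cong) (auto simp: image_diff_atLeastAtMost)
  also have "\<dots> = (\<Sum>k\<in>{- n..0}. v (t + 2 * of_int k * pi))"
    by (subst sum.reindex) (auto simp: inj_on_def algebra_simps)
  also have "{- n..0} = insert 0 {- n..-1}" using n(1) by auto
  also have "(\<Sum>k\<in>insert 0 {- n..-1}. v (t + 2 * of_int k * pi)) = v t + past v t"
    by (simp add: past_eq n_def)
  finally show ?thesis .
qed

text \<open>Only earlier nonnegative times on the orbit enter the sum; nothing is known about
  \<open>v\<close> at negative times.\<close>

lemma past_cong:
  assumes "\<And>k::int. k < 0 \<Longrightarrow> 0 \<le> t + 2 * of_int k * pi \<Longrightarrow> v (t + 2 * of_int k * pi) = w (t + 2 * of_int k * pi)"
  shows "past v t = past w t"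
  unfolding past_def
proof (rule sum.cong[OF refl])
  fix k :: int assume "k \<in> {k. k \<noteq> 0 \<and> 2 * of_int k * pi \<in> {-t..0}}"
  then have "k < 0" "0 \<le> t + 2 * of_int k * pi" using pi_gt_zero by (auto simp: mult_le_0_iff)
  then show "v (t + 2 * of_int k * pi) = w (t + 2 * of_int k * pi)" by (rule assms)
qed

lemma measurable_past:
  assumes [measurable]: "v \<in> borel_measurable borel"
  shows "past v \<in> borel_measurable borel"
proof -
  have floor: "(\<lambda>t::real. \<lfloor>t / (2 * pi)\<rfloor>) \<in> borel \<rightarrow>\<^sub>M count_space UNIV" by measurable
  \<comment> \<open>For a fixed number of terms the sum is measurable, and that number is a
    measurable function of \<open>t\<close> with countably many values.\<close>
  have "(\<lambda>t. (\<lambda>n t. \<Sum>k\<in>{- n..-1}. v (t + 2 * of_int k * pi)) \<lfloor>t / (2 * pi)\<rfloor> t) \<in> borel_measurable borel"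
    by (rule measurable_compose_countable[OF _ floor]) measurable
  then show ?thesis by (simp add: past_eq[abs_def])
qed

lemma past_bound:
  assumes "\<And>t. \<bar>v t\<bar> \<le> 1" "t \<le> T"
  shows "\<bar>past v t\<bar> \<le> real (nat \<lfloor>T / (2 * pi)\<rfloor>)"
proof -
  have "\<bar>past v t\<bar> \<le> (\<Sum>k\<in>{- \<lfloor>t / (2 * pi)\<rfloor>..-1}. \<bar>v (t + 2 * of_int k * pi)\<bar>)"
    unfolding past_eq by (rule sum_abs)
  also have "\<dots> \<le> (\<Sum>k\<in>{- \<lfloor>t / (2 * pi)\<rfloor>..-1}. 1)"
    by (intro sum_mono assms)
  also have "\<dots> = real (nat \<lfloor>t / (2 * pi)\<rfloor>)" by simp
  also have "\<dots> \<le> real (nat \<lfloor>T / (2 * pi)\<rfloor>)"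
    using assms(2) by (intro of_nat_mono nat_mono floor_mono divide_right_mono) auto
  finally show ?thesis .
qed

text \<open>The resolvent of the multivalued sign: \<open>\<phi> + v/2 = R\<close> with \<open>v \<in> sign \<phi>\<close> holds
  exactly for \<open>v = clip R\<close>, \<open>\<phi> = R - v/2\<close>.\<close>

definition clip :: "real \<Rightarrow> real" where
  "clip R = max (-1) (min 1 (2 * R))"

lemma clip_unique: "v \<in> msign \<phi> \<Longrightarrow> v = clip (\<phi> + v / 2)"
  by (auto simp: msign_def clip_def split: if_splits)

lemma clip_in_msign: "clip R \<in> msign (R - clip R / 2)"
  by (auto simp: msign_def clip_def max_def min_def split: if_splits)

section \<open>Almost every orbit of the translation by 2 pi, and uniqueness for the delay
  equation\<close>

lemma periodic_int:
  fixes f :: "real \<Rightarrow> 'a"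
  assumes "\<And>x. f (x + 2 * pi) = f x"
  shows "f (x + 2 * of_int k * pi) = f x"
proof (induction k rule: int_induct[of _ 0])
  case (step1 i)
  then show ?case using assms[of "x + 2 * of_int i * pi"] by (simp add: algebra_simps)
next
  case (step2 i)
  then show ?case using assms[of "x + 2 * of_int (i - 1) * pi"] by (simp add: algebra_simps)
qed simp

text \<open>Countably many translates of a null set form a null set. Outside it the property is
  available at all points of the orbit at once, so induction along an orbit becomes
  pointwise.\<close>

lemma AE_lborel_translates:
  assumes "AE x in lborel. P x"
  shows "AE x in lborel. \<forall>k::int. P (x + 2 * of_int k * pi)"
  unfolding AE_all_countable using AE_lborel_translate[OF assms] by blast

lemma AE_periodic:
  assumes "AE x in lborel. x \<in> {0..2 * pi} \<longrightarrow> P x" "\<And>x. P (x + 2 * pi) = P x"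
  shows "AE x in lborel. P x"
  using AE_lborel_translates[OF assms(1)]
proof eventually_elim
  fix x assume *: "\<forall>k::int. x + 2 * of_int k * pi \<in> {0..2 * pi} \<longrightarrow> P (x + 2 * of_int k * pi)"
  define n where "n = \<lfloor>x / (2 * pi)\<rfloor>"
  have "of_int n \<le> x / (2 * pi)" "x / (2 * pi) < of_int n + 1"
    unfolding n_def by linarith+
  then have "x + 2 * of_int (- n) * pi \<in> {0..2 * pi}"
    by (simp add: field_simps)
  then show "P x" using * periodic_int[of P x "- n", OF assms(2)] by blast
qed

lemma delay_solution_AE:
  assumes "delay_solution G \<phi> v"
  shows "AE t in lborel. 0 \<le> t \<longrightarrow> v t = clip (G t - past v t) \<and> \<phi> t = G t - past v t - v t / 2"
proof -
  have "AE t in lborel. 0 \<le> t \<longrightarrow> \<phi> t + 1 / 2 * v t + past v t = G t"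
    "AE t in lborel. 0 \<le> t \<longrightarrow> v t \<in> msign (\<phi> t)"
    using assms unfolding delay_solution_def past_def[symmetric] by (simp_all add: AE_lebesgue_on_iff)
  then show ?thesis
  proof eventually_elim
    fix t assume *: "0 \<le> t \<longrightarrow> \<phi> t + 1 / 2 * v t + past v t = G t" "0 \<le> t \<longrightarrow> v t \<in> msign (\<phi> t)"
    show "0 \<le> t \<longrightarrow> v t = clip (G t - past v t) \<and> \<phi> t = G t - past v t - v t / 2"
    proof
      assume "0 \<le> t"
      then have "\<phi> t + v t / 2 = G t - past v t" using * by simp
      then show "v t = clip (G t - past v t) \<and> \<phi> t = G t - past v t - v t / 2"
        using clip_unique[of "v t" "\<phi> t"] * \<open>0 \<le> t\<close> by simp
    qed
  qed
qed

text \<open>On an orbit where both equations hold at every nonnegative time, \<open>v\<close> and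
  \<open>\<phi>\<close> are determined by \<open>G\<close> and the past. Before
  \<open>2 * pi\<close> the past is empty, and each further period is fixed by the earlier
  ones.\<close>

lemma delay_solution_unique:
  assumes "delay_solution G \<phi> v" "delay_solution G \<phi>' v'"
  shows "AE t in lborel. 0 \<le> t \<longrightarrow> v' t = v t \<and> \<phi>' t = \<phi> t"
  using AE_lborel_translates[OF delay_solution_AE[OF assms(1)]] AE_lborel_translates[OF delay_solution_AE[OF assms(2)]]
proof eventually_elim
  fix t
  assume eq: "\<forall>k::int. 0 \<le> t + 2 * of_int k * pi \<longrightarrow>
      v (t + 2 * of_int k * pi) = clip (G (t + 2 * of_int k * pi) - past v (t + 2 * of_int k * pi)) \<and>
      \<phi> (t + 2 * of_int k * pi) = G (t + 2 * of_int k * pi) - past v (t + 2 * of_int k * pi) - v (t + 2 * of_int k * pi) / 2"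
    and eq': "\<forall>k::int. 0 \<le> t + 2 * of_int k * pi \<longrightarrow>
      v' (t + 2 * of_int k * pi) = clip (G (t + 2 * of_int k * pi) - past v' (t + 2 * of_int k * pi)) \<and>
      \<phi>' (t + 2 * of_int k * pi) = G (t + 2 * of_int k * pi) - past v' (t + 2 * of_int k * pi) - v' (t + 2 * of_int k * pi) / 2"
  have past: "past v' (t + 2 * of_int k * pi) = past v (t + 2 * of_int k * pi)"
    if "t + 2 * of_int k * pi < 2 * pi * (real n + 1)" for n and k :: int
    using that
  proof (induction n arbitrary: k)
    case 0
    then show ?case by (simp add: past_eq_0)
  next
    case (Suc n)
    show ?case
    proof (rule past_cong)
      fix j :: int
      assume j: "j < 0" "0 \<le> t + 2 * of_int k * pi + 2 * of_int j * pi"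
      have shift: "t + 2 * of_int k * pi + 2 * of_int j * pi = t + 2 * of_int (k + j) * pi"
        by (simp add: algebra_simps)
      \<comment> \<open>As \<open>j \<le> -1\<close>, the argument drops by at least one full
        period, into the range of the induction hypothesis.\<close>
      have "of_int j * pi \<le> - 1 * pi" using j(1) by (intro mult_right_mono) auto
      then have "t + 2 * of_int (k + j) * pi < 2 * pi * (real n + 1)"
        using Suc.prems by (simp add: algebra_simps)
      from Suc.IH[OF this] show "v' (t + 2 * of_int k * pi + 2 * of_int j * pi) = v (t + 2 * of_int k * pi + 2 * of_int j * pi)"
        using eq eq' j(2) unfolding shift by metis
    qed
  qed
  obtain n where "t / (2 * pi) < real n" using reals_Archimedean2 by blast
  then have "t + 2 * of_int 0 * pi < 2 * pi * (real n + 1)" by (simp add: field_simps) (smt (verit) pi_gt_zero)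
  from past[OF this] show "0 \<le> t \<longrightarrow> v' t = v t \<and> \<phi>' t = \<phi> t"
    using spec[OF eq, of 0] spec[OF eq', of 0] by simp
qed

subsection \<open>Borel profiles\<close>

text \<open>A Borel representative need not be periodic; repeating its values on
  \<open>[0, 2 * pi)\<close>, which is \<open>rolled f (x, 0)\<close>, makes it so. Equality with
  \<open>G\<close> survives wherever the whole orbit avoids the exceptional null set.\<close>

lemma periodic_borel_representative:
  assumes G: "periodic G" "G \<in> borel_measurable lebesgue" and B: "\<And>x. \<bar>G x\<bar> \<le> B"
  obtains G' where "G' \<in> borel_measurable borel" "\<And>x. \<bar>G' x\<bar> \<le> B" "\<And>x. G' (x + 2 * pi) = G' x"
    "AE x in lborel. G x = G' x"
proof -
  have "0 \<le> B" using B by (rule order_trans[OF abs_ge_zero])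
  have meas: "G \<in> borel_measurable (lebesgue_on UNIV)" using G(2) by (simp add: lebesgue_on_UNIV_eq)
  obtain f where f: "f \<in> borel_measurable borel" "\<And>x. \<bar>f x\<bar> \<le> B" "AE x in lborel. G x = f x"
    using borel_representative[OF _ meas _ \<open>0 \<le> B\<close>] B by auto
  have [measurable]: "f \<in> borel_measurable borel" by fact
  show ?thesis
  proof (rule that[of "\<lambda>x. rolled f (x, 0)"])
    show "(\<lambda>x. rolled f (x, 0)) \<in> borel_measurable borel"
      unfolding rolled_def fst_conv snd_conv by measurable
    show "\<bar>rolled f (x, 0)\<bar> \<le> B" for x unfolding rolled_def by (rule f(2))
    show "rolled f (x + 2 * pi, 0) = rolled f (x, 0)" for x
      using periodic_rolled[of f 0] by (simp add: periodic_def)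
    show "AE x in lborel. G x = rolled f (x, 0)"
      using AE_lborel_translates[OF f(3)]
    proof eventually_elim
      fix x assume "\<forall>k::int. G (x + 2 * of_int k * pi) = f (x + 2 * of_int k * pi)"
      then have "G (x + 2 * of_int (- \<lfloor>x / (2 * pi)\<rfloor>) * pi) = f (x + 2 * of_int (- \<lfloor>x / (2 * pi)\<rfloor>) * pi)"
        by blast
      moreover have "G (x + 2 * of_int (- \<lfloor>x / (2 * pi)\<rfloor>) * pi) = G x"
        using G(1) by (intro periodic_int) (simp add: periodic_def)
      ultimately show "G x = rolled f (x, 0)" by (simp add: rolled_def algebra_simps)
    qed
  qed
qed

lemma profile_past:
  assumes [measurable]: "G \<in> borel_measurable borel" "v \<in> borel_measurable borel"
    and "\<And>x. \<bar>G x\<bar> \<le> B" "\<And>t. \<bar>v t\<bar> \<le> 1"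
  shows "profile (\<lambda>s. G s - past v s)"
proof
  show "(\<lambda>s. G s - past v s) \<in> borel_measurable borel"
    using measurable_past[OF assms(2)] by measurable
  show "\<exists>B. \<forall>s\<le>T. \<bar>G s - past v s\<bar> \<le> B" for T
  proof (intro exI allI impI)
    fix s assume "s \<le> T"
    then show "\<bar>G s - past v s\<bar> \<le> B + real (nat \<lfloor>T / (2 * pi)\<rfloor>)"
      using assms(3)[of s] past_bound[of v s T, OF assms(4)] by linarith
  qed
qed

text \<open>The source \<open>u = clip r\<close> turns \<open>r (s + 2\<pi>) = r s - u s\<close> into an iteration. It keeps \<open>r\<close> bounded because
  it maps \<open>[-b, b]\<close> into itself for \<open>b \<ge> 1/2\<close>.\<close>

definition iterated_profile :: "(real \<Rightarrow> real) \<Rightarrow> real \<Rightarrow> real" where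
  "iterated_profile G s = ((\<lambda>R. R - clip R) ^^ nat \<lfloor>s / (2 * pi)\<rfloor>) (G s)"

lemma iterated_profile_add_2pi:
  assumes "\<And>x. G (x + 2 * pi) = G x" "0 \<le> s"
  shows "iterated_profile G (s + 2 * pi) = iterated_profile G s - clip (iterated_profile G s)"
proof -
  have "nat \<lfloor>(s + 2 * pi) / (2 * pi)\<rfloor> = Suc (nat \<lfloor>s / (2 * pi)\<rfloor>)"
    using assms(2) by (simp add: add_divide_distrib nat_add_distrib)
  then show ?thesis by (simp add: iterated_profile_def assms(1))
qed

lemma iterated_profile_initial: "s < 2 * pi \<Longrightarrow> iterated_profile G s = G s"
proof -
  assume "s < 2 * pi"
  then have "\<lfloor>s / (2 * pi)\<rfloor> < 1" by (simp add: floor_less_iff)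
  then show ?thesis by (simp add: iterated_profile_def)
qed

lemma iterated_profile_bound:
  assumes "\<And>x. \<bar>G x\<bar> \<le> B"
  shows "\<bar>iterated_profile G s\<bar> \<le> max 1 B"
proof -
  \<comment> \<open>For \<open>\<bar>R\<bar> \<le> 1 / 2\<close> the map is
    \<open>R \<mapsto> - R\<close>; otherwise it moves \<open>R\<close> by 1 towards 0, overshooting
    by less than \<open>1 / 2\<close>.\<close>
  have "\<bar>R - clip R\<bar> \<le> max 1 B" if "\<bar>R\<bar> \<le> max 1 B" for R
    using that by (auto simp: clip_def max_def min_def abs_if split: if_splits)
  then have "\<bar>((\<lambda>R. R - clip R) ^^ n) (G s)\<bar> \<le> max 1 B" for n
    using assms[of s] by (induction n) auto
  then show ?thesis unfolding iterated_profile_def .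
qed

lemma measurable_clip: "clip \<in> borel_measurable borel"
  unfolding clip_def[abs_def] by measurable

lemma profile_iterated_profile:
  assumes [measurable]: "G \<in> borel_measurable borel" and "\<And>x. \<bar>G x\<bar> \<le> B"
  shows "profile (iterated_profile G)"
proof
  note measurable_clip [measurable]
  have floor: "(\<lambda>s::real. nat \<lfloor>s / (2 * pi)\<rfloor>) \<in> borel \<rightarrow>\<^sub>M count_space UNIV" by measurable
  have "(\<lambda>s. ((\<lambda>R. R - clip R) ^^ n) (G s)) \<in> borel_measurable borel" for n
  proof (induction n)
    case (Suc n)
    then have [measurable]: "(\<lambda>s. ((\<lambda>R. R - clip R) ^^ n) (G s)) \<in> borel_measurable borel" .
    show ?case by simp
  qed simp
  from measurable_compose_countable[OF this floor]
  show "iterated_profile G \<in> borel_measurable borel"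
    by (simp add: iterated_profile_def[abs_def])
  show "\<exists>B. \<forall>s\<le>T. \<bar>iterated_profile G s\<bar> \<le> B" for T
    using iterated_profile_bound[of G, OF assms(2)] by blast
qed

subsection \<open>Traces\<close>

lemma AE_lborel_snd:
  fixes P :: "'b::euclidean_space \<Rightarrow> bool"
  assumes "AE y in lborel. P y"
  shows "AE p in lborel. P (snd (p :: 'a::euclidean_space \<times> 'b))"
proof -
  obtain N where N: "N \<in> null_sets lborel" "{y. \<not> P y} \<subseteq> N"
    using assms[unfolded eventually_ae_filter] by auto
  have "(UNIV :: 'a set) \<times> N \<in> null_sets (lborel \<Otimes>\<^sub>M lborel)"
    using null_setsD1[OF N(1)] null_setsD2[OF N(1)] lborel.emeasure_pair_measure_Times[of "UNIV :: 'a set" lborel N]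
    by (intro null_setsI) auto
  then have "AE p in lborel. p \<notin> (UNIV :: 'a set) \<times> N"
    unfolding lborel_prod by (rule AE_not_in)
  then show ?thesis
  proof eventually_elim
    fix p :: "'a \<times> 'b" assume "p \<notin> UNIV \<times> N"
    then show "P (snd p)" using N(2) by (cases p) auto
  qed
qed

text \<open>Passing from sections to the plane needs a measurable exceptional set, so the difference
  is first replaced by a Borel function \<open>D'\<close>, to which Fubini for null sets
  applies.\<close>

lemma AE_if_AE_sections:
  fixes f f' :: "real \<times> real \<Rightarrow> real"
  assumes f: "f \<in> borel_measurable (lebesgue_on (UNIV \<times> {0..}))" "f' \<in> borel_measurable (lebesgue_on (UNIV \<times> {0..}))"
    and AE: "\<And>t. 0 \<le> t \<Longrightarrow> AE x in lborel. f (x, t) = f' (x, t)"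
  shows "AE p in lborel. p \<in> UNIV \<times> {0..} \<longrightarrow> f p = f' p"
proof -
  define D where "D p = (if p \<in> UNIV \<times> {0..} then f p - f' p else 0)" for p
  have S: "UNIV \<times> {0..} \<in> sets (lebesgue :: (real \<times> real) measure)"
    by (auto intro!: sets_completionI_sets borel_Times simp: space_borel[symmetric] simp del: space_borel)
  have "D \<in> borel_measurable lebesgue"
    unfolding D_def using f S by (subst borel_measurable_if) auto
  from completion_ex_borel_measurable_real[OF this] obtain D'
    where D': "D' \<in> borel_measurable borel" "AE p in lborel. D p = D' p" by auto
  have "AE t in lborel. AE x in lborel. D' (x, t) = 0"
    using AE_lborel_sections[OF D'(2)]
  proof eventually_elim
    fix t assume "AE x in lborel. D (x, t) = D' (x, t)"
    moreover have "AE x in lborel. D (x, t) = 0"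
      using AE[of t] by (cases "0 \<le> t") (auto simp: D_def)
    ultimately show "AE x in lborel. D' (x, t) = 0" by eventually_elim simp
  qed
  moreover have sets: "{p \<in> space (lborel \<Otimes>\<^sub>M lborel). D' p = 0} \<in> sets (lborel \<Otimes>\<^sub>M lborel)"
    unfolding lborel_prod using D'(1) by measurable
  ultimately have "AE x in lborel. AE t in lborel. D' (x, t) = 0"
    using lborel_pair.AE_commute[of "\<lambda>x t. D' (x, t) = 0"] by simp
  then have "AE p in lborel \<Otimes>\<^sub>M lborel. D' p = 0"
    by (rule lborel_pair.AE_pair_measure[OF sets])
  with D'(2) show ?thesis
    unfolding lborel_prod by eventually_elim (auto simp: D_def)
qed

lemma profile_shift: "profile r \<Longrightarrow> profile (\<lambda>s. r (s + c))"
proof -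
  assume "profile r"
  then interpret profile r .
  show ?thesis
  proof
    show "(\<lambda>s. r (s + c)) \<in> borel_measurable borel" by measurable
    show "\<exists>B. \<forall>s\<le>T. \<bar>r (s + c)\<bar> \<le> B" for T
      using locally_bounded[of "T + c"] by (meson add_right_mono)
  qed
qed

text \<open>The closed strip contains the line \<open>x = 0\<close>, where \<open>rolled\<close> is
  already on its right-hand branch; this line is a null set.\<close>

lemma AE_rolled_left:
  "AE p in lborel. p \<in> {- 2 * pi..0} \<times> {0..} \<longrightarrow> rolled r p = r (fst p + snd p + 2 * pi)"
proof -
  have "negligible {p :: real \<times> real. p \<bullet> (1, 0) = 0}"
    by (rule negligible_standard_hyperplane) (simp add: Basis_prod_def)
  then have "AE p in lborel. fst (p :: real \<times> real) \<noteq> 0"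
    unfolding AE_lebesgue_iff_lborel[symmetric] eventually_ae_filter_negligible
    by (intro exI[of _ "{p. p \<bullet> (1, 0) = 0}"]) (auto simp: inner_prod_def)
  then show ?thesis
  proof eventually_elim
    fix p :: "real \<times> real" assume "fst p \<noteq> 0"
    then show "p \<in> {- 2 * pi..0} \<times> {0..} \<longrightarrow> rolled r p = r (fst p + snd p + 2 * pi)"
      by (cases p) (auto simp: rolled_neg)
  qed
qed

lemma AE_rolled_right:
  "AE p in lborel. p \<in> {0..<2 * pi} \<times> {0..} \<longrightarrow> rolled r p = r (fst p + snd p)"
  by (rule AE_I2) (auto simp: rolled_nonneg)

text \<open>Existence of the traces, for both sides at once through the choice of \<open>c\<close>:
  a function that is almost everywhere \<open>r (x + t)\<close> on thin strips has the trace
  \<open>r\<close>.\<close>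

lemma mean_congruence:
  assumes "profile r" and c: "\<And>h. h > 0 \<Longrightarrow> - h \<le> c h \<and> c h \<le> 0" and T: "T > 0"
    and g: "\<And>h. 0 < h \<Longrightarrow> h < 2 * pi \<Longrightarrow>
      AE p in lborel. p \<in> {c h..c h + h} \<times> {0..T} \<longrightarrow> g p = r (fst p + snd p)"
  shows "((\<lambda>h. (1 / h) * (LINT p|lebesgue_on ({c h..c h + h} \<times> {0..T}). \<bar>g p - r (snd p)\<bar>))
    \<longlongrightarrow> 0) (at_right 0)"
proof -
  interpret profile r by fact
  have "\<forall>\<^sub>F h in at_right 0. 0 < h \<and> h < 2 * pi"
    by (auto simp: eventually_at_right_field intro!: exI[of _ "2 * pi"])
  then have "\<forall>\<^sub>F h in at_right 0.
      (1 / h) * (LINT p|lebesgue_on ({c h..c h + h} \<times> {0..T}). \<bar>r (fst p + snd p) - r (snd p)\<bar>)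
      = (1 / h) * (LINT p|lebesgue_on ({c h..c h + h} \<times> {0..T}). \<bar>g p - r (snd p)\<bar>)"
  proof eventually_elim
    fix h :: real assume h: "0 < h \<and> h < 2 * pi"
    let ?S = "{c h..c h + h} \<times> {0..T}"
    have S: "?S \<in> sets borel" by (intro borel_Times) auto
    have meas: "(\<lambda>p. \<bar>r (fst p + snd p) - r (snd p)\<bar>) \<in> borel_measurable borel" by measurable
    have "(LINT p|lebesgue_on ?S. \<bar>g p - r (snd p)\<bar>)
        = (LINT p|lborel. indicator ?S p * \<bar>r (fst p + snd p) - r (snd p)\<bar>)"
    proof (rule integral_lebesgue_on_cong_borel[OF S meas])
      show "AE p in lborel. p \<in> ?S \<longrightarrow> \<bar>g p - r (snd p)\<bar> = \<bar>r (fst p + snd p) - r (snd p)\<bar>"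
        using g[of h] h by (auto elim!: eventually_mono)
    qed
    then show "(1 / h) * (LINT p|lebesgue_on ?S. \<bar>r (fst p + snd p) - r (snd p)\<bar>)
        = (1 / h) * (LINT p|lebesgue_on ?S. \<bar>g p - r (snd p)\<bar>)"
      using integral_lebesgue_on_borel[OF S meas] by simp
  qed
  with mean_translation_difference[of c, OF c T] show ?thesis
    by (rule Lim_transform_eventually)
qed

text \<open>The integral \<open>A\<close> of \<open>\<bar>r - \<gamma>\<bar>\<close> over
  \<open>[0, T]\<close> does not involve \<open>x\<close>, so it equals its mean over a strip of
  width \<open>h\<close>. The triangle inequality through \<open>g\<close> bounds it by two means
  that tend to 0 with \<open>h\<close>; hence \<open>A = 0\<close>.\<close>

lemma trace_unique:
  assumes "profile r" and c: "\<And>h. h > 0 \<Longrightarrow> - h \<le> c h \<and> c h \<le> 0" and T: "T > 0"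
    and g: "\<And>h. 0 < h \<Longrightarrow> h < 2 * pi \<Longrightarrow>
      AE p in lborel. p \<in> {c h..c h + h} \<times> {0..T} \<longrightarrow> g p = r (fst p + snd p)"
    and \<gamma>: "\<gamma> \<in> borel_measurable (lebesgue_on {0..})" "bounded (\<gamma> ` {0..})"
    and lim: "((\<lambda>h. (1 / h) * (LINT p|lebesgue_on ({c h..c h + h} \<times> {0..T}). \<bar>g p - \<gamma> (snd p)\<bar>))
      \<longlongrightarrow> 0) (at_right 0)"
  shows "AE t in lborel. t \<in> {0..T} \<longrightarrow> \<gamma> t = r t"
proof -
  interpret profile r by fact
  obtain b where b: "\<And>t. t \<in> {0..} \<Longrightarrow> \<bar>\<gamma> t\<bar> \<le> b"
    using \<gamma>(2) unfolding bounded_iff by auto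
  have "0 \<le> b" using b[of 0] by auto
  have "AE t in lborel. t \<in> {0..} \<longrightarrow> \<bar>\<gamma> t\<bar> \<le> b" using b by auto
  from borel_representative[OF _ \<gamma>(1) this \<open>0 \<le> b\<close>] obtain \<gamma>' where
    [measurable]: "\<gamma>' \<in> borel_measurable borel" and \<gamma>'b: "\<And>t. \<bar>\<gamma>' t\<bar> \<le> b"
    and \<gamma>': "AE t in lborel. t \<in> {0..} \<longrightarrow> \<gamma> t = \<gamma>' t" by auto
  obtain B where B: "\<And>s. s \<le> T + 2 * pi \<Longrightarrow> \<bar>r s\<bar> \<le> B" using locally_bounded by blast
  let ?a = "\<lambda>y. indicator {0..T} y * \<bar>r y - \<gamma>' y\<bar>"
  define A where "A = (LINT y|lborel. ?a y)"
  let ?S = "\<lambda>h. {c h..c h + h} \<times> {0..T}"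
  have key: "A \<le> (1 / h) * (LINT p|lebesgue_on (?S h). \<bar>g p - r (snd p)\<bar>)
      + (1 / h) * (LINT p|lebesgue_on (?S h). \<bar>g p - \<gamma> (snd p)\<bar>)" if h: "0 < h" "h < 2 * pi" for h
  proof -
    have S: "?S h \<in> sets borel" by (intro borel_Times) auto
    have int: "integrable lborel (\<lambda>p. indicator (?S h) p * f p)"
      if "f \<in> borel_measurable borel" "\<And>x y. (x, y) \<in> ?S h \<Longrightarrow> \<bar>f (x, y)\<bar> \<le> 2 * (\<bar>B\<bar> + b)"
      for f :: "real \<times> real \<Rightarrow> real"
    proof (rule integrable_bounded_on_box[of _ "c h" "c h + h" 0 T "2 * (\<bar>B\<bar> + b)"])
      show "(\<lambda>p. indicator (?S h) p * f p) \<in> borel_measurable borel"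
        by (intro borel_measurable_times borel_measurable_indicator S that)
    qed (use that(2) in auto)
    have bound: "\<bar>r (x + y)\<bar> \<le> \<bar>B\<bar>" "\<bar>r y\<bar> \<le> \<bar>B\<bar>" if "(x, y) \<in> ?S h" for x y
      using that B[of "x + y"] B[of y] c[OF h(1)] h by auto
    have "h * A = (LINT x|lborel. indicator {c h..c h + h} x * A)"
      using h by simp
    also have "\<dots> = (LINT x|lborel. LINT y|lborel. indicator (?S h) (x, y) * \<bar>r (snd (x, y)) - \<gamma>' (snd (x, y))\<bar>)"
      unfolding A_def by (intro Bochner_Integration.integral_cong refl) (auto simp: indicator_def)
    also have "\<dots> = (LINT p|lborel. indicator (?S h) p * \<bar>r (snd p) - \<gamma>' (snd p)\<bar>)"
    proof (rule integral_lborel_pair(1)[symmetric], rule int)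
      show "\<bar>\<bar>r (snd (x, y)) - \<gamma>' (snd (x, y))\<bar>\<bar> \<le> 2 * (\<bar>B\<bar> + b)" if "(x, y) \<in> ?S h" for x y
        using bound[OF that] \<gamma>'b[of y] \<open>0 \<le> b\<close> by simp
    qed measurable
    also have "\<dots> \<le> (LINT p|lborel. indicator (?S h) p * \<bar>r (fst p + snd p) - r (snd p)\<bar>
        + indicator (?S h) p * \<bar>r (fst p + snd p) - \<gamma>' (snd p)\<bar>)"
    proof (rule integral_mono)
      show "integrable lborel (\<lambda>p. indicator (?S h) p * \<bar>r (snd p) - \<gamma>' (snd p)\<bar>)"
      proof (rule int)
        show "\<bar>\<bar>r (snd (x, y)) - \<gamma>' (snd (x, y))\<bar>\<bar> \<le> 2 * (\<bar>B\<bar> + b)" if "(x, y) \<in> ?S h" for x y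
          using bound[OF that] \<gamma>'b[of y] \<open>0 \<le> b\<close> by simp
      qed measurable
    next
      show "integrable lborel (\<lambda>p. indicator (?S h) p * \<bar>r (fst p + snd p) - r (snd p)\<bar>
        + indicator (?S h) p * \<bar>r (fst p + snd p) - \<gamma>' (snd p)\<bar>)"
      proof (intro Bochner_Integration.integrable_add int)
        show "\<bar>\<bar>r (fst (x, y) + snd (x, y)) - \<gamma>' (snd (x, y))\<bar>\<bar> \<le> 2 * (\<bar>B\<bar> + b)" if "(x, y) \<in> ?S h" for x y
          using bound[OF that] \<gamma>'b[of y] \<open>0 \<le> b\<close> by simp
        show "\<bar>\<bar>r (fst (x, y) + snd (x, y)) - r (snd (x, y))\<bar>\<bar> \<le> 2 * (\<bar>B\<bar> + b)" if "(x, y) \<in> ?S h" for x y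
          using bound[OF that] \<open>0 \<le> b\<close> by simp
      qed measurable
    next
      fix p show "indicator (?S h) p * \<bar>r (snd p) - \<gamma>' (snd p)\<bar>
        \<le> indicator (?S h) p * \<bar>r (fst p + snd p) - r (snd p)\<bar>
          + indicator (?S h) p * \<bar>r (fst p + snd p) - \<gamma>' (snd p)\<bar>"
        by (cases "p \<in> ?S h") auto
    qed
    also have "\<dots> = (LINT p|lborel. indicator (?S h) p * \<bar>r (fst p + snd p) - r (snd p)\<bar>)
        + (LINT p|lborel. indicator (?S h) p * \<bar>r (fst p + snd p) - \<gamma>' (snd p)\<bar>)"
    proof (intro Bochner_Integration.integral_add int)
        show "\<bar>\<bar>r (fst (x, y) + snd (x, y)) - \<gamma>' (snd (x, y))\<bar>\<bar> \<le> 2 * (\<bar>B\<bar> + b)" if "(x, y) \<in> ?S h" for x y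
          using bound[OF that] \<gamma>'b[of y] \<open>0 \<le> b\<close> by simp
        show "\<bar>\<bar>r (fst (x, y) + snd (x, y)) - r (snd (x, y))\<bar>\<bar> \<le> 2 * (\<bar>B\<bar> + b)" if "(x, y) \<in> ?S h" for x y
          using bound[OF that] \<open>0 \<le> b\<close> by simp
    qed measurable
    also have "(LINT p|lborel. indicator (?S h) p * \<bar>r (fst p + snd p) - r (snd p)\<bar>)
        = (LINT p|lebesgue_on (?S h). \<bar>g p - r (snd p)\<bar>)"
    proof (rule integral_lebesgue_on_cong_borel[OF S, symmetric])
      show "AE p in lborel. p \<in> ?S h \<longrightarrow> \<bar>g p - r (snd p)\<bar> = \<bar>r (fst p + snd p) - r (snd p)\<bar>"
        using g[OF h] by (auto elim!: eventually_mono)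
    qed measurable
    also have "(LINT p|lborel. indicator (?S h) p * \<bar>r (fst p + snd p) - \<gamma>' (snd p)\<bar>)
        = (LINT p|lebesgue_on (?S h). \<bar>g p - \<gamma> (snd p)\<bar>)"
    proof (rule integral_lebesgue_on_cong_borel[OF S, symmetric])
      show "AE p in lborel. p \<in> ?S h \<longrightarrow> \<bar>g p - \<gamma> (snd p)\<bar> = \<bar>r (fst p + snd p) - \<gamma>' (snd p)\<bar>"
        using g[OF h] AE_lborel_snd[OF \<gamma>', where 'a = real] by eventually_elim auto
    qed measurable
    finally show ?thesis using h by (simp add: field_simps)
  qed
  have "((\<lambda>h. (1 / h) * (LINT p|lebesgue_on (?S h). \<bar>g p - r (snd p)\<bar>)
      + (1 / h) * (LINT p|lebesgue_on (?S h). \<bar>g p - \<gamma> (snd p)\<bar>)) \<longlongrightarrow> 0 + 0) (at_right 0)"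
    by (intro tendsto_add lim mean_congruence[OF \<open>profile r\<close> c T g])
  moreover have "\<forall>\<^sub>F h in at_right 0. A \<le> (1 / h) * (LINT p|lebesgue_on (?S h). \<bar>g p - r (snd p)\<bar>)
      + (1 / h) * (LINT p|lebesgue_on (?S h). \<bar>g p - \<gamma> (snd p)\<bar>)"
    using key by (auto simp: eventually_at_right_field intro!: exI[of _ "2 * pi"])
  ultimately have "A \<le> 0 + 0"
    by (rule tendsto_lowerbound) simp
  moreover have "0 \<le> A" unfolding A_def by (intro integral_nonneg_AE) auto
  ultimately have "A = 0" by simp
  moreover have "integrable lborel ?a"
  proof (rule integrable_bounded_on_interval[of _ 0 T "\<bar>B\<bar> + b"])
    show "\<bar>?a y\<bar> \<le> \<bar>B\<bar> + b" if "y \<in> {0..T}" for y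
    proof -
      have "y \<le> T + 2 * pi" using that pi_gt_zero by (auto intro: order_trans[of y T])
      then show ?thesis using B[of y] \<gamma>'b[of y] that by auto
    qed
  qed auto
  ultimately have "AE y in lborel. ?a y = 0"
    unfolding A_def by (subst (asm) integral_nonneg_eq_0_iff_AE) auto
  with \<gamma>' show ?thesis
    by eventually_elim (auto simp: indicator_def)
qed

subsection \<open>Bounded solutions\<close>

lemma half_space_in_sets_lebesgue: "UNIV \<times> {0..} \<in> sets (lebesgue :: (real \<times> real) measure)"
  by (auto intro!: sets_completionI_sets borel_Times simp: space_borel[symmetric] simp del: space_borel)

lemma integrable_against_test_function:
  fixes h K :: "real \<times> real \<Rightarrow> real"
  assumes h: "h \<in> borel_measurable (lebesgue_on (UNIV \<times> {0..}))"
    and bound: "\<exists>B. \<forall>x. \<forall>t\<in>{0..b}. \<bar>h (x, t)\<bar> \<le> B"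
    and K: "K \<in> borel_measurable borel" "0 < a" "\<And>x t. t \<notin> {a..b} \<Longrightarrow> K (x, t) = 0"
      "\<And>x t. x \<in> {0..2 * pi} \<Longrightarrow> \<bar>K (x, t)\<bar> \<le> C"
  shows "integrable (lebesgue_on ({0..2 * pi} \<times> {0<..})) (\<lambda>p. h p * K p)"
proof -
  let ?\<Omega> = "{0..2 * pi} \<times> {0<..} :: (real \<times> real) set" and ?A = "cbox (0, a) (2 * pi, b)"
  have \<Omega>: "?\<Omega> \<in> sets borel" by (intro borel_Times) auto
  have A: "?A \<subseteq> ?\<Omega>" using K(2) by auto
  obtain B where B: "\<And>x t. t \<in> {0..b} \<Longrightarrow> \<bar>h (x, t)\<bar> \<le> B" using bound by blast
  have K_meas: "K \<in> borel_measurable (lebesgue_on ?\<Omega>)"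
    using K(1) by (intro measurable_restrict_space1 measurable_completion) simp
  have h_meas: "h \<in> borel_measurable (lebesgue_on ?\<Omega>)"
    by (rule measurable_restrict_mono[OF h]) auto
  show ?thesis
  proof (rule integrableI_bounded_set[where A = ?A and B = "B * C"])
    show "?A \<in> sets (lebesgue_on ?\<Omega>)"
      using A \<Omega> by (subst sets_restrict_space_iff) auto
    have eq: "emeasure (lebesgue_on ?\<Omega>) ?A = emeasure lborel ?A"
      using A \<Omega> by (subst emeasure_restrict_space) auto
    show "emeasure (lebesgue_on ?\<Omega>) ?A < \<infinity>"
      unfolding eq by (rule emeasure_lborel_cbox_finite)
    show "AE p in lebesgue_on ?\<Omega>. p \<in> ?A \<longrightarrow> norm (h p * K p) \<le> B * C"
    proof (intro AE_I2 impI)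
      fix p assume "p \<in> ?A"
      then obtain x t where p: "p = (x, t)" "x \<in> {0..2 * pi}" "t \<in> {a..b}" by (cases p) auto
      then have "\<bar>h p\<bar> * \<bar>K p\<bar> \<le> B * C"
        using K(2) B[of t x] K(4)[of x t] by (intro mult_mono) (auto intro: order_trans[OF abs_ge_zero])
      then show "norm (h p * K p) \<le> B * C" by (simp add: abs_mult)
    qed
    show "AE p in lebesgue_on ?\<Omega>. p \<notin> ?A \<longrightarrow> h p * K p = 0"
    proof (intro AE_I2 impI)
      fix p assume "p \<in> space (lebesgue_on ?\<Omega>)" "p \<notin> ?A"
      then show "h p * K p = 0" using K(3)[of "snd p" "fst p"] by (cases p) auto
    qed
  qed (intro borel_measurable_times h_meas K_meas)
qed

lemma bounded_solution_source_bound: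
  assumes "bounded_solution G g u"
  shows "AE t in lborel. t \<in> {0..} \<longrightarrow> \<bar>u t\<bar> \<le> 1"
proof -
  obtain \<phi> where "AE t in lebesgue_on {0..}. u t \<in> msign (\<phi> t)"
    using assms unfolding bounded_solution_def by blast
  then have "AE t in lborel. t \<in> {0..} \<longrightarrow> u t \<in> msign (\<phi> t)"
    by (simp add: AE_lebesgue_on_iff)
  then show ?thesis by eventually_elim (auto simp: msign_def split: if_splits)
qed

text \<open>Representatives of the initial function and the source that are Borel, bounded and
  defined everywhere. With them the recursion for \<open>r\<close> holds at every
  \<open>s \<ge> 0\<close>.\<close>

locale borel_data =
  fixes G' u' :: "real \<Rightarrow> real" and B :: real
  assumes G': "G' \<in> borel_measurable borel" "\<And>x. \<bar>G' x\<bar> \<le> B" "\<And>x. G' (x + 2 * pi) = G' x"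
    and u': "u' \<in> borel_measurable borel" "\<And>t. \<bar>u' t\<bar> \<le> 1"
begin

definition r :: "real \<Rightarrow> real" where
  "r s = G' s - past u' s"

lemma profile_r: "profile r"
  using profile_past[OF G'(1) u'(1) G'(2) u'(2)] by (simp add: r_def[abs_def])

sublocale profile r by (rule profile_r)

lemma r_add_2pi: "0 \<le> s \<Longrightarrow> r (s + 2 * pi) = r s - u' s"
  by (simp add: r_def G'(3) past_add_2pi)

text \<open>The jump of \<open>rolled r\<close> at \<open>x = 0\<close> is
  \<open>r s - r (s + 2 * pi) = u' s\<close>, so subtracting \<open>rolled r\<close> from
  \<open>g\<close> removes the source. On the first period the past is empty, so it removes the
  initial value as well.\<close>

lemma solution_eq_rolled:
  assumes sol: "bounded_solution G g u" and G: "AE x in lborel. G x = G' x"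
    and u: "AE t in lborel. t \<in> {0..} \<longrightarrow> u t = u' t"
  shows "0 \<le> t \<Longrightarrow> AE x in lborel. g (x, t) = rolled r (x, t)"
    and "AE p in lborel. p \<in> UNIV \<times> {0..} \<longrightarrow> g p = rolled r p"
proof -
  have g_meas: "g \<in> borel_measurable (lebesgue_on (UNIV \<times> {0..}))"
    and g_section: "\<And>t. 0 \<le> t \<Longrightarrow> (\<lambda>x. g (x, t)) \<in> borel_measurable lebesgue"
    and g_periodic: "\<And>t. 0 \<le> t \<Longrightarrow> periodic (\<lambda>x. g (x, t))"
    and g_bounded: "bounded (g ` (UNIV \<times> {0..}))"
    and g_wave: "wave_equation g u"
    and g_cont: "continuous_into_distributions g"
    and g_initial: "AE x in lborel. g (x, 0) = G x"
    using sol unfolding bounded_solution_def AE_lebesgue_iff_lborel by blast+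
  obtain Bg where Bg: "\<And>x t. 0 \<le> t \<Longrightarrow> \<bar>g (x, t)\<bar> \<le> Bg"
    using g_bounded unfolding bounded_iff by auto
  have g_bound: "\<exists>B. \<forall>x. \<forall>t\<in>{0..T}. \<bar>g (x, t)\<bar> \<le> B" for T
    using Bg by (intro exI[of _ Bg]) simp
  have R_meas: "rolled r \<in> borel_measurable (lebesgue_on (UNIV \<times> {0..}))"
    by (intro measurable_restrict_space1 measurable_completion) simp
  have R_section_borel: "(\<lambda>x. rolled r (x, t)) \<in> borel_measurable borel" for t
    unfolding rolled_def fst_conv snd_conv by measurable
  have R_section: "(\<lambda>x. rolled r (x, t)) \<in> borel_measurable lebesgue" for t
    using R_section_borel by (intro measurable_completion) simp
  have R_bound: "\<exists>B. \<forall>x. \<forall>t\<in>{0..T}. \<bar>rolled r (x, t)\<bar> \<le> B" for T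
  proof -
    obtain B where B: "\<And>s. s \<le> T + 2 * pi \<Longrightarrow> \<bar>r s\<bar> \<le> B" using locally_bounded by blast
    \<comment> \<open>Reduced modulo the period, \<open>x\<close> is below \<open>2 * pi\<close>, so
      \<open>r\<close> is evaluated only where its local bound holds.\<close>
    have "x - 2 * pi * of_int \<lfloor>x / (2 * pi)\<rfloor> + t \<le> T + 2 * pi" if "t \<in> {0..T}" for x t :: real
    proof -
      have "x / (2 * pi) < of_int \<lfloor>x / (2 * pi)\<rfloor> + 1" by linarith
      then have "x < 2 * pi * of_int \<lfloor>x / (2 * pi)\<rfloor> + 2 * pi" by (simp add: field_simps)
      then show ?thesis using that by simp
    qed
    then show ?thesis using B unfolding rolled_def fst_conv snd_conv by blast
  qed
  interpret homogeneous_wave "\<lambda>p. g p - rolled r p"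
  proof
    show "(\<lambda>p. g p - rolled r p) \<in> borel_measurable (lebesgue_on (UNIV \<times> {0..}))"
      by (intro borel_measurable_diff g_meas R_meas)
    show "(\<lambda>x. g (x, t) - rolled r (x, t)) \<in> borel_measurable lebesgue" if "0 \<le> t" for t
      by (intro borel_measurable_diff g_section R_section that)
    show "\<exists>B. \<forall>x. \<forall>t\<in>{0..T}. \<bar>g (x, t) - rolled r (x, t)\<bar> \<le> B" for T
    proof -
      obtain B where B: "\<And>x t. t \<in> {0..T} \<Longrightarrow> \<bar>rolled r (x, t)\<bar> \<le> B" using R_bound by blast
      have "\<bar>g (x, t) - rolled r (x, t)\<bar> \<le> Bg + B" if "t \<in> {0..T}" for x t
        using Bg[of t x] B[OF that, of x] that by auto
      then show ?thesis by blast
    qed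
    show "wave_equation (\<lambda>p. g p - rolled r p) (\<lambda>_. 0)"
      unfolding wave_equation_def
    proof (intro allI impI)
      fix \<psi> assume \<psi>: "test_function \<psi>"
      obtain K a b C where K: "\<And>p. K p = - frechet_derivative \<psi> (at p) (0, 1) + frechet_derivative \<psi> (at p) (1, 0)"
        and K': "K \<in> borel_measurable borel" "0 < a"
        "\<And>x t. t \<notin> {a..b} \<Longrightarrow> K (x, t) = 0"
        "\<And>x t. x \<in> {0..2 * pi} \<Longrightarrow> \<bar>K (x, t)\<bar> \<le> C"
        by (rule test_function_derivative[OF \<psi>]) (rule that; assumption)
      let ?\<Omega> = "{0..2 * pi} \<times> {0<..} :: (real \<times> real) set"
      have \<psi>_meas: "(\<lambda>t. \<psi> (0, t)) \<in> borel_measurable borel"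
        using \<psi> unfolding test_function_def
        by (intro borel_measurable_continuous_onI continuous_on_compose2[OF smooth_imp_continuous[of \<psi> UNIV]]
            continuous_intros) auto
      have "(LINT p|lebesgue_on ?\<Omega>. (g p - rolled r p) * K p)
          = (LINT p|lebesgue_on ?\<Omega>. g p * K p) - (LINT p|lebesgue_on ?\<Omega>. rolled r p * K p)"
        unfolding left_diff_distrib
        by (intro Bochner_Integration.integral_diff integrable_against_test_function[OF _ _ K']
            g_meas R_meas R_bound g_bound)
      also have "(LINT p|lebesgue_on ?\<Omega>. g p * K p) = - (LINT t|lebesgue_on {0<..}. u t * \<psi> (0, t))"
        using g_wave \<psi> unfolding wave_equation_def K by blast
      also have "(LINT p|lebesgue_on ?\<Omega>. rolled r p * K p) = - (LINT t|lebesgue_on {0<..}. (r t - r (t + 2 * pi)) * \<psi> (0, t))"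
        using wave_equation_rolled \<psi> unfolding wave_equation_def K by blast
      also have "(LINT t|lebesgue_on {0<..}. u t * \<psi> (0, t)) = (LINT t|lborel. indicator {0<..} t * (u' t * \<psi> (0, t)))"
      proof (rule integral_lebesgue_on_cong_borel)
        show "AE t in lborel. t \<in> {0<..} \<longrightarrow> u t * \<psi> (0, t) = u' t * \<psi> (0, t)"
          using u by eventually_elim auto
      qed (use u' \<psi>_meas in auto)
      also have "(LINT t|lebesgue_on {0<..}. (r t - r (t + 2 * pi)) * \<psi> (0, t))
          = (LINT t|lborel. indicator {0<..} t * (u' t * \<psi> (0, t)))"
        by (rule integral_lebesgue_on_cong_borel) (use u' \<psi>_meas in \<open>auto simp: r_add_2pi\<close>)
      finally show "(LINT p|lebesgue_on ?\<Omega>. (g p - rolled r p)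
          * (- frechet_derivative \<psi> (at p) (0, 1) + frechet_derivative \<psi> (at p) (1, 0)))
          = - (LINT t|lebesgue_on {0<..}. 0 * \<psi> (0, t))"
        unfolding K by simp
    qed
    show "continuous_into_distributions (\<lambda>p. g p - rolled r p)"
      unfolding continuous_into_distributions_def
    proof (intro allI impI)
      fix \<theta> :: "real \<Rightarrow> real" assume \<theta>: "smooth \<theta> \<and> periodic \<theta>"
      have cont: "continuous_on UNIV \<theta>" using \<theta> smooth_imp_continuous by blast
      have "continuous_on {0..} (\<lambda>t. (LINT x|lebesgue_on {0..2 * pi}. g (x, t) * \<theta> x)
          - (LINT x|lebesgue_on {0..2 * pi}. rolled r (x, t) * \<theta> x))"
        using g_cont continuous_into_distributions_rolled \<theta>
        unfolding continuous_into_distributions_def by (intro continuous_on_diff) auto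
      moreover have "(LINT x|lebesgue_on {0..2 * pi}. g (x, t) * \<theta> x)
          - (LINT x|lebesgue_on {0..2 * pi}. rolled r (x, t) * \<theta> x)
          = (LINT x|lebesgue_on {0..2 * pi}. (g (x, t) - rolled r (x, t)) * \<theta> x)" if t: "t \<in> {0..}" for t
      proof -
        obtain BR where BR: "\<And>x. \<bar>rolled r (x, t)\<bar> \<le> BR" using R_bound[of t] t by force
        have "integrable (lebesgue_on {0..2 * pi}) (\<lambda>x. g (x, t) * \<theta> x)"
          using t Bg by (intro integrable_bounded_times_continuous[OF _ _ cont] g_section) auto
        moreover have "integrable (lebesgue_on {0..2 * pi}) (\<lambda>x. rolled r (x, t) * \<theta> x)"
          by (rule integrable_bounded_times_continuous[OF R_section BR cont])
        ultimately show ?thesis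
          unfolding left_diff_distrib by (rule Bochner_Integration.integral_diff[symmetric])
      qed
      ultimately show "continuous_on {0..} (\<lambda>t. LINT x|lebesgue_on {0..2 * pi}. (g (x, t) - rolled r (x, t)) * \<theta> x)"
        by (rule continuous_on_eq)
    qed
    show "AE x in lborel. x \<in> {0..2 * pi} \<longrightarrow> g (x, 0) - rolled r (x, 0) = 0"
      using g_initial G AE_lborel_singleton[of "2 * pi"]
      by eventually_elim (auto simp: rolled_nonneg r_def past_eq_0)
  qed
  show slice: "AE x in lborel. g (x, t) = rolled r (x, t)" if t: "0 \<le> t" for t
  proof (rule AE_periodic)
    show "AE x in lborel. x \<in> {0..2 * pi} \<longrightarrow> g (x, t) = rolled r (x, t)"
      using section_eq_0[OF t] by eventually_elim simp
    show "(g (x + 2 * pi, t) = rolled r (x + 2 * pi, t)) = (g (x, t) = rolled r (x, t))" for x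
      using g_periodic[OF t] periodic_rolled[of r t] by (simp add: periodic_def)
  qed
  show "AE p in lborel. p \<in> UNIV \<times> {0..} \<longrightarrow> g p = rolled r p"
    by (rule AE_if_AE_sections[OF g_meas R_meas slice])
qed

text \<open>The traces are \<open>r t\<close> and \<open>r (t + 2 * pi) = r t - u' t\<close>; their
  half-sum produces the term \<open>u' t / 2\<close>. Uniqueness of traces is available on bounded
  intervals, hence the exhaustion by \<open>[0, n + 1]\<close>.\<close>

lemma value_at_0_eq:
  assumes sol: "bounded_solution G g u" and G: "AE x in lborel. G x = G' x"
    and u: "AE t in lborel. t \<in> {0..} \<longrightarrow> u t = u' t" and \<phi>: "value_at_0 g \<phi>"
  shows "AE t in lborel. t \<in> {0..} \<longrightarrow> \<phi> t = r t - u' t / 2"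
proof -
  obtain \<alpha> \<beta> where \<alpha>: "trace_right g \<alpha>" and \<beta>: "trace_left g \<beta>"
    and "AE t in lebesgue_on {0..}. \<phi> t = (\<alpha> t + \<beta> t) / 2"
    using \<phi> unfolding value_at_0_def by blast
  then have \<alpha>\<beta>: "AE t in lborel. t \<in> {0..} \<longrightarrow> \<phi> t = (\<alpha> t + \<beta> t) / 2"
    by (subst (asm) AE_lebesgue_on_iff) simp_all
  note g = solution_eq_rolled(2)[OF sol G u]
  have "AE t in lborel. t \<in> {0..real (Suc n)} \<longrightarrow> \<alpha> t = r t" for n
  proof (rule trace_unique[OF profile_r, of "\<lambda>h. 0" _ g])
    show "AE p in lborel. p \<in> {0..0 + h} \<times> {0..real (Suc n)} \<longrightarrow> g p = r (fst p + snd p)" if "0 < h" "h < 2 * pi" for h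
      using g AE_rolled_right[of r] by eventually_elim (use that in auto)
    show "((\<lambda>h. (1 / h) * (LINT p|lebesgue_on ({0..0 + h} \<times> {0..real (Suc n)}). \<bar>g p - \<alpha> (snd p)\<bar>)) \<longlongrightarrow> 0) (at_right 0)"
      using \<alpha> unfolding trace_right_def by simp
  qed (use \<alpha> in \<open>auto simp: trace_right_def\<close>)
  then have "AE t in lborel. \<forall>n. t \<in> {0..real (Suc n)} \<longrightarrow> \<alpha> t = r t"
    unfolding AE_all_countable by blast
  moreover have "AE t in lborel. t \<in> {0..real (Suc n)} \<longrightarrow> \<beta> t = r (t + 2 * pi)" for n
  proof (rule trace_unique[OF profile_shift[OF profile_r], of uminus _ g])
    show "AE p in lborel. p \<in> {- h..- h + h} \<times> {0..real (Suc n)} \<longrightarrow> g p = r (fst p + snd p + 2 * pi)" if "0 < h" "h < 2 * pi" for h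
      using g AE_rolled_left[of r] by eventually_elim (use that in auto)
    show "((\<lambda>h. (1 / h) * (LINT p|lebesgue_on ({- h..- h + h} \<times> {0..real (Suc n)}). \<bar>g p - \<beta> (snd p)\<bar>)) \<longlongrightarrow> 0) (at_right 0)"
      using \<beta> unfolding trace_left_def by simp
  qed (use \<beta> in \<open>auto simp: trace_left_def\<close>)
  then have "AE t in lborel. \<forall>n. t \<in> {0..real (Suc n)} \<longrightarrow> \<beta> t = r (t + 2 * pi)"
    unfolding AE_all_countable by blast
  ultimately show ?thesis
    using \<alpha>\<beta>
  proof eventually_elim
    fix t assume *: "\<forall>n. t \<in> {0..real (Suc n)} \<longrightarrow> \<alpha> t = r t"
      "\<forall>n. t \<in> {0..real (Suc n)} \<longrightarrow> \<beta> t = r (t + 2 * pi)" "t \<in> {0..} \<longrightarrow> \<phi> t = (\<alpha> t + \<beta> t) / 2"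
    show "t \<in> {0..} \<longrightarrow> \<phi> t = r t - u' t / 2"
    proof
      assume t: "t \<in> {0..}"
      obtain n where "t \<le> real n" using real_arch_simple by blast
      then have "t \<in> {0..real (Suc n)}" using t by simp
      with *(1,2) have "\<alpha> t = r t" "\<beta> t = r (t + 2 * pi)" by blast+
      with *(3) t show "\<phi> t = r t - u' t / 2" by (simp add: r_add_2pi)
    qed
  qed
qed

lemma delay_solution_of_bounded_solution:
  assumes sol: "bounded_solution G g u" and G: "AE x in lborel. G x = G' x"
    and u: "AE t in lborel. t \<in> {0..} \<longrightarrow> u t = u' t" and \<phi>: "value_at_0 g \<phi>"
  shows "delay_solution G \<phi> u"
  unfolding delay_solution_def past_def[symmetric]
proof (intro conjI)
  obtain \<alpha> \<beta> where \<alpha>\<beta>: "\<alpha> \<in> borel_measurable (lebesgue_on {0..})" "\<beta> \<in> borel_measurable (lebesgue_on {0..})"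
    and eq: "AE t in lebesgue_on {0..}. \<phi> t = (\<alpha> t + \<beta> t) / 2"
    using \<phi> unfolding value_at_0_def trace_right_def trace_left_def by blast
  show "\<phi> \<in> borel_measurable (lebesgue_on {0..})"
  proof (rule borel_measurable_lebesgue_on_cong_AE)
    show "(\<lambda>t. (\<alpha> t + \<beta> t) / 2) \<in> borel_measurable (lebesgue_on {0..})"
      by (intro borel_measurable_divide borel_measurable_add borel_measurable_const \<alpha>\<beta>)
    show "AE t in lborel. t \<in> {0..} \<longrightarrow> \<phi> t = (\<alpha> t + \<beta> t) / 2"
      using eq by (subst (asm) AE_lebesgue_on_iff) simp_all
  qed simp
  show "u \<in> borel_measurable (lebesgue_on {0..})" using sol by (simp add: bounded_solution_def)
  \<comment> \<open>The value at 0 that carries the sign condition may differ from the given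
    \<open>\<phi>\<close>; both equal \<open>r - u' / 2\<close> almost everywhere, so the condition
    transfers.\<close>
  obtain \<phi>' where \<phi>': "value_at_0 g \<phi>'" and "AE t in lebesgue_on {0..}. u t \<in> msign (\<phi>' t)"
    using sol unfolding bounded_solution_def by blast
  then have sign: "AE t in lborel. t \<in> {0..} \<longrightarrow> u t \<in> msign (\<phi>' t)"
    by (subst (asm) AE_lebesgue_on_iff) simp_all
  have "AE t in lborel. t \<in> {0..} \<longrightarrow> u t \<in> msign (\<phi> t)"
    using sign value_at_0_eq[OF sol G u \<phi>] value_at_0_eq[OF sol G u \<phi>'] by eventually_elim auto
  then show "AE t in lebesgue_on {0..}. u t \<in> msign (\<phi> t)" by (simp add: AE_lebesgue_on_iff)
  have "AE t in lborel. t \<in> {0..} \<longrightarrow> \<phi> t + 1 / 2 * u t + past u t = G t"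
    using value_at_0_eq[OF sol G u \<phi>] AE_lborel_translates[OF u] G
  proof eventually_elim
    fix t assume *: "t \<in> {0..} \<longrightarrow> \<phi> t = r t - u' t / 2"
      "\<forall>k::int. t + 2 * of_int k * pi \<in> {0..} \<longrightarrow> u (t + 2 * of_int k * pi) = u' (t + 2 * of_int k * pi)"
      "G t = G' t"
    have "past u t = past u' t" by (rule past_cong) (use *(2) in auto)
    moreover have "t \<in> {0..} \<longrightarrow> u t = u' t" using spec[OF *(2), of 0] by simp
    ultimately show "t \<in> {0..} \<longrightarrow> \<phi> t + 1 / 2 * u t + past u t = G t"
      using * by (simp add: r_def)
  qed
  then show "AE t in lebesgue_on {0..}. \<phi> t + 1 / 2 * u t + past u t = G t"
    by (simp add: AE_lebesgue_on_iff)
qed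

end

text \<open>With the source \<open>clip r\<close> the traces of the rolled iterated profile average
  to \<open>r - clip r / 2\<close>, for which \<open>clip_in_msign\<close> is exactly the sign
  condition. The iteration supplies the bound uniform in time.\<close>

lemma bounded_solution_exists:
  assumes G': "G' \<in> borel_measurable borel" "\<And>x. \<bar>G' x\<bar> \<le> B" "\<And>x. G' (x + 2 * pi) = G' x"
    and G: "AE x in lborel. G x = G' x"
  shows "\<exists>g u. bounded_solution G g u"
proof -
  define r where "r = iterated_profile G'"
  have profile_r: "profile r" unfolding r_def by (rule profile_iterated_profile[OF G'(1,2)])
  interpret profile r by (rule profile_r)
  define u where "u s = clip (r s)" for s
  have r_add_2pi: "r (s + 2 * pi) = r s - u s" if "0 \<le> s" for s
    using iterated_profile_add_2pi[of G', OF G'(3) that] by (simp add: r_def u_def)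
  have r_bound: "\<bar>r s\<bar> \<le> max 1 B" for s
    unfolding r_def by (rule iterated_profile_bound[OF G'(2)])
  have lebesgue_on_meas: "f \<in> borel_measurable (lebesgue_on S)" if "f \<in> borel_measurable borel"
    for f :: "'a::euclidean_space \<Rightarrow> real" and S
    using that by (intro measurable_restrict_space1 measurable_completion) simp
  have r_bounded: "bounded ((\<lambda>s. r (s + c)) ` {0..})" for c
    unfolding bounded_iff using r_bound by auto
  have right: "trace_right (rolled r) r"
    unfolding trace_right_def
  proof (intro conjI allI impI)
    show "r \<in> borel_measurable (lebesgue_on {0..})" by (rule lebesgue_on_meas) simp
    show "bounded (r ` {0..})" using r_bounded[of 0] by simp
    fix T :: real assume T: "T > 0"
    have "((\<lambda>h. (1 / h) * (LINT p|lebesgue_on ({0..0 + h} \<times> {0..T}). \<bar>rolled r p - r (snd p)\<bar>)) \<longlongrightarrow> 0) (at_right 0)"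
    proof (rule mean_congruence[OF profile_r _ T])
      show "AE p in lborel. p \<in> {0..0 + h} \<times> {0..T} \<longrightarrow> rolled r p = r (fst p + snd p)" if "0 < h" "h < 2 * pi" for h
        using AE_rolled_right[of r] by eventually_elim (use that in auto)
    qed auto
    then show "((\<lambda>h. (1 / h) * (LINT p|lebesgue_on ({0..h} \<times> {0..T}). \<bar>rolled r p - r (snd p)\<bar>)) \<longlongrightarrow> 0) (at_right 0)"
      by simp
  qed
  have left: "trace_left (rolled r) (\<lambda>s. r (s + 2 * pi))"
    unfolding trace_left_def
  proof (intro conjI allI impI)
    show "(\<lambda>s. r (s + 2 * pi)) \<in> borel_measurable (lebesgue_on {0..})" by (rule lebesgue_on_meas) simp
    show "bounded ((\<lambda>s. r (s + 2 * pi)) ` {0..})" by (rule r_bounded)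
    fix T :: real assume T: "T > 0"
    have "((\<lambda>h. (1 / h) * (LINT p|lebesgue_on ({- h..- h + h} \<times> {0..T}). \<bar>rolled r p - r (snd p + 2 * pi)\<bar>)) \<longlongrightarrow> 0) (at_right 0)"
    proof (rule mean_congruence[OF profile_shift[OF profile_r] _ T])
      show "AE p in lborel. p \<in> {- h..- h + h} \<times> {0..T} \<longrightarrow> rolled r p = r (fst p + snd p + 2 * pi)" if "0 < h" "h < 2 * pi" for h
        using AE_rolled_left[of r] by eventually_elim (use that in auto)
    qed auto
    then show "((\<lambda>h. (1 / h) * (LINT p|lebesgue_on ({- h..0} \<times> {0..T}). \<bar>rolled r p - r (snd p + 2 * pi)\<bar>)) \<longlongrightarrow> 0) (at_right 0)"
      by simp
  qed
  have "bounded_solution G (rolled r) u"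
    unfolding bounded_solution_def
  proof (intro conjI allI impI)
    show "periodic (\<lambda>x. rolled r (x, t))" for t by (rule periodic_rolled)
    show "rolled r \<in> borel_measurable (lebesgue_on (UNIV \<times> {0..}))" by (rule lebesgue_on_meas) simp
    have "(\<lambda>x. rolled r (x, t)) \<in> borel_measurable borel" for t
      unfolding rolled_def fst_conv snd_conv by measurable
    then show "(\<lambda>x. rolled r (x, t)) \<in> borel_measurable lebesgue" for t
      by (intro measurable_completion) simp
    show "bounded (rolled r ` (UNIV \<times> {0..}))"
      unfolding bounded_iff rolled_def using r_bound by auto
    show "u \<in> borel_measurable (lebesgue_on {0..})"
      unfolding u_def
      by (intro lebesgue_on_meas measurable_compose[OF measurable_profile measurable_clip])
    have "(LINT t|lebesgue_on {0<..}. (r t - r (t + 2 * pi)) * \<psi> (0, t)) = (LINT t|lebesgue_on {0<..}. u t * \<psi> (0, t))"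
      for \<psi> :: "real \<times> real \<Rightarrow> real"
      by (intro Bochner_Integration.integral_cong refl) (simp add: r_add_2pi)
    then show "wave_equation (rolled r) u"
      using wave_equation_rolled unfolding wave_equation_def by simp
    show "continuous_into_distributions (rolled r)" by (rule continuous_into_distributions_rolled)
    show "\<exists>\<phi>. value_at_0 (rolled r) \<phi> \<and> (AE t in lebesgue_on {0..}. u t \<in> msign (\<phi> t))"
    proof (intro exI conjI)
      show "value_at_0 (rolled r) (\<lambda>t. (r t + r (t + 2 * pi)) / 2)"
        unfolding value_at_0_def using right left by blast
      have "u t \<in> msign ((r t + r (t + 2 * pi)) / 2)" if "0 \<le> t" for t
      proof -
        have "(r t + r (t + 2 * pi)) / 2 = r t - clip (r t) / 2"
          using r_add_2pi[OF that] by (simp add: u_def)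
        then show ?thesis by (simp only: u_def clip_in_msign)
      qed
      then show "AE t in lebesgue_on {0..}. u t \<in> msign ((r t + r (t + 2 * pi)) / 2)"
        by (simp add: AE_lebesgue_on_iff)
    qed
    have "AE x in lborel. rolled r (x, 0) = G' x"
    proof (rule AE_periodic)
      show "AE x in lborel. x \<in> {0..2 * pi} \<longrightarrow> rolled r (x, 0) = G' x"
        using AE_lborel_singleton[of "2 * pi"]
        by eventually_elim (auto simp: rolled_nonneg r_def iterated_profile_initial)
      show "(rolled r (x + 2 * pi, 0) = G' (x + 2 * pi)) = (rolled r (x, 0) = G' x)" for x
        using periodic_rolled[of r 0] G'(3) by (simp add: periodic_def)
    qed
    then show "AE x in lebesgue. rolled r (x, 0) = G x"
      unfolding AE_lebesgue_iff_lborel using G by eventually_elim simp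
  qed
  then show ?thesis by blast
qed

theorem theorem5:
  fixes G :: "real \<Rightarrow> real"
  assumes "periodic G"
    and "G \<in> borel_measurable lebesgue"
    and "bounded (range G)"
  shows "(\<exists>g u. bounded_solution G g u) \<and>
    (\<forall>g u g' u'. bounded_solution G g u \<and> bounded_solution G g' u' \<longrightarrow>
       (AE p in lebesgue_on (UNIV \<times> {0..}). g p = g' p) \<and>
       (\<forall>t\<ge>0. AE x in lebesgue. g (x, t) = g' (x, t)) \<and>
       (AE t in lebesgue_on {0..}. u t = u' t)) \<and>
    (\<forall>g u \<phi>. bounded_solution G g u \<and> value_at_0 g \<phi> \<longrightarrow>
       delay_solution G \<phi> u \<and>
       (\<forall>\<phi>' v'. delay_solution G \<phi>' v' \<longrightarrow>
          (AE t in lebesgue_on {0..}. \<phi>' t = \<phi> t) \<and>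
          (AE t in lebesgue_on {0..}. v' t = u t)))"
proof -
  obtain B where "\<And>x. \<bar>G x\<bar> \<le> B"
    using assms(3) unfolding bounded_iff by auto
  from periodic_borel_representative[OF assms(1,2) this] obtain G' where
    G': "G' \<in> borel_measurable borel" "\<And>x. \<bar>G' x\<bar> \<le> B" "\<And>x. G' (x + 2 * pi) = G' x"
    and G: "AE x in lborel. G x = G' x" by blast
  have data: "\<exists>u'. borel_data G' u' B \<and> (AE t in lborel. t \<in> {0..} \<longrightarrow> u t = u' t)"
    if sol: "bounded_solution G g u" for g u
  proof -
    have "u \<in> borel_measurable (lebesgue_on {0..})" using sol by (simp add: bounded_solution_def)
    from borel_representative[OF _ this bounded_solution_source_bound[OF sol]] obtain u' where
      "u' \<in> borel_measurable borel" "\<And>t. \<bar>u' t\<bar> \<le> 1" "AE t in lborel. t \<in> {0..} \<longrightarrow> u t = u' t"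
      by auto
    then show ?thesis using G' by (auto simp: borel_data_def)
  qed
  have delay: "delay_solution G \<phi> u" if sol: "bounded_solution G g u" and \<phi>: "value_at_0 g \<phi>" for g u \<phi>
  proof -
    obtain u' where "borel_data G' u' B" "AE t in lborel. t \<in> {0..} \<longrightarrow> u t = u' t"
      using data[OF sol] by blast
    then show ?thesis
      using borel_data.delay_solution_of_bounded_solution[OF _ sol G _ \<phi>] by blast
  qed
  have ex_value: "\<exists>\<phi>. value_at_0 g \<phi>" if "bounded_solution G g u" for g u
    using that unfolding bounded_solution_def by blast
  have unique: "(AE p in lebesgue_on (UNIV \<times> {0..}). g p = g' p) \<and>
       (\<forall>t\<ge>0. AE x in lebesgue. g (x, t) = g' (x, t)) \<and>
       (AE t in lebesgue_on {0..}. u t = u' t)"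
    if sol: "bounded_solution G g u" "bounded_solution G g' u'" for g u g' u'
  proof -
    obtain \<phi> \<phi>' where \<phi>: "value_at_0 g \<phi>" "value_at_0 g' \<phi>'" using ex_value sol by blast
    have u: "AE t in lborel. t \<in> {0..} \<longrightarrow> u' t = u t"
      using delay_solution_unique[OF delay[OF sol(1) \<phi>(1)] delay[OF sol(2) \<phi>(2)]]
      by eventually_elim auto
    \<comment> \<open>One representative serves both sources, as the delay equation forces
      \<open>u' = u\<close> almost everywhere; both solutions are then the same rolled
      profile.\<close>
    obtain u0 where data0: "borel_data G' u0 B" and u0: "AE t in lborel. t \<in> {0..} \<longrightarrow> u t = u0 t"
      using data[OF sol(1)] by blast
    have u0': "AE t in lborel. t \<in> {0..} \<longrightarrow> u' t = u0 t"
      using u u0 by eventually_elim auto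
    note eq = borel_data.solution_eq_rolled[OF data0 sol(1) G u0]
      and eq' = borel_data.solution_eq_rolled[OF data0 sol(2) G u0']
    have "AE p in lborel. p \<in> UNIV \<times> {0..} \<longrightarrow> g p = g' p"
      using eq(2) eq'(2) by eventually_elim auto
    moreover have "AE x in lborel. g (x, t) = g' (x, t)" if "0 \<le> t" for t
      using eq(1)[OF that] eq'(1)[OF that] by eventually_elim auto
    moreover have "AE t in lborel. t \<in> {0..} \<longrightarrow> u t = u' t"
      using u by eventually_elim auto
    ultimately show ?thesis
      by (simp add: AE_lebesgue_on_iff half_space_in_sets_lebesgue AE_lebesgue_iff_lborel)
  qed
  have delay_unique: "(AE t in lebesgue_on {0..}. \<phi>' t = \<phi> t) \<and> (AE t in lebesgue_on {0..}. v' t = u t)"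
    if "bounded_solution G g u" "value_at_0 g \<phi>" "delay_solution G \<phi>' v'" for g u \<phi> \<phi>' v'
  proof -
    note eq = delay_solution_unique[OF delay[OF that(1,2)] that(3)]
    have "AE t in lborel. t \<in> {0..} \<longrightarrow> \<phi>' t = \<phi> t" using eq by eventually_elim simp
    moreover have "AE t in lborel. t \<in> {0..} \<longrightarrow> v' t = u t" using eq by eventually_elim simp
    ultimately show ?thesis by (simp add: AE_lebesgue_on_iff)
  qed
  show ?thesis
  proof (intro conjI)
    show "\<exists>g u. bounded_solution G g u" by (rule bounded_solution_exists[OF G' G])
  next
    show "\<forall>g u g' u'. bounded_solution G g u \<and> bounded_solution G g' u' \<longrightarrow>
       (AE p in lebesgue_on (UNIV \<times> {0..}). g p = g' p) \<and>
       (\<forall>t\<ge>0. AE x in lebesgue. g (x, t) = g' (x, t)) \<and>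
       (AE t in lebesgue_on {0..}. u t = u' t)"
      by (intro allI impI, elim conjE) (rule unique)
  next
    show "\<forall>g u \<phi>. bounded_solution G g u \<and> value_at_0 g \<phi> \<longrightarrow>
       delay_solution G \<phi> u \<and>
       (\<forall>\<phi>' v'. delay_solution G \<phi>' v' \<longrightarrow>
          (AE t in lebesgue_on {0..}. \<phi>' t = \<phi> t) \<and>
          (AE t in lebesgue_on {0..}. v' t = u t))"
    proof (intro allI impI, elim conjE)
      fix g u \<phi>
      assume sol: "bounded_solution G g u" "value_at_0 g \<phi>"
      show "delay_solution G \<phi> u \<and>
         (\<forall>\<phi>' v'. delay_solution G \<phi>' v' \<longrightarrow>
          (AE t in lebesgue_on {0..}. \<phi>' t = \<phi> t) \<and>
          (AE t in lebesgue_on {0..}. v' t = u t))"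
        by (intro conjI[OF delay[OF sol]] allI impI delay_unique[OF sol])
    qed
  qed
qed

end
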